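(* Let $0\le\alpha<n$, $m\in\mathbb{N}$, and for $1\le i\le m$ let $0\le\alpha_i<n$ with $\alpha_1+\cdots+\alpha_m=n-\alpha$. Let $A_1,\dots,A_m$ be real $n\times n$ matrices such that each $A_i$ is invertible and $A_i-A_j$ is invertible for all $i\ne j$. Let $k_i\in S_{n-\alpha_i,\infty}\cap H_{n-\alpha_i,\infty}$ for $1\le i\le m$, and let $$T_{\alpha,m}f(x)=\int_{\mathbb{R}^n}k_1(x-A_1y)\,k_2(x-A_2y)\cdots k_m(x-A_my)\,f(y)\,dy .$$ If $\alpha=0$, suppose that $T_{0,m}$ is of strong type $(p_0,p_0)$ for some $1<p_0<\infty$. Let $1<p<\frac n\alpha$ and $\frac1q=\frac1p-\frac\alpha n$. If $w$ is a weight such that $w\in\mathcal{M}_{\alpha,A_i,p,q}\cap\mathcal{M}_{\alpha,A_i,q',p'}$ for $i=1,\dots,m$, then $T_{\alpha,m}$ is bounded from $L^p(w^p)$ to $L^q(w^q)$.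
   Context: Conventions: $n/\alpha=\infty$ if $\alpha=0$; $t'$ is the conjugate exponent of $t$. A weight is a nonnegative function in $L^1_{loc}(\mathbb{R}^n)$; $w_A(x):=w(Ax)$; $v(Q)=\int_Qv$; $L^p(w^p)=L^p(\mathbb{R}^n,w^p\,dx)$. $|x|\sim t$ means $t<|x|\le2t$, and $\|f\|_{\infty,|x|\sim t}$ is the essential supremum of $|f|$ on $\{x:|x|\sim t\}$. $k\in S_{\beta,\infty}$ if there is $C>0$ with $\|k\|_{\infty,|x|\sim t}\le C\,t^{\beta-n}$ for all $t>0$. $k\in H_{\beta,\infty}$ if there are $c>1$ and $C>0$ such that for all $x\in\mathbb{R}^n$ and $R>c|x|$, $$\sum_{l=1}^\infty(2^lR)^{n-\beta}\,\|k(\cdot-x)-k(\cdot)\|_{\infty,|y|\sim2^lR}\le C .$$ The fractional maximal operator is $M_\alpha f(x)=\sup_{Q\ni x}|Q|^{\frac\alpha n-1}\int_Q|f|$ (sup over cubes with sides parallel to the axes). For $1<a\le b<\infty$, a pair of weights $(\mu,\nu)$ belongs to $\mathcal{M}_{\alpha,a,b}$ if $$[\mu,\nu]_{\mathcal{M}_{\alpha,a,b}}=\sup_Q\nu(Q)^{-1/a}\Big(\int_QM_\alpha(\chi_Q\nu)^b\,\mu\Big)^{1/b}<\infty .$$ For an invertible matrix $A$: $w\in\mathcal{M}_{\alpha,A,p,q}$ means $(w_A^q,w^{-p'})\in\mathcal{M}_{\alpha,p,q}$, and $w\in\mathcal{M}_{\alpha,A,q',p'}$ means $(w^{-p'},w_A^q)\in\mathcal{M}_{\alpha,q',p'}$.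 *)

theory Defs
  imports "HOL-Analysis.Analysis" "HOL-Probability.Essential_Supremum"
begin

text \<open>
  Real powers of \<open>[0,\<infinity>]\<close>-valued quantities.  In contrast to \<open>0 powr a = 0\<close> on the reals,
  a negative power of \<open>0\<close> is \<open>\<infinity>\<close>; this matters for negative powers of a weight, whose local
  integrability then forces the weight to be positive almost everywhere.
\<close>

definition epowr :: "ennreal \<Rightarrow> real \<Rightarrow> ennreal" where
  "epowr t a =
     (if a = 0 then 1
      else if t = 0 then (if a > 0 then 0 else top)
      else if t = top then (if a > 0 then top else 0)
      else ennreal (enn2real t powr a))"

definition conj_exp :: "real \<Rightarrow> real" where
  "conj_exp t = t / (t - 1)"

text \<open>
  A weight is a nonnegative locally integrable function; it is taken with values in \<open>[0,\<infinity>]\<close>, where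
  local integrability makes it finite almost everywhere.
\<close>

definition weight :: "(real ^ 'n \<Rightarrow> ennreal) \<Rightarrow> bool" where
  "weight w \<longleftrightarrow> w \<in> borel_measurable lebesgue \<and>
     (\<forall>K. compact K \<longrightarrow> (\<integral>\<^sup>+ x \<in> K. w x \<partial>lebesgue) < top)"

definition cubes :: "(real ^ 'n) set set" where
  "cubes = {cbox a (\<chi> i. a $ i + s) | a s. s > 0}"

text \<open>
  The fractional maximal operator, as a function of \<open>g = \<bar>f\<bar>\<close>.
\<close>

definition frac_max :: "real \<Rightarrow> (real ^ 'n \<Rightarrow> ennreal) \<Rightarrow> real ^ 'n \<Rightarrow> ennreal" where
  "frac_max \<alpha> g x =
     (SUP Q \<in> {Q \<in> cubes. x \<in> Q}.
        ennreal (measure lebesgue Q powr (\<alpha> / real CARD('n) - 1)) * (\<integral>\<^sup>+ y \<in> Q. g y \<partial>lebesgue))"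

definition testing_const ::
    "real \<Rightarrow> real \<Rightarrow> real \<Rightarrow> (real ^ 'n \<Rightarrow> ennreal) \<Rightarrow> (real ^ 'n \<Rightarrow> ennreal) \<Rightarrow> ennreal" where
  "testing_const \<alpha> a b \<mu> \<nu> =
     (SUP Q \<in> cubes.
        epowr (\<integral>\<^sup>+ x \<in> Q. \<nu> x \<partial>lebesgue) (- (1 / a)) *
        epowr (\<integral>\<^sup>+ x \<in> Q. epowr (frac_max \<alpha> (\<lambda>y. \<nu> y * indicator Q y) x) b * \<mu> x \<partial>lebesgue) (1 / b))"

definition testing_class ::
    "real \<Rightarrow> real \<Rightarrow> real \<Rightarrow> ((real ^ 'n \<Rightarrow> ennreal) \<times> (real ^ 'n \<Rightarrow> ennreal)) set" where
  "testing_class \<alpha> a b =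
     {(\<mu>, \<nu>). weight \<mu> \<and> weight \<nu> \<and> testing_const \<alpha> a b \<mu> \<nu> < top}"

text \<open>
  The classes \<open>M\<^bsub>\<alpha>,A,p,q\<^esub>\<close> and \<open>M\<^bsub>\<alpha>,A,q',p'\<^esub>\<close> of weights.  The second one is not the first one with
  \<open>(p, q)\<close> replaced by \<open>(q', p')\<close>: the two weights of the pair are interchanged, but not altered.
\<close>

definition M_class :: "real \<Rightarrow> real ^ 'n ^ 'n \<Rightarrow> real \<Rightarrow> real \<Rightarrow> (real ^ 'n \<Rightarrow> ennreal) set" where
  "M_class \<alpha> A p q =
     {w. (\<lambda>x. epowr (w (A *v x)) q, \<lambda>x. epowr (w x) (- conj_exp p)) \<in> testing_class \<alpha> p q}"

definition M_class_dual :: "real \<Rightarrow> real ^ 'n ^ 'n \<Rightarrow> real \<Rightarrow> real \<Rightarrow> (real ^ 'n \<Rightarrow> ennreal) set" where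
  "M_class_dual \<alpha> A p q =
     {w. (\<lambda>x. epowr (w x) (- conj_exp p), \<lambda>x. epowr (w (A *v x)) q)
           \<in> testing_class \<alpha> (conj_exp q) (conj_exp p)}"

definition annulus :: "real \<Rightarrow> (real ^ 'n) set" where
  "annulus t = {x. t < norm x \<and> norm x \<le> 2 * t}"

definition annulus_norm :: "(real ^ 'n \<Rightarrow> complex) \<Rightarrow> real \<Rightarrow> ennreal" where
  "annulus_norm f t = esssup (restrict_space lebesgue (annulus t)) (\<lambda>x. ennreal (norm (f x)))"

definition S_inf :: "real \<Rightarrow> (real ^ 'n \<Rightarrow> complex) set" where
  "S_inf \<beta> = {k. k \<in> borel_measurable lebesgue \<and>
     (\<exists>C>0. \<forall>t>0. annulus_norm k t \<le> ennreal (C * t powr (\<beta> - real CARD('n))))}"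

definition H_inf :: "real \<Rightarrow> (real ^ 'n \<Rightarrow> complex) set" where
  "H_inf \<beta> = {k. k \<in> borel_measurable lebesgue \<and>
     (\<exists>c>1. \<exists>C>0. \<forall>x R. R > c * norm x \<longrightarrow>
        (\<Sum>l. ennreal ((2 ^ Suc l * R) powr (real CARD('n) - \<beta>)) *
              annulus_norm (\<lambda>y. k (y - x) - k y) (2 ^ Suc l * R)) \<le> ennreal C)}"

definition wLp_norm :: "real \<Rightarrow> (real ^ 'n \<Rightarrow> ennreal) \<Rightarrow> (real ^ 'n \<Rightarrow> complex) \<Rightarrow> ennreal" where
  "wLp_norm p u f = epowr (\<integral>\<^sup>+ x. ennreal (norm (f x) powr p) * u x \<partial>lebesgue) (1 / p)"

definition wLp :: "real \<Rightarrow> (real ^ 'n \<Rightarrow> ennreal) \<Rightarrow> (real ^ 'n \<Rightarrow> complex) set" where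
  "wLp p u = {f \<in> borel_measurable lebesgue. wLp_norm p u f < top}"

text \<open>
  Since the Bochner integral of a non-integrable function is \<open>0\<close>, boundedness of an integral
  operator from \<open>L\<^sup>p(u)\<close> to \<open>L\<^sup>q(v)\<close> includes the requirement that, for each \<open>f\<close> in \<open>L\<^sup>p(u)\<close>, the
  defining integral converges absolutely at almost every point.
\<close>

definition int_op ::
    "(real ^ 'n \<Rightarrow> real ^ 'n \<Rightarrow> complex) \<Rightarrow> (real ^ 'n \<Rightarrow> complex) \<Rightarrow> real ^ 'n \<Rightarrow> complex" where
  "int_op K f x = (LINT y|lebesgue. K x y * f y)"

definition int_op_bounded ::
    "(real ^ 'n \<Rightarrow> real ^ 'n \<Rightarrow> complex) \<Rightarrow> real \<Rightarrow> (real ^ 'n \<Rightarrow> ennreal) \<Rightarrow>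
     real \<Rightarrow> (real ^ 'n \<Rightarrow> ennreal) \<Rightarrow> bool" where
  "int_op_bounded K p u q v \<longleftrightarrow>
     (\<exists>C::real. \<forall>f \<in> wLp p u.
        (AE x in lebesgue. integrable lebesgue (\<lambda>y. K x y * f y)) \<and>
        int_op K f \<in> wLp q v \<and>
        wLp_norm q v (int_op K f) \<le> ennreal C * wLp_norm p u f)"

definition prod_kernel ::
    "nat \<Rightarrow> (nat \<Rightarrow> real ^ 'n ^ 'n) \<Rightarrow> (nat \<Rightarrow> real ^ 'n \<Rightarrow> complex) \<Rightarrow>
     real ^ 'n \<Rightarrow> real ^ 'n \<Rightarrow> complex" where
  "prod_kernel m A k x y = (\<Prod>i = 1..m. k i (x - A i *v y))"

end

theory Submission
  imports Defs
begin

text \<open>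
  The size condition bounds the kernel by \<open>\<Prod>\<^sub>i \<bar>x - A\<^sub>i y\<bar>\<close> to the powers \<open>- \<alpha>\<^sub>i\<close>, and since only one factor
  can be small compared with \<open>max \<bar>x\<bar> \<bar>y\<bar>\<close>, this is at most a sum over \<open>i\<close> of positive kernels in
  \<open>x' = A\<^sub>i\<^sup>-\<^sup>1 x\<close> and \<open>y\<close>: the Riesz kernel \<open>\<bar>x' - y\<bar>\<close> to the power \<open>\<alpha> - n\<close> if \<open>\<alpha> > 0\<close>, and
  \<open>max \<bar>x'\<bar> \<bar>y\<bar>\<close> to the power \<open>- \<delta>\<close> times \<open>\<bar>x' - y\<bar>\<close> to the power \<open>\<delta> - n\<close>, for some \<open>\<delta> > 0\<close>, if \<open>\<alpha> = 0\<close>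
  (as every \<open>\<alpha>\<^sub>i < n\<close>, the singularities off the origin are integrable, so no cancellation is needed).
  It remains to bound these positive operators from \<open>L\<^sup>p(\<sigma>)\<close> to \<open>L\<^sup>q(\<mu>)\<close> for \<open>\<sigma>\<close> and \<open>\<mu>\<close> the powers
  \<open>- p'\<close> of \<open>w\<close> and \<open>q\<close> of \<open>w \<circ> A\<^sub>i\<close>.

  By the one-third trick they are dominated by finitely many dyadic operators
  \<open>\<Sum>\<^sub>Q \<lambda>\<^sub>Q (\<integral>\<^sub>Q f d\<sigma>) 1\<^sub>Q\<close>. The testing conditions on the maximal operator imply those on these sums:
  for \<open>p < q\<close>, and also for the cubes that contain the origin, one groups the cubes by the size of
  \<open>\<sigma>(Q)\<close> and sums a geometric series, while for \<open>\<alpha> = 0\<close> the coefficients of the cubes away from the origin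
  are summable at each point. A parallel corona argument then gives the bilinear bound: the cubes are
  divided according to which of the averages of \<open>f\<close> and \<open>g\<close> has been stable for longer, and Young's
  inequality and the dyadic maximal theorem conclude.
\<close>

section \<open>Powers and dyadic sums in the extended half-line\<close>

text \<open>For \<alpha> = 0 one has p = q, and this is the obstacle. If \<Omega> is the union of
  the cells considered, those with \<sigma>(Q) near 2^a contribute about 2^(a (q/p - 1))
  \<sigma>(\<Omega>), and without a positive exponent the series over a diverges. The factor with
  exponent -\<delta> removes this: a cube of side r at distance d \<ge> r from the origin gets the
  coefficient (r/d)^\<delta>, which is summable over the cubes through a point. What remains is the
  nested chain of cubes around the origin, where the union of a group has measure about 2^a instead
  of \<sigma>(\<Omega>), so that the exponent becomes q/p. The testing condition for sums is
  formulated for arbitrary families of cells, with the measure of their union on the right. The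
  corona argument can then apply it at once to all cells on which f has a given level, and running
  maxima of averages take the place of selected stopping cubes. Only finitely many generations occur
  at a time; the constants do not depend on their number, so the full operators follow by monotone
  convergence.\<close>

lemma epowr_zero: "r > 0 \<Longrightarrow> epowr 0 r = 0"
  by (simp add: epowr_def)

lemma epowr_top: "r > 0 \<Longrightarrow> epowr top r = top"
  by (simp add: epowr_def)

lemma epowr_ennreal: "r > 0 \<Longrightarrow> x \<ge> 0 \<Longrightarrow> epowr (ennreal x) r = ennreal (x powr r)"
  by (simp add: epowr_def)

lemma epowr_ennreal_pos: "x > 0 \<Longrightarrow> epowr (ennreal x) r = ennreal (x powr r)"
  by (simp add: epowr_def)

lemma epowr_0_right: "epowr x 0 = 1"
  by (simp add: epowr_def)

lemma epowr_1_right: "epowr x 1 = x"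
  by (cases x) (auto simp: epowr_def)

lemma epowr_one_left: "epowr 1 r = 1"
  by (auto simp: epowr_def)

lemma epowr_mono: "r \<ge> 0 \<Longrightarrow> x \<le> y \<Longrightarrow> epowr x r \<le> epowr y r"
  by (cases x; cases y; cases "r = 0")
     (auto simp: epowr_ennreal epowr_top epowr_0_right ennreal_le_iff2 top_unique intro!: powr_mono2 ennreal_leI)

lemma epowr_mult: "r \<ge> 0 \<Longrightarrow> epowr (x * y) r = epowr x r * epowr y r"
proof (cases "r = 0")
  case False
  assume "r \<ge> 0" with False have r: "r > 0" by simp
  have pos: "epowr z r \<noteq> 0" if "z \<noteq> 0" for z
    using that r by (cases z) (auto simp: epowr_ennreal epowr_top)
  show ?thesis
  proof (cases "x = 0 \<or> y = 0")
    case True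
    then show ?thesis using r by (auto simp: epowr_zero)
  next
    case F: False
    show ?thesis
    proof (cases "x = top \<or> y = top")
      case True
      then show ?thesis
        using F r pos[of x] pos[of y] by (auto simp: epowr_top ennreal_top_mult ennreal_mult_top)
    next
      case False
      then obtain a b where "x = ennreal a" "y = ennreal b" "a \<ge> 0" "b \<ge> 0"
        by (cases x; cases y) auto
      then show ?thesis
        using r by (simp add: epowr_ennreal ennreal_mult[symmetric] powr_mult)
    qed
  qed
qed (simp add: epowr_0_right)

lemma epowr_epowr: "a > 0 \<Longrightarrow> b > 0 \<Longrightarrow> epowr (epowr x a) b = epowr x (a * b)"
  by (cases x) (auto simp: epowr_ennreal epowr_top powr_powr)

text \<open>The signs matter: for x = 0, a = 1 and b = -1 the left side is 1 and the right side is 0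
  times \<infinity>, that is 0. Negative exponents are covered by \<open>epowr_add_pos\<close>, away
  from 0 and \<infinity>.\<close>

lemma epowr_add: "a \<ge> 0 \<Longrightarrow> b \<ge> 0 \<Longrightarrow> epowr x (a + b) = epowr x a * epowr x b"
  by (cases x; cases "a = 0"; cases "b = 0")
     (auto simp: epowr_ennreal epowr_top epowr_0_right powr_add ennreal_mult)

lemma epowr_add_pos: "0 < x \<Longrightarrow> x < top \<Longrightarrow> epowr x (a + b) = epowr x a * epowr x b"
  by (cases x) (auto simp: epowr_ennreal_pos powr_add ennreal_mult)

lemma epowr_epowr_pos: "0 < x \<Longrightarrow> x < top \<Longrightarrow> epowr (epowr x a) b = epowr x (a * b)"
  by (cases x) (auto simp: epowr_ennreal_pos powr_powr)

lemma epowr_less_top: "r \<ge> 0 \<Longrightarrow> x < top \<Longrightarrow> epowr x r < top"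
  by (cases x; cases "r = 0") (auto simp: epowr_ennreal epowr_0_right)

lemma epowr_eq_0_iff: "r > 0 \<Longrightarrow> epowr x r = 0 \<longleftrightarrow> x = 0"
  by (cases x) (auto simp: epowr_ennreal epowr_top)

lemma epowr_eq_top_iff: "r > 0 \<Longrightarrow> epowr x r = top \<longleftrightarrow> x = top"
  by (cases x) (auto simp: epowr_ennreal epowr_top)

lemma epowr_le_swap: "r > 0 \<Longrightarrow> epowr x r \<le> y \<longleftrightarrow> x \<le> epowr y (1 / r)"
  using epowr_mono[of "1/r" "epowr x r" y] epowr_mono[of r x "epowr y (1/r)"]
  by (auto simp: epowr_epowr epowr_1_right)

lemma borel_measurable_epowr [measurable (raw)]:
  assumes [measurable]: "f \<in> borel_measurable M"
  shows "(\<lambda>x. epowr (f x) r) \<in> borel_measurable M"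
  unfolding epowr_def by measurable

lemma epowr_SUP:
  assumes "r > 0" shows "epowr (SUP i\<in>I. X i) r = (SUP i\<in>I. epowr (X i) r)"
proof (rule antisym)
  show "epowr (SUP i\<in>I. X i) r \<le> (SUP i\<in>I. epowr (X i) r)"
    unfolding epowr_le_swap[OF assms]
    by (rule SUP_least) (auto simp: epowr_le_swap[OF assms, symmetric] intro: SUP_upper)
  show "(SUP i\<in>I. epowr (X i) r) \<le> epowr (SUP i\<in>I. X i) r"
    by (rule SUP_least) (use assms in \<open>auto intro!: epowr_mono SUP_upper\<close>)
qed

text \<open>The sum is at most \<open>card I\<close> times its largest term, whose power is one of
  the summands on the right.\<close>

lemma epowr_sum_le:
  assumes "r > 0" "finite I"
  shows "epowr (\<Sum>i\<in>I. x i) r \<le> ennreal (real (card I) powr r) * (\<Sum>i\<in>I. epowr (x i) r)"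
proof (cases "I = {}")
  case False
  define m where "m = Max (x ` I)"
  have "m \<in> x ` I"
    unfolding m_def using False assms(2) by (intro Max_in) auto
  then obtain i where i: "i \<in> I" "x i = m"
    by blast
  have "(\<Sum>i\<in>I. x i) \<le> of_nat (card I) * m"
    by (rule sum_bounded_above) (use assms(2) in \<open>auto simp: m_def\<close>)
  hence "epowr (\<Sum>i\<in>I. x i) r \<le> epowr (ennreal (real (card I)) * m) r"
    using assms by (intro epowr_mono) (auto simp: ennreal_of_nat_eq_real_of_nat)
  also have "\<dots> = ennreal (real (card I) powr r) * epowr (x i) r"
    using assms i by (simp add: epowr_mult epowr_ennreal)
  also have "\<dots> \<le> ennreal (real (card I) powr r) * (\<Sum>i\<in>I. epowr (x i) r)"
    using assms(2) i by (intro mult_left_mono member_le_sum) auto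
  finally show ?thesis .
qed (use assms in \<open>simp add: epowr_zero\<close>)

section \<open>Conjugate exponents and Young's inequality\<close>

definition dual_exp :: "real \<Rightarrow> real \<Rightarrow> bool" where
  "dual_exp p q \<longleftrightarrow> 1 < p \<and> 1 < q \<and> 1 / p + 1 / q = 1"

lemma dual_expD:
  assumes "dual_exp p q"
  shows "1 < p" "1 < q" "(p - 1) * q = p" "(q - 1) * p = q" "(p - 1) * (q - 1) = 1"
proof -
  show "1 < p" "1 < q" using assms by (auto simp: dual_exp_def)
  then have "p + q = p * q"
  proof -
    have "p * q * (1 / p + 1 / q) = q + p"
      using \<open>1 < p\<close> \<open>1 < q\<close> by (simp add: distrib_left)
    moreover have "1 / p + 1 / q = 1" using assms by (simp add: dual_exp_def)
    ultimately show ?thesis by simp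
  qed
  then show "(p - 1) * q = p" "(q - 1) * p = q" "(p - 1) * (q - 1) = 1"
    by (simp_all add: left_diff_distrib right_diff_distrib mult.commute)
qed

lemma dual_exp_sym: "dual_exp p q \<Longrightarrow> dual_exp q p"
  by (simp add: dual_exp_def)

lemma dual_exp_conj: "1 < p \<Longrightarrow> dual_exp p (conj_exp p)"
  by (simp add: dual_exp_def conj_exp_def diff_divide_distrib)

text \<open>Either \<open>y \<le> x\<^sup>p\<^sup>-\<^sup>1\<close>, and \<open>xy \<le> x\<^sup>p\<close>, or the reverse, and \<open>xy \<le> y\<^sup>q\<close>.\<close>

lemma mult_le_epowr_add:
  assumes "dual_exp p q"
  shows "x * y \<le> epowr x p + epowr y q"
proof (cases "y \<le> epowr x (p - 1)")
  case True
  have "x * y \<le> epowr x 1 * epowr x (p - 1)"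
    using True by (intro mult_mono) (auto simp: epowr_1_right)
  also have "\<dots> = epowr x p"
    using dual_expD[OF assms] by (subst epowr_add[symmetric]) auto
  finally show ?thesis by (simp add: add_increasing2)
next
  case False
  have "x = epowr (epowr x (p - 1)) (q - 1)"
    using dual_expD[OF assms] by (simp add: epowr_epowr epowr_1_right)
  also have "\<dots> \<le> epowr y (q - 1)"
    using False dual_expD[OF assms] by (intro epowr_mono) auto
  finally have "x * y \<le> epowr y (q - 1) * epowr y 1"
    by (intro mult_mono) (auto simp: epowr_1_right)
  also have "\<dots> = epowr y q"
    using dual_expD[OF assms] by (subst epowr_add[symmetric]) auto
  finally show ?thesis by (simp add: add_increasing)
qed

section \<open>Powers of two, dyadic levels and geometric series\<close>

definition pow2 :: "real \<Rightarrow> ennreal" where "pow2 r = ennreal (2 powr r)"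

lemma pow2_pos: "0 < pow2 r" and pow2_less_top: "pow2 r < top"
  by (auto simp: pow2_def)

lemma pow2_add: "pow2 (a + b) = pow2 a * pow2 b"
  by (simp add: pow2_def powr_add ennreal_mult)

lemma epowr_pow2: "epowr (pow2 a) r = pow2 (a * r)"
  by (simp add: pow2_def epowr_ennreal_pos powr_powr)

lemma pow2_le_iff: "pow2 a \<le> pow2 b \<longleftrightarrow> a \<le> b"
  by (simp add: pow2_def ennreal_le_iff)

text \<open>The dyadic level of a quantity in (0, \<infinity>). At 0 and \<infinity> its value
  carries no meaning, hence the positivity and finiteness conditions wherever it is used.\<close>

definition lev :: "ennreal \<Rightarrow> int" where "lev t = \<lfloor>log 2 (enn2real t)\<rfloor>"

lemma lev_bounds:
  assumes "0 < t" "t < top"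
  shows "pow2 (lev t) \<le> t" "t < pow2 (lev t + 1)"
proof -
  obtain r where r: "t = ennreal r" "r > 0"
    using assms by (cases t) auto
  have "2 powr (lev t) \<le> r \<and> r < 2 powr (lev t + 1)"
    using r by (simp add: lev_def le_log_iff[symmetric] log_less_iff[symmetric])
  with r show "pow2 (lev t) \<le> t" "t < pow2 (lev t + 1)"
    by (auto simp: pow2_def ennreal_less_iff)
qed

lemma le_lev_iff:
  assumes "0 < t" "t < top"
  shows "i \<le> lev t \<longleftrightarrow> pow2 (of_int i) \<le> t"
proof -
  obtain r where r: "t = ennreal r" "r > 0"
    using assms by (cases t) auto
  then show ?thesis
    by (simp add: lev_def le_floor_iff pow2_def le_log_iff)
qed

text \<open>Sums over all integers are written as integrals against counting measure, so that
  Tonelli's theorem and monotonicity apply to them directly.\<close>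

abbreviation isum :: "(int \<Rightarrow> ennreal) \<Rightarrow> ennreal" where
  "isum f \<equiv> \<integral>\<^sup>+ i. f i \<partial>count_space UNIV"

lemma sum_le_isum:
  assumes "finite I" "\<And>i. i \<in> I \<Longrightarrow> f i \<le> g i"
  shows "sum f I \<le> isum g"
proof -
  have "sum f I = isum (\<lambda>i. f i * indicator I i)"
    using assms(1) by (subst nn_integral_count_space'[where A = I]) auto
  also have "\<dots> \<le> isum g"
    using assms(2) by (intro nn_integral_mono) (auto simp: indicator_def)
  finally show ?thesis .
qed

text \<open>For \<theta> > 0, the value of the geometric series with ratio 2^(-\<theta>).\<close>

definition geoC :: "real \<Rightarrow> real" where
  "geoC \<theta> = 1 / (1 - 2 powr (- \<theta>))"

lemma geoC_pos: "\<theta> > 0 \<Longrightarrow> geoC \<theta> > 0"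
  using powr_less_mono[of "- \<theta>" 0 2] by (simp add: geoC_def)

text \<open>Only i \<le> \<open>lev t\<close> contributes; the largest term is at most t^\<theta>,
  and going down from it the terms decrease by the factor 2^(-\<theta>).\<close>

lemma isum_pow2_le:
  assumes "\<theta> > 0"
  shows "isum (\<lambda>i. pow2 (real_of_int i * \<theta>) * of_bool (pow2 (of_int i) \<le> t)) \<le> ennreal (geoC \<theta>) * epowr t \<theta>"
proof -
  define \<rho> where "\<rho> = (2::real) powr (- \<theta>)"
  have \<rho>: "0 < \<rho>" "\<rho> < 1" using assms powr_less_mono[of "-\<theta>" 0 2] by (auto simp: \<rho>_def)
  have geo: "(\<Sum>n. ennreal (\<rho> ^ n)) = ennreal (1 / (1 - \<rho>))"
    using \<rho> by (subst suminf_ennreal2) (auto simp: suminf_geometric summable_geometric)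
  have G: "ennreal (geoC \<theta>) = ennreal (1 / (1 - \<rho>))"
    by (simp add: geoC_def \<rho>_def)
  show ?thesis unfolding G
  proof -
    let ?L = "isum (\<lambda>i. pow2 (real_of_int i * \<theta>) * of_bool (pow2 (of_int i) \<le> t))"
    consider "t = 0" | "t = top" | "0 < t" "t < top"
      by (metis not_gr_zero less_top)
    then show "?L \<le> ennreal (1 / (1 - \<rho>)) * epowr t \<theta>"
    proof cases
      case 1
      have "pow2 (of_int i) \<noteq> 0" for i using pow2_pos[of "of_int i"] by simp
      then show ?thesis using 1 by simp
    next
      case 2
      then show ?thesis using \<rho> assms by (simp add: epowr_top ennreal_mult_top)
    next
      case 3
      have bij: "bij_betw (\<lambda>n::nat. lev t - int n) UNIV {..lev t}"
        by (rule bij_betw_byWitness[where f' = "\<lambda>i. nat (lev t - i)"]) auto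
      have "?L = isum (\<lambda>i. pow2 (real_of_int i * \<theta>) * indicator {..lev t} i)"
        by (intro nn_integral_cong) (auto simp: le_lev_iff[OF 3, symmetric] indicator_def)
      also have "\<dots> = (\<integral>\<^sup>+ i. pow2 (real_of_int i * \<theta>) \<partial>count_space {..lev t})"
        by (subst nn_integral_count_space_indicator) auto
      also have "\<dots> = (\<integral>\<^sup>+ n. pow2 (real_of_int (lev t - int n) * \<theta>) \<partial>count_space (UNIV :: nat set))"
        by (rule nn_integral_bij_count_space[OF bij, symmetric])
      also have "\<dots> = (\<Sum>n. pow2 (real_of_int (lev t) * \<theta>) * ennreal (\<rho> ^ n))"
        unfolding nn_integral_count_space_nat
      proof (intro suminf_cong)
        fix n
        have "2 powr (real_of_int (lev t - int n) * \<theta>) = 2 powr (real_of_int (lev t) * \<theta>) * \<rho> ^ n"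
          by (simp add: \<rho>_def powr_realpow[symmetric] powr_powr powr_add[symmetric] algebra_simps)
        then show "pow2 (real_of_int (lev t - int n) * \<theta>) = pow2 (real_of_int (lev t) * \<theta>) * ennreal (\<rho> ^ n)"
          using \<rho> by (simp add: pow2_def ennreal_mult[symmetric])
      qed
      also have "\<dots> = pow2 (real_of_int (lev t) * \<theta>) * ennreal (1 / (1 - \<rho>))"
        by (simp add: geo)
      also have "\<dots> \<le> epowr t \<theta> * ennreal (1 / (1 - \<rho>))"
        using lev_bounds(1)[OF 3] assms
        by (intro mult_right_mono) (auto simp: epowr_pow2[symmetric] intro!: epowr_mono)
      finally show ?thesis by (simp add: mult.commute)
    qed
  qed
qed

section \<open>Filtrations by countable partitions\<close>

lemma isum_member_le: "f i \<le> isum f"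
  using sum_le_isum[of "{i}" f f] by simp

text \<open>Pointwise core of the corona argument; \<open>i k\<close> and \<open>j k\<close> will be
  the dyadic levels of the running maxima of f and g at one point. For each level n of f only the
  largest level \<open>J n\<close> of g occurring with it is kept. Since j determines i, J is
  injective, so after Young's inequality with exponents q and q' every level of g is paid for at
  most once.\<close>

lemma sum_mult_pow2_le:
  fixes i j :: "nat \<Rightarrow> int"
  assumes K: "finite K" and q: "dual_exp q q'"
    and ij: "\<And>k l. k \<in> K \<Longrightarrow> l \<in> K \<Longrightarrow> j k = j l \<Longrightarrow> i k = i l"
  shows "(\<Sum>k\<in>K. \<tau> k * (pow2 (i k) * pow2 (j k)))
    \<le> (\<Sum>n\<in>i ` K. epowr (pow2 n * (\<Sum>k | k \<in> K \<and> i k = n. \<tau> k)) q) + (\<Sum>m\<in>j ` K. pow2 (of_int m * q'))"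
proof -
  define J where "J n = Max (j ` {k \<in> K. i k = n})" for n
  have J: "\<exists>k\<in>K. i k = n \<and> j k = J n" if "n \<in> i ` K" for n
  proof -
    have "J n \<in> j ` {k \<in> K. i k = n}"
      unfolding J_def using that K by (intro Max_in) auto
    then obtain k where "k \<in> K" "i k = n" "J n = j k" by blast
    then show ?thesis by metis
  qed
  have J_le: "pow2 (j k) \<le> pow2 (J (i k))" if "k \<in> K" for k
    unfolding J_def pow2_le_iff of_int_le_iff using that K by (intro Max_ge) auto
  have inj: "inj_on J (i ` K)"
  proof (rule inj_onI)
    fix m n assume mn: "m \<in> i ` K" "n \<in> i ` K" "J m = J n"
    obtain k where k: "k \<in> K" "i k = m" "j k = J m" using J[OF mn(1)] by blast
    obtain l where l: "l \<in> K" "i l = n" "j l = J n" using J[OF mn(2)] by blast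
    show "m = n" using ij[OF k(1) l(1)] k l mn(3) by simp
  qed
  have sub: "J ` i ` K \<subseteq> j ` K"
  proof
    fix m assume "m \<in> J ` i ` K"
    then obtain n where n: "n \<in> i ` K" "m = J n" by blast
    obtain k where "k \<in> K" "j k = J n" using J[OF n(1)] by blast
    then show "m \<in> j ` K" using n(2) by (metis imageI)
  qed
  let ?T = "\<lambda>n. \<Sum>k | k \<in> K \<and> i k = n. \<tau> k"
  have "(\<Sum>k\<in>K. \<tau> k * (pow2 (i k) * pow2 (j k))) \<le> (\<Sum>k\<in>K. \<tau> k * (pow2 (i k) * pow2 (J (i k))))"
    using J_le by (intro sum_mono mult_left_mono) auto
  also have "\<dots> = (\<Sum>n\<in>i ` K. \<Sum>k | k \<in> K \<and> i k = n. \<tau> k * (pow2 (i k) * pow2 (J (i k))))"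
    using K by (intro sum.group[symmetric]) auto
  also have "\<dots> = (\<Sum>n\<in>i ` K. ?T n * (pow2 n * pow2 (J n)))"
    by (simp add: sum_distrib_right)
  also have "\<dots> \<le> (\<Sum>n\<in>i ` K. epowr (pow2 n * ?T n) q + epowr (pow2 (J n)) q')"
  proof (rule sum_mono)
    fix n
    have "?T n * (pow2 n * pow2 (J n)) = (pow2 n * ?T n) * pow2 (J n)"
      by (simp only: mult_ac)
    also have "\<dots> \<le> epowr (pow2 n * ?T n) q + epowr (pow2 (J n)) q'"
      by (rule mult_le_epowr_add[OF q])
    finally show "?T n * (pow2 n * pow2 (J n)) \<le> epowr (pow2 n * ?T n) q + epowr (pow2 (J n)) q'" .
  qed
  also have "\<dots> = (\<Sum>n\<in>i ` K. epowr (pow2 n * ?T n) q) + (\<Sum>n\<in>i ` K. pow2 (J n * q'))"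
    unfolding sum.distrib epowr_pow2 ..
  also have "(\<Sum>n\<in>i ` K. pow2 (J n * q')) = (\<Sum>m\<in>J ` i ` K. pow2 (m * q'))"
    by (rule sum.reindex_cong[OF inj, symmetric]) auto
  also have "(\<Sum>n\<in>i ` K. epowr (pow2 n * ?T n) q) + (\<Sum>m\<in>J ` i ` K. pow2 (m * q'))
      \<le> (\<Sum>n\<in>i ` K. epowr (pow2 n * ?T n) q) + (\<Sum>m\<in>j ` K. pow2 (m * q'))"
    using K sub by (intro add_left_mono sum_mono2) auto
  finally show ?thesis .
qed

text \<open>\<open>c k x\<close> is the label of the cell of generation k that contains x; larger k
  means finer cells, and generation 0 is the coarsest. Labels are of countable type, so each
  generation is a countable partition and integrals are sums over its cells.\<close>

locale filtration =
  fixes c :: "nat \<Rightarrow> 'a \<Rightarrow> 'i::countable" and M :: "'a measure"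
  assumes refine: "\<And>k x y. c (Suc k) x = c (Suc k) y \<Longrightarrow> c k x = c k y"
    and measurable_c [measurable]: "\<And>k. c k \<in> M \<rightarrow>\<^sub>M count_space UNIV"
    and space_M: "space M = UNIV"
begin

definition cell :: "nat \<Rightarrow> 'a \<Rightarrow> 'a set" where
  "cell k x = {y. c k y = c k x}"

definition adapted :: "nat \<Rightarrow> ('a \<Rightarrow> 'b) \<Rightarrow> bool" where
  "adapted k \<phi> \<longleftrightarrow> (\<forall>x y. c k x = c k y \<longrightarrow> \<phi> x = \<phi> y)"

definition cm :: "'a measure \<Rightarrow> nat \<Rightarrow> 'a \<Rightarrow> ennreal" where
  "cm \<nu> k x = emeasure \<nu> (cell k x)"

text \<open>On a null cell the numerator vanishes and 0 / 0 = 0, so the average is 0 there.\<close>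

definition av :: "'a measure \<Rightarrow> ('a \<Rightarrow> ennreal) \<Rightarrow> nat \<Rightarrow> 'a \<Rightarrow> ennreal" where
  "av \<nu> f k x = (\<integral>\<^sup>+ y. f y * indicator (cell k x) y \<partial>\<nu>) / cm \<nu> k x"

text \<open>A running maximum, over the generations up to k only: it is adapted to generation k,
  nondecreasing in k, and attained by one of the averages.\<close>

definition mx :: "'a measure \<Rightarrow> ('a \<Rightarrow> ennreal) \<Rightarrow> nat \<Rightarrow> 'a \<Rightarrow> ennreal" where
  "mx \<nu> f k x = Max ((\<lambda>l. av \<nu> f l x) ` {..k})"

text \<open>A stopping time. For an adapted family E it selects the maximal cells of the family,
  which are pairwise disjoint.\<close>

definition first :: "(nat \<Rightarrow> 'a \<Rightarrow> bool) \<Rightarrow> nat \<Rightarrow> 'a \<Rightarrow> bool" where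
  "first E k x \<longleftrightarrow> E k x \<and> (\<forall>l<k. \<not> E l x)"

lemma refine_le: "l \<le> k \<Longrightarrow> c k x = c k y \<Longrightarrow> c l x = c l y"
proof (induction k)
  case (Suc k)
  show ?case
  proof (cases "l = Suc k")
    case False
    then show ?thesis using Suc refine[OF Suc.prems(2)] by simp
  qed (use Suc in simp)
qed simp

lemma adaptedD: "adapted k \<phi> \<Longrightarrow> c k x = c k y \<Longrightarrow> \<phi> x = \<phi> y"
  unfolding adapted_def by blast

text \<open>A function that is constant on cells factors through the countable set of labels, where
  every map is measurable.\<close>

lemma adapted_measurable:
  assumes "adapted k \<phi>" "space N = UNIV"
  shows "\<phi> \<in> M \<rightarrow>\<^sub>M N"
proof -
  have "\<phi> = (\<lambda>i. \<phi> (SOME x. c k x = i)) \<circ> c k"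
  proof
    fix x
    have "c k (SOME y. c k y = c k x) = c k x" by (rule someI[where x = x]) simp
    then show "\<phi> x = ((\<lambda>i. \<phi> (SOME x. c k x = i)) \<circ> c k) x"
      using adaptedD[OF assms(1), of "SOME y. c k y = c k x" x] by simp
  qed
  moreover have "(\<lambda>i. \<phi> (SOME x. c k x = i)) \<in> count_space UNIV \<rightarrow>\<^sub>M N"
    using assms(2) by simp
  ultimately show ?thesis
    using measurable_comp[OF measurable_c, of "\<lambda>i. \<phi> (SOME x. c k x = i)" N k] by simp
qed

lemma adapted_pred: "adapted k E \<Longrightarrow> Measurable.pred M E"
  using adapted_measurable[of k E "count_space UNIV"] by simp

lemma adapted_cm: "adapted k (cm \<nu> k)"
  and adapted_av: "adapted k (av \<nu> f k)"
  by (auto simp: adapted_def cell_def cm_def av_def)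

lemma adapted_comp2:
  assumes "adapted k \<phi>" "adapted k \<psi>" shows "adapted k (\<lambda>x. F (\<phi> x) (\<psi> x))"
  unfolding adapted_def
proof (intro allI impI)
  fix x y assume "c k x = c k y"
  then have "\<phi> x = \<phi> y" "\<psi> x = \<psi> y"
    using adaptedD[OF assms(1), of x y] adaptedD[OF assms(2), of x y] by simp_all
  then show "F (\<phi> x) (\<psi> x) = F (\<phi> y) (\<psi> y)" by simp
qed

lemma adapted_mx: "adapted k (mx \<nu> f k)"
proof -
  have *: "av \<nu> f l x = av \<nu> f l y" if "l \<le> k" "c k x = c k y" for l x y
    by (rule adaptedD[OF adapted_av refine_le[OF that]])
  have "(\<lambda>l. av \<nu> f l x) ` {..k} = (\<lambda>l. av \<nu> f l y) ` {..k}" if "c k x = c k y" for x y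
    by (rule image_cong) (use * that in blast)+
  then show ?thesis
    unfolding adapted_def mx_def by metis
qed

lemma adapted_first:
  assumes "\<And>k. adapted k (E k)" shows "adapted k (first E k)"
  unfolding adapted_def
proof (intro allI impI)
  fix x y assume "c k x = c k y"
  then have *: "E l x = E l y" if "l \<le> k" for l
    by (rule adaptedD[OF assms refine_le[OF that]])
  show "first E k x = first E k y"
    unfolding first_def using * by simp
qed

lemma sum_first: "(\<Sum>k<L. of_bool (first E k x)) = (of_bool (\<exists>k<L. E k x) :: ennreal)"
proof (induction L)
  case (Suc L)
  have "first E L x \<longleftrightarrow> E L x \<and> \<not> (\<exists>k<L. E k x)" by (auto simp: first_def)
  then show ?case using Suc by (auto simp: less_Suc_eq)
qed simp

lemma cell_sets [measurable]: "{y. c k y = i} \<in> sets M" "cell k x \<in> sets M"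
  unfolding cell_def using measurable_sets[OF measurable_c, of "{_}"] space_M
  by (auto simp: vimage_def)

lemma nn_integral_cells:
  assumes [measurable_cong]: "sets \<nu> = sets M" and [measurable]: "h \<in> borel_measurable M"
  shows "(\<integral>\<^sup>+ x. h x \<partial>\<nu>) = (\<integral>\<^sup>+ i. (\<integral>\<^sup>+ x. h x * indicator {y. c k y = i} x \<partial>\<nu>) \<partial>count_space UNIV)"
proof -
  have *: "(\<integral>\<^sup>+ i. h x * indicator {y. c k y = i} x \<partial>count_space UNIV) = h x" for x
    by (subst nn_integral_count_space'[where A = "{c k x}"]) auto
  have "(\<integral>\<^sup>+ x. h x \<partial>\<nu>) = (\<integral>\<^sup>+ x. (\<integral>\<^sup>+ i. h x * indicator {y. c k y = i} x \<partial>count_space UNIV) \<partial>\<nu>)"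
    unfolding * ..
  also have "\<dots> = (\<integral>\<^sup>+ i. (\<integral>\<^sup>+ x. h x * indicator {y. c k y = i} x \<partial>\<nu>) \<partial>count_space UNIV)"
    by (rule nn_integral_count_space_nn_integral) auto
  finally show ?thesis .
qed

text \<open>The two measures may differ; this is how an integral over \<mu> is exchanged for one
  over \<sigma>, cell by cell.\<close>

lemma nn_integral_cells_mono:
  assumes "sets \<nu> = sets M" "h \<in> borel_measurable M" "sets \<nu>' = sets M" "h' \<in> borel_measurable M"
    and "\<And>x. (\<integral>\<^sup>+ y. h y * indicator (cell k x) y \<partial>\<nu>) \<le> (\<integral>\<^sup>+ y. h' y * indicator (cell k x) y \<partial>\<nu>')"
  shows "(\<integral>\<^sup>+ x. h x \<partial>\<nu>) \<le> (\<integral>\<^sup>+ x. h' x \<partial>\<nu>')"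
  unfolding nn_integral_cells[OF assms(1,2), of k] nn_integral_cells[OF assms(3,4), of k]
proof (rule nn_integral_mono)
  fix i
  show "(\<integral>\<^sup>+ x. h x * indicator {y. c k y = i} x \<partial>\<nu>) \<le> (\<integral>\<^sup>+ x. h' x * indicator {y. c k y = i} x \<partial>\<nu>')"
  proof (cases "\<exists>x. c k x = i")
    case True then show ?thesis using assms(5) by (auto simp: cell_def)
  next
    case False
    then have "{y. c k y = i} = {}" by auto
    then show ?thesis by (simp only:) simp
  qed
qed

lemma nn_integral_cells_cong:
  assumes "sets \<nu> = sets M" "h \<in> borel_measurable M" "sets \<nu>' = sets M" "h' \<in> borel_measurable M"
    and "\<And>x. (\<integral>\<^sup>+ y. h y * indicator (cell k x) y \<partial>\<nu>) = (\<integral>\<^sup>+ y. h' y * indicator (cell k x) y \<partial>\<nu>')"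
  shows "(\<integral>\<^sup>+ x. h x \<partial>\<nu>) = (\<integral>\<^sup>+ x. h' x \<partial>\<nu>')"
  by (rule antisym; rule nn_integral_cells_mono[where k = k]) (simp_all add: assms)

lemma nn_integral_adapted_cell:
  assumes [measurable_cong]: "sets \<nu> = sets M" and "adapted k \<phi>" and [measurable]: "f \<in> borel_measurable M"
  shows "(\<integral>\<^sup>+ y. (\<phi> y * f y) * indicator (cell k x) y \<partial>\<nu>) = \<phi> x * (\<integral>\<^sup>+ y. f y * indicator (cell k x) y \<partial>\<nu>)"
proof -
  have "(\<integral>\<^sup>+ y. (\<phi> y * f y) * indicator (cell k x) y \<partial>\<nu>) = (\<integral>\<^sup>+ y. \<phi> x * (f y * indicator (cell k x) y) \<partial>\<nu>)"
  proof (rule nn_integral_cong)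
    fix y
    show "(\<phi> y * f y) * indicator (cell k x) y = \<phi> x * (f y * indicator (cell k x) y)"
      using adaptedD[OF assms(2), of y x] by (auto simp: indicator_def cell_def)
  qed
  then show ?thesis by (simp add: nn_integral_cmult)
qed

lemma av_mult_cm:
  assumes [measurable_cong]: "sets \<nu> = sets M" and "cm \<nu> k x < top" and [measurable]: "f \<in> borel_measurable M"
  shows "av \<nu> f k x * cm \<nu> k x = (\<integral>\<^sup>+ y. f y * indicator (cell k x) y \<partial>\<nu>)"
proof (cases "cm \<nu> k x = 0")
  case True
  then have "cell k x \<in> null_sets \<nu>" by (auto simp: cm_def assms(1))
  then have "(\<integral>\<^sup>+ y. f y * indicator (cell k x) y \<partial>\<nu>) = 0" by (rule nn_integral_null_set)
  then show ?thesis using True by simp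
next
  case False
  then have "b / cm \<nu> k x * cm \<nu> k x = b" for b
    using assms(2) ennreal_mult_divide_eq[of "cm \<nu> k x" b]
    by (simp add: ennreal_times_divide mult.commute less_top)
  then show ?thesis by (simp add: av_def)
qed

text \<open>\<open>av\<close> is the conditional expectation with respect to the partition of
  generation k, and \<phi> is constant on its cells.\<close>

lemma nn_integral_mult_av:
  assumes \<nu>: "sets \<nu> = sets M" and fin: "\<And>x. cm \<nu> k x < top"
    and \<phi>: "adapted k \<phi>" and [measurable]: "f \<in> borel_measurable M"
  shows "(\<integral>\<^sup>+ x. \<phi> x * f x \<partial>\<nu>) = (\<integral>\<^sup>+ x. \<phi> x * av \<nu> f k x \<partial>\<nu>)"
proof (rule nn_integral_cells_cong[OF \<nu> _ \<nu>])
  have [measurable]: "\<phi> \<in> borel_measurable M" by (rule adapted_measurable[OF \<phi>]) simp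
  have [measurable]: "av \<nu> f k \<in> borel_measurable M" by (rule adapted_measurable[OF adapted_av]) simp
  show "(\<lambda>x. \<phi> x * f x) \<in> borel_measurable M" "(\<lambda>x. \<phi> x * av \<nu> f k x) \<in> borel_measurable M" by auto
  fix x
  have "(\<integral>\<^sup>+ y. (\<phi> y * av \<nu> f k y * 1) * indicator (cell k x) y \<partial>\<nu>) = \<phi> x * av \<nu> f k x * (\<integral>\<^sup>+ y. 1 * indicator (cell k x) y \<partial>\<nu>)"
    by (intro nn_integral_adapted_cell[OF \<nu>] adapted_comp2[OF \<phi> adapted_av]) auto
  also have "\<dots> = \<phi> x * (av \<nu> f k x * cm \<nu> k x)"
    using \<nu> by (simp add: cm_def mult.assoc)
  also have "\<dots> = (\<integral>\<^sup>+ y. (\<phi> y * f y) * indicator (cell k x) y \<partial>\<nu>)"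
    by (simp add: nn_integral_adapted_cell[OF \<nu> \<phi>] av_mult_cm[OF \<nu> fin])
  finally show "(\<integral>\<^sup>+ y. (\<phi> y * f y) * indicator (cell k x) y \<partial>\<nu>) = (\<integral>\<^sup>+ y. (\<phi> y * av \<nu> f k y) * indicator (cell k x) y \<partial>\<nu>)"
    by simp
qed

text \<open>Both sides are the sum of \<phi>(Q) \<sigma>(Q) \<mu>(Q) over the cells Q of generation
  k.\<close>

lemma nn_integral_cm_swap:
  assumes \<sigma>: "sets \<sigma> = sets M" and \<mu>: "sets \<mu> = sets M" and \<phi>: "adapted k \<phi>"
  shows "(\<integral>\<^sup>+ x. \<phi> x * cm \<sigma> k x \<partial>\<mu>) = (\<integral>\<^sup>+ x. \<phi> x * cm \<mu> k x \<partial>\<sigma>)"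
proof (rule nn_integral_cells_cong[OF \<mu> _ \<sigma>])
  have [measurable]: "\<phi> \<in> borel_measurable M" by (rule adapted_measurable[OF \<phi>]) simp
  have [measurable]: "cm \<nu> k \<in> borel_measurable M" for \<nu> by (rule adapted_measurable[OF adapted_cm]) simp
  show "(\<lambda>x. \<phi> x * cm \<sigma> k x) \<in> borel_measurable M" "(\<lambda>x. \<phi> x * cm \<mu> k x) \<in> borel_measurable M" by auto
  fix x
  have *: "(\<integral>\<^sup>+ y. (\<phi> y * cm \<nu> k y) * indicator (cell k x) y \<partial>\<nu>') = \<phi> x * cm \<nu> k x * cm \<nu>' k x"
    if "sets \<nu>' = sets M" for \<nu> \<nu>'
  proof -
    have "(\<integral>\<^sup>+ y. (\<phi> y * cm \<nu> k y * 1) * indicator (cell k x) y \<partial>\<nu>') = \<phi> x * cm \<nu> k x * (\<integral>\<^sup>+ y. 1 * indicator (cell k x) y \<partial>\<nu>')"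
      by (intro nn_integral_adapted_cell[OF that] adapted_comp2[OF \<phi> adapted_cm]) auto
    then show ?thesis using that by (simp add: cm_def[of \<nu>'])
  qed
  show "(\<integral>\<^sup>+ y. (\<phi> y * cm \<sigma> k y) * indicator (cell k x) y \<partial>\<mu>) = (\<integral>\<^sup>+ y. (\<phi> y * cm \<mu> k y) * indicator (cell k x) y \<partial>\<sigma>)"
    unfolding *[OF \<mu>] *[OF \<sigma>] by (simp add: mult_ac)
qed

end

section \<open>The dyadic maximal inequality\<close>

lemma borel_measurable_of_bool [measurable (raw)]:
  assumes [measurable]: "Measurable.pred M P"
  shows "(\<lambda>x. of_bool (P x) :: ennreal) \<in> borel_measurable M"
  unfolding of_bool_def by measurable

text \<open>The coefficient of f^p in \<open>2 * f\<close> times the bound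
  \<open>geoC (p - 1)\<close> (2 f)^(p - 1) for the geometric series in
  \<open>maximal_levels\<close>.\<close>

definition maxC :: "real \<Rightarrow> real" where
  "maxC p = 2 * geoC (p - 1) * 2 powr (p - 1)"

lemma maxC_pos: "p > 1 \<Longrightarrow> maxC p > 0"
  by (simp add: maxC_def geoC_pos)

context filtration
begin

lemma adapted_comp: "adapted k \<phi> \<Longrightarrow> adapted k (\<lambda>x. F (\<phi> x))"
  using adapted_comp2[of k \<phi> \<phi> "\<lambda>a _. F a"] .

lemma sets_Ex_less:
  assumes [measurable]: "\<And>k. Measurable.pred M (Q k)"
  shows "{x. \<exists>k<(L::nat). Q k x} \<in> sets M"
proof -
  have "{x \<in> space M. \<exists>k<L::nat. Q k x} \<in> sets M" by measurable
  then show ?thesis by (simp add: space_M)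
qed

lemma av_le_mx: "l \<le> k \<Longrightarrow> av \<nu> f l x \<le> mx \<nu> f k x"
  unfolding mx_def by (rule Max_ge) auto

lemma mx_attained: "\<exists>l\<le>k. mx \<nu> f k x = av \<nu> f l x"
proof -
  have "mx \<nu> f k x \<in> (\<lambda>l. av \<nu> f l x) ` {..k}"
    unfolding mx_def by (rule Max_in) auto
  then show ?thesis by blast
qed

lemma mx_mono: "k \<le> l \<Longrightarrow> mx \<nu> f k x \<le> mx \<nu> f l x"
  using mx_attained[of k \<nu> f x] av_le_mx order_trans by metis

lemma measurable_av [measurable]: "av \<nu> f k \<in> borel_measurable M"
  and measurable_cm [measurable]: "cm \<nu> k \<in> borel_measurable M"
  and measurable_mx [measurable]: "mx \<nu> f k \<in> borel_measurable M"
  by (rule adapted_measurable[OF adapted_av] adapted_measurable[OF adapted_cm] adapted_measurable[OF adapted_mx], simp)+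

lemma av_less_top:
  assumes [measurable_cong]: "sets \<nu> = sets M" and fin: "cm \<nu> k x < top" and [measurable]: "f \<in> borel_measurable M"
    and p: "p \<ge> 1" and f: "(\<integral>\<^sup>+ x. epowr (f x) p \<partial>\<nu>) < top"
  shows "av \<nu> f k x < top"
proof -
  have le: "f y \<le> 1 + epowr (f y) p" for y
  proof (cases "f y \<le> 1")
    case False
    have "f y * 1 \<le> epowr (f y) 1 * epowr (f y) (p - 1)"
      using False p epowr_mono[of "p - 1" 1 "f y"]
      by (intro mult_mono) (auto simp: epowr_1_right epowr_one_left)
    also have "\<dots> = epowr (f y) p" using p by (simp add: epowr_add[symmetric])
    finally show ?thesis by (simp add: add_increasing)
  qed (simp add: add_increasing2)
  have "(\<integral>\<^sup>+ y. f y * indicator (cell k x) y \<partial>\<nu>) \<le> (\<integral>\<^sup>+ y. indicator (cell k x) y + epowr (f y) p \<partial>\<nu>)"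
    using le by (intro nn_integral_mono) (auto simp: indicator_def)
  also have "\<dots> = cm \<nu> k x + (\<integral>\<^sup>+ y. epowr (f y) p \<partial>\<nu>)"
    by (simp add: nn_integral_add cm_def assms(1))
  also have "\<dots> < top" using fin f by simp
  finally have I: "(\<integral>\<^sup>+ y. f y * indicator (cell k x) y \<partial>\<nu>) < top" .
  show ?thesis
  proof (cases "cm \<nu> k x = 0")
    case True
    then have "cell k x \<in> null_sets \<nu>" by (auto simp: cm_def assms(1))
    then have "(\<integral>\<^sup>+ y. f y * indicator (cell k x) y \<partial>\<nu>) = 0" by (rule nn_integral_null_set)
    then show ?thesis by (simp add: av_def)
  next
    case False
    then have "av \<nu> f k x \<noteq> top" using I by (auto simp: av_def ennreal_divide_eq_top_iff)
    then show ?thesis by (simp add: less_top)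
  qed
qed

lemma mx_less_top:
  assumes "sets \<nu> = sets M" "\<And>k x. cm \<nu> k x < top" "f \<in> borel_measurable M" "p \<ge> 1" "(\<integral>\<^sup>+ x. epowr (f x) p \<partial>\<nu>) \<le> 1"
  shows "mx \<nu> f k x < top"
proof -
  obtain l where l: "mx \<nu> f k x = av \<nu> f l x" using mx_attained by blast
  show ?thesis unfolding l
    by (rule av_less_top[OF assms(1,2,3,4)]) (rule order_le_less_trans[OF assms(5)], simp)
qed

text \<open>The part of f below height t adds at most t to any average, so where the average of f
  reaches 2 t, that of the part above t reaches t. The first cells on which this happens are
  disjoint, and on them the average may be replaced by the function.\<close>

lemma maximal_weak:
  assumes \<nu> [measurable_cong]: "sets \<nu> = sets M" and fin: "\<And>k x. cm \<nu> k x < top"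
    and [measurable]: "f \<in> borel_measurable M" and t: "t < top"
  shows "t * emeasure \<nu> {x. \<exists>k<L. 2 * t \<le> av \<nu> f k x} \<le> (\<integral>\<^sup>+ x. f x * of_bool (t \<le> f x) \<partial>\<nu>)"
proof -
  define E where "E k x \<longleftrightarrow> 2 * t \<le> av \<nu> f k x" for k x
  define f' where "f' x = f x * of_bool (t \<le> f x)" for x
  have [measurable]: "f' \<in> borel_measurable M" unfolding f'_def by measurable
  have adE: "adapted k (E k)" for k unfolding E_def by (rule adapted_comp[OF adapted_av])
  have adF: "adapted k (first E k)" for k by (rule adapted_first[OF adE])
  have [measurable]: "Measurable.pred M (E k)" "Measurable.pred M (first E k)" for k
    by (rule adapted_pred adE adF)+
  have av': "t \<le> av \<nu> f' k x" if "E k x" for k x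
  proof -
    have "(\<integral>\<^sup>+ y. f y * indicator (cell k x) y \<partial>\<nu>) \<le> (\<integral>\<^sup>+ y. f' y * indicator (cell k x) y + t * indicator (cell k x) y \<partial>\<nu>)"
      by (intro nn_integral_mono) (auto simp: indicator_def f'_def)
    also have "\<dots> = (\<integral>\<^sup>+ y. f' y * indicator (cell k x) y \<partial>\<nu>) + t * cm \<nu> k x"
      by (simp add: nn_integral_add nn_integral_cmult cm_def assms(1))
    finally have "av \<nu> f k x \<le> ((\<integral>\<^sup>+ y. f' y * indicator (cell k x) y \<partial>\<nu>) + t * cm \<nu> k x) / cm \<nu> k x"
      unfolding av_def by (rule divide_right_mono_ennreal)
    also have "\<dots> = av \<nu> f' k x + t * cm \<nu> k x / cm \<nu> k x"
      by (simp add: add_divide_distrib_ennreal av_def)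
    also have "t * cm \<nu> k x / cm \<nu> k x \<le> t"
      using fin[of k x] by (cases "cm \<nu> k x = 0") (auto simp: ennreal_mult_divide_eq less_top)
    finally have "t + t \<le> t + av \<nu> f' k x"
      using that by (simp add: E_def mult_2[symmetric] add_left_mono add.commute order_trans)
    then show ?thesis using t by (auto simp: ennreal_add_left_cancel_le)
  qed
  have meas: "{x. \<exists>k<L. E k x} \<in> sets M" by (rule sets_Ex_less) measurable
  have "t * emeasure \<nu> {x. \<exists>k<L. E k x} = (\<integral>\<^sup>+ x. t * of_bool (\<exists>k<L. E k x) \<partial>\<nu>)"
    using meas by (subst nn_integral_cmult_indicator[symmetric]) (auto simp: \<nu> indicator_def intro!: nn_integral_cong)
  also have "\<dots> = (\<integral>\<^sup>+ x. (\<Sum>k<L. t * of_bool (first E k x)) \<partial>\<nu>)"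
    by (simp only: sum_first[symmetric] sum_distrib_left)
  also have "\<dots> = (\<Sum>k<L. \<integral>\<^sup>+ x. t * of_bool (first E k x) \<partial>\<nu>)"
    by (rule nn_integral_sum) measurable
  also have "\<dots> \<le> (\<Sum>k<L. \<integral>\<^sup>+ x. of_bool (first E k x) * av \<nu> f' k x \<partial>\<nu>)"
    using av' by (intro sum_mono nn_integral_mono) (auto simp: first_def)
  also have "\<dots> = (\<Sum>k<L. \<integral>\<^sup>+ x. of_bool (first E k x) * f' x \<partial>\<nu>)"
    by (intro sum.cong refl nn_integral_mult_av[symmetric] \<nu> fin adapted_comp[OF adF]) measurable
  also have "\<dots> = (\<integral>\<^sup>+ x. (\<Sum>k<L. of_bool (first E k x) * f' x) \<partial>\<nu>)"
    by (rule nn_integral_sum[symmetric]) measurable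
  also have "\<dots> = (\<integral>\<^sup>+ x. of_bool (\<exists>k<L. E k x) * f' x \<partial>\<nu>)"
    by (simp only: sum_first[symmetric] sum_distrib_right)
  also have "\<dots> \<le> (\<integral>\<^sup>+ x. f' x \<partial>\<nu>)"
    by (intro nn_integral_mono) auto
  finally show ?thesis unfolding E_def f'_def .
qed

text \<open>The strong type bound in discrete form. The level 2^i is treated by the weak type bound
  at height 2^(i - 1); the sum over i, taken inside the integral, is then a geometric series that
  ends where 2^i exceeds 2 f.\<close>

lemma maximal_levels:
  assumes \<nu> [measurable_cong]: "sets \<nu> = sets M" and fin: "\<And>k x. cm \<nu> k x < top"
    and [measurable]: "f \<in> borel_measurable M" and p: "p > 1"
  shows "isum (\<lambda>i. pow2 (i * p) * emeasure \<nu> {x. \<exists>k<L. pow2 i \<le> av \<nu> f k x})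
    \<le> ennreal (maxC p) * (\<integral>\<^sup>+ x. epowr (f x) p \<partial>\<nu>)"
proof -
  have two: "2 * pow2 r = pow2 (r + 1)" for r
    by (simp add: pow2_def powr_add ennreal_mult mult.commute)
  have 1: "pow2 (i * p) * emeasure \<nu> {x. \<exists>k<L. pow2 i \<le> av \<nu> f k x}
      \<le> (\<integral>\<^sup>+ x. pow2 (i * (p - 1) + 1) * (f x * of_bool (pow2 (of_int i - 1) \<le> f x)) \<partial>\<nu>)" for i :: int
  proof -
    have "pow2 (i * p) = pow2 (i * (p - 1) + 1) * pow2 (of_int i - 1)"
      by (simp add: pow2_add[symmetric] algebra_simps)
    then have "pow2 (i * p) * emeasure \<nu> {x. \<exists>k<L. pow2 i \<le> av \<nu> f k x}
        = pow2 (i * (p - 1) + 1) * (pow2 (of_int i - 1) * emeasure \<nu> {x. \<exists>k<L. 2 * pow2 (of_int i - 1) \<le> av \<nu> f k x})"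
      by (simp add: two mult.assoc)
    also have "\<dots> \<le> pow2 (i * (p - 1) + 1) * (\<integral>\<^sup>+ x. f x * of_bool (pow2 (of_int i - 1) \<le> f x) \<partial>\<nu>)"
      by (intro mult_left_mono maximal_weak[OF \<nu> fin] pow2_less_top) auto
    also have "\<dots> = (\<integral>\<^sup>+ x. pow2 (i * (p - 1) + 1) * (f x * of_bool (pow2 (of_int i - 1) \<le> f x)) \<partial>\<nu>)"
      by (rule nn_integral_cmult[symmetric]) measurable
    finally show ?thesis .
  qed
  have "isum (\<lambda>i. pow2 (i * p) * emeasure \<nu> {x. \<exists>k<L. pow2 i \<le> av \<nu> f k x})
      \<le> isum (\<lambda>i. \<integral>\<^sup>+ x. pow2 (i * (p - 1) + 1) * (f x * of_bool (pow2 (of_int i - 1) \<le> f x)) \<partial>\<nu>)"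
    using 1 by (rule nn_integral_mono)
  also have "\<dots> = (\<integral>\<^sup>+ x. isum (\<lambda>i. pow2 (i * (p - 1) + 1) * (f x * of_bool (pow2 (of_int i - 1) \<le> f x))) \<partial>\<nu>)"
    by (rule nn_integral_count_space_nn_integral[symmetric]) auto
  also have "\<dots> \<le> (\<integral>\<^sup>+ x. ennreal (maxC p) * epowr (f x) p \<partial>\<nu>)"
  proof (rule nn_integral_mono)
    fix x
    have eq: "pow2 (of_int i - 1) \<le> f x \<longleftrightarrow> pow2 i \<le> 2 * f x" for i :: int
    proof -
      have "pow2 i = 2 * pow2 (of_int i - 1)" by (simp add: two)
      then show ?thesis by (simp add: ennreal_mult_le_mult_iff)
    qed
    have "isum (\<lambda>i. pow2 (i * (p - 1) + 1) * (f x * of_bool (pow2 (of_int i - 1) \<le> f x)))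
        = isum (\<lambda>i. (2 * f x) * (pow2 (i * (p - 1)) * of_bool (pow2 i \<le> 2 * f x)))"
      unfolding eq by (rule nn_integral_cong) (simp add: two[symmetric] mult_ac)
    also have "\<dots> = (2 * f x) * isum (\<lambda>i. pow2 (i * (p - 1)) * of_bool (pow2 i \<le> 2 * f x))"
      by (rule nn_integral_cmult) auto
    also have "\<dots> \<le> (2 * f x) * (ennreal (geoC (p - 1)) * epowr (2 * f x) (p - 1))"
      using p by (intro mult_left_mono isum_pow2_le) auto
    also have "\<dots> = ennreal (maxC p) * (epowr (f x) 1 * epowr (f x) (p - 1))"
    proof -
      have "epowr (2 * f x) (p - 1) = ennreal (2 powr (p - 1)) * epowr (f x) (p - 1)"
        using p epowr_ennreal[of "p - 1" 2] by (simp add: epowr_mult)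
      moreover have "ennreal (maxC p) = 2 * ennreal (geoC (p - 1)) * ennreal (2 powr (p - 1))"
        using p geoC_pos[of "p - 1"] by (simp add: maxC_def ennreal_mult)
      ultimately show ?thesis by (simp add: epowr_1_right mult_ac)
    qed
    also have "epowr (f x) 1 * epowr (f x) (p - 1) = epowr (f x) p"
      using p by (simp add: epowr_add[symmetric])
    finally show "isum (\<lambda>i. pow2 (i * (p - 1) + 1) * (f x * of_bool (pow2 (of_int i - 1) \<le> f x)))
      \<le> ennreal (maxC p) * epowr (f x) p" .
  qed
  also have "\<dots> = ennreal (maxC p) * (\<integral>\<^sup>+ x. epowr (f x) p \<partial>\<nu>)"
    by (rule nn_integral_cmult) measurable
  finally show ?thesis .
qed

end

section \<open>Two-weight bounds for positive dyadic operators\<close>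

context filtration
begin

text \<open>R is an arbitrary family of cells, not necessarily inside a single one: in the corona
  argument it consists of all cells of one half on which the running maximum of f has a given level.
  Only the generations below L enter, to keep the sums finite.\<close>

definition testing :: "'a measure \<Rightarrow> 'a measure \<Rightarrow> (nat \<Rightarrow> 'a \<Rightarrow> ennreal) \<Rightarrow> nat \<Rightarrow> real \<Rightarrow> real \<Rightarrow> real \<Rightarrow> bool" where
  "testing \<sigma> \<mu> lam L p q C \<longleftrightarrow> (\<forall>R. (\<forall>k. adapted k (R k)) \<longrightarrow>
     (\<integral>\<^sup>+ x. epowr (\<Sum>k<L. lam k x * cm \<sigma> k x * of_bool (R k x)) q \<partial>\<mu>)
       \<le> ennreal C * epowr (emeasure \<sigma> {x. \<exists>k<L. R k x}) (q / p))"

text \<open>By \<open>P_lev\<close>, the dyadic level of the average of \<open>g\<close> determines that of \<open>f\<close> along a point. Hence,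
  after Young's inequality, each level of \<open>g\<close> is counted only once.\<close>

lemma corona_half:
  assumes \<sigma> [measurable_cong]: "sets \<sigma> = sets M" and \<mu> [measurable_cong]: "sets \<mu> = sets M"
    and fin\<sigma>: "\<And>k x. cm \<sigma> k x < top" and fin\<mu>: "\<And>k x. cm \<mu> k x < top"
    and p: "1 < p" "p \<le> q" and q: "dual_exp q q'"
    and [measurable]: "f \<in> borel_measurable M" "g \<in> borel_measurable M"
    and f: "(\<integral>\<^sup>+ x. epowr (f x) p \<partial>\<sigma>) \<le> 1" and g: "(\<integral>\<^sup>+ x. epowr (g x) q' \<partial>\<mu>) \<le> 1"
    and lam: "\<And>k. adapted k (lam k)" and P: "\<And>k. adapted k (P k)"
    and P_pos: "\<And>k x. P k x \<Longrightarrow> 0 < mx \<sigma> f k x \<and> 0 < mx \<mu> g k x"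
    and P_lev: "\<And>k l x. P k x \<Longrightarrow> P l x \<Longrightarrow> lev (mx \<mu> g k x) = lev (mx \<mu> g l x) \<Longrightarrow> lev (mx \<sigma> f k x) = lev (mx \<sigma> f l x)"
    and T: "testing \<sigma> \<mu> lam L p q C" and C: "C \<ge> 0"
  shows "(\<integral>\<^sup>+ x. (\<Sum>k<L. lam k x * cm \<sigma> k x * (av \<sigma> f k x * av \<mu> g k x) * of_bool (P k x)) \<partial>\<mu>)
    \<le> ennreal (4 * (C * maxC p powr (q / p) + maxC q'))"
proof -
  have q': "q' > 1" "q > 1" using dual_expD[OF q] by auto
  define A where "A k x = mx \<sigma> f k x" for k x
  define B where "B k x = mx \<mu> g k x" for k x
  have A_top: "A k x < top" for k x
    unfolding A_def by (rule mx_less_top[OF \<sigma> fin\<sigma> _ _ f]) (use p in simp_all)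
  have B_top: "B k x < top" for k x
    unfolding B_def by (rule mx_less_top[OF \<mu> fin\<mu> _ _ g]) (use q' in simp_all)
  have [measurable]: "lam k \<in> borel_measurable M" for k by (rule adapted_measurable[OF lam]) simp
  have [measurable]: "Measurable.pred M (P k)" for k by (rule adapted_pred[OF P])
  define \<tau> where "\<tau> k x = lam k x * cm \<sigma> k x" for k x
  have [measurable]: "\<tau> k \<in> borel_measurable M" for k unfolding \<tau>_def by measurable
  \<comment> \<open>All cells of P at level n of f; they lie in the set where the maximal function
    of f is at least 2^n.\<close>
  define R where "R n k x \<longleftrightarrow> P k x \<and> lev (A k x) = n" for n k x
  have adR: "adapted k (R n k)" for n k
    unfolding R_def A_def using adapted_comp2[OF P adapted_mx, of k "\<lambda>P a. P \<and> lev a = n" \<sigma> f] .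
  have [measurable]: "Measurable.pred M (R n k)" for n k by (rule adapted_pred[OF adR])
  define T' where "T' n x = (\<Sum>k<L. \<tau> k x * of_bool (R n k x))" for n x
  have [measurable]: "T' n \<in> borel_measurable M" for n unfolding T'_def by measurable
  \<comment> \<open>The n-th term of the maximal inequality for f, so that \<open>isum y\<close> is
    at most \<open>maxC p\<close>.\<close>
  define y where "y n = pow2 (of_int n * p) * emeasure \<sigma> {x. \<exists>k<L. pow2 n \<le> av \<sigma> f k x}" for n :: int
  \<comment> \<open>The running maximum is an actual average of some generation below L, which is
    the form in which \<open>maximal_levels\<close> measures the level sets.\<close>
  have mx_ge: "\<exists>l<L. pow2 (lev (mx \<nu> h k x)) \<le> av \<nu> h l x" if "0 < mx \<nu> h k x" "mx \<nu> h k x < top" "k < L" for \<nu> h k x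
  proof -
    obtain l where "l \<le> k" "mx \<nu> h k x = av \<nu> h l x" using mx_attained by blast
    then show ?thesis using lev_bounds(1)[OF that(1,2)] \<open>k < L\<close> by (intro exI[of _ l]) auto
  qed

  have point: "(\<Sum>k<L. lam k x * cm \<sigma> k x * (av \<sigma> f k x * av \<mu> g k x) * of_bool (P k x))
     \<le> 4 * (isum (\<lambda>n. epowr (pow2 n * T' n x) q) + isum (\<lambda>m. pow2 (m * q') * of_bool (\<exists>k<L. pow2 m \<le> av \<mu> g k x)))" for x
  proof -
    define K where "K = {k \<in> {..<L}. P k x}"
    have KL: "K \<subseteq> {..<L}" and finK: "finite K" by (auto simp: K_def)
    \<comment> \<open>Each average is at most twice the power of two below its running maximum;
      hence the factor 4.\<close>
    have bnd: "av \<sigma> f k x * av \<mu> g k x \<le> 4 * (pow2 (lev (A k x)) * pow2 (lev (B k x)))" if "k \<in> K" for k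
    proof -
      have pos: "0 < A k x" "0 < B k x" using P_pos that by (auto simp: K_def A_def B_def)
      have "av \<sigma> f k x \<le> 2 * pow2 (lev (A k x))"
        using av_le_mx[of k k \<sigma> f x] lev_bounds(2)[OF pos(1) A_top]
        by (simp add: A_def[symmetric] pow2_def powr_add ennreal_mult mult.commute)
      moreover have "av \<mu> g k x \<le> 2 * pow2 (lev (B k x))"
        using av_le_mx[of k k \<mu> g x] lev_bounds(2)[OF pos(2) B_top]
        by (simp add: B_def[symmetric] pow2_def powr_add ennreal_mult mult.commute)
      ultimately have "av \<sigma> f k x * av \<mu> g k x \<le> (2 * pow2 (lev (A k x))) * (2 * pow2 (lev (B k x)))"
        by (intro mult_mono) auto
      also have "\<dots> = (2 * 2) * (pow2 (lev (A k x)) * pow2 (lev (B k x)))"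
        by (simp only: mult_ac)
      finally show ?thesis by simp
    qed
    have "(\<Sum>k<L. lam k x * cm \<sigma> k x * (av \<sigma> f k x * av \<mu> g k x) * of_bool (P k x))
        = (\<Sum>k\<in>K. \<tau> k x * (av \<sigma> f k x * av \<mu> g k x))"
      using KL by (intro sum.mono_neutral_cong_right) (auto simp: K_def \<tau>_def)
    also have "\<dots> \<le> (\<Sum>k\<in>K. \<tau> k x * (4 * (pow2 (lev (A k x)) * pow2 (lev (B k x)))))"
      using bnd by (intro sum_mono mult_left_mono) auto
    also have "\<dots> = 4 * (\<Sum>k\<in>K. \<tau> k x * (pow2 (lev (A k x)) * pow2 (lev (B k x))))"
      by (simp add: sum_distrib_left mult.left_commute)
    also have "(\<Sum>k\<in>K. \<tau> k x * (pow2 (lev (A k x)) * pow2 (lev (B k x))))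
        \<le> (\<Sum>n\<in>(\<lambda>k. lev (A k x)) ` K. epowr (pow2 n * (\<Sum>k | k \<in> K \<and> lev (A k x) = n. \<tau> k x)) q)
          + (\<Sum>m\<in>(\<lambda>k. lev (B k x)) ` K. pow2 (m * q'))"
      using P_lev by (intro sum_mult_pow2_le[OF finK q]) (auto simp: K_def A_def B_def)
    also have "\<dots> \<le> isum (\<lambda>n. epowr (pow2 n * T' n x) q) + isum (\<lambda>m. pow2 (m * q') * of_bool (\<exists>k<L. pow2 m \<le> av \<mu> g k x))"
    proof (intro add_mono sum_le_isum)
      fix n
      have "(\<Sum>k | k \<in> K \<and> lev (A k x) = n. \<tau> k x) = T' n x"
        unfolding T'_def by (intro sum.mono_neutral_cong_left) (auto simp: K_def R_def)
      then show "epowr (pow2 n * (\<Sum>k | k \<in> K \<and> lev (A k x) = n. \<tau> k x)) q \<le> epowr (pow2 n * T' n x) q"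
        by simp
    next
      fix m assume "m \<in> (\<lambda>k. lev (B k x)) ` K"
      then obtain k where k: "k < L" "P k x" "m = lev (B k x)" by (auto simp: K_def)
      then have "\<exists>l<L. pow2 m \<le> av \<mu> g l x"
        using mx_ge[of \<mu> g k x] P_pos[of k x] B_top[of k x] by (simp add: B_def)
      then show "pow2 (m * q') \<le> pow2 (m * q') * of_bool (\<exists>k<L. pow2 m \<le> av \<mu> g k x)"
        by simp
    qed (use finK in auto)
    finally show ?thesis by (simp add: mult_left_mono)
  qed
  have y_sum: "isum y \<le> ennreal (maxC p)"
  proof -
    have "isum y \<le> ennreal (maxC p) * (\<integral>\<^sup>+ x. epowr (f x) p \<partial>\<sigma>)"
      unfolding y_def using p by (intro maximal_levels \<sigma> fin\<sigma>) auto
    also have "\<dots> \<le> ennreal (maxC p) * 1" using f by (intro mult_left_mono) auto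
    finally show ?thesis by simp
  qed
  have first_part: "(\<integral>\<^sup>+ x. epowr (pow2 n * T' n x) q \<partial>\<mu>) \<le> ennreal C * (epowr (ennreal (maxC p)) (q / p - 1) * y n)" for n :: int
  proof -
    have "(\<integral>\<^sup>+ x. epowr (pow2 n * T' n x) q \<partial>\<mu>) = pow2 (n * q) * (\<integral>\<^sup>+ x. epowr (T' n x) q \<partial>\<mu>)"
      using q' by (simp add: epowr_mult epowr_pow2 nn_integral_cmult)
    also have "(\<integral>\<^sup>+ x. epowr (T' n x) q \<partial>\<mu>) \<le> ennreal C * epowr (emeasure \<sigma> {x. \<exists>k<L. R n k x}) (q / p)"
      using T adR unfolding testing_def T'_def \<tau>_def by blast
    also have "emeasure \<sigma> {x. \<exists>k<L. R n k x} \<le> emeasure \<sigma> {x. \<exists>k<L. pow2 n \<le> av \<sigma> f k x}"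
    proof (rule emeasure_mono)
      show "{x. \<exists>k<L. R n k x} \<subseteq> {x. \<exists>k<L. pow2 n \<le> av \<sigma> f k x}"
        using mx_ge[of \<sigma> f] P_pos A_top by (auto simp: R_def A_def)
      show "{x. \<exists>k<L. pow2 n \<le> av \<sigma> f k x} \<in> sets \<sigma>"
        unfolding \<sigma> by (rule sets_Ex_less) measurable
    qed
    also have "pow2 (n * q) * (ennreal C * epowr (emeasure \<sigma> {x. \<exists>k<L. pow2 n \<le> av \<sigma> f k x}) (q / p))
        = ennreal C * epowr (y n) (q / p)"
      using p unfolding y_def by (simp add: epowr_mult epowr_pow2 mult_ac)
    \<comment> \<open>Here p \<le> q enters, as the inclusion of l^1 in l^(q/p): one power of
      \<open>y n\<close> is kept for the summation over n, the others are bounded by the whole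
      sum.\<close>
    also have "epowr (y n) (q / p) = epowr (y n) (q / p - 1) * epowr (y n) 1"
      using p by (subst epowr_add[symmetric]) auto
    also have "\<dots> \<le> epowr (ennreal (maxC p)) (q / p - 1) * y n"
      using p order_trans[OF isum_member_le y_sum] by (intro mult_mono epowr_mono) (auto simp: epowr_1_right)
    finally show ?thesis using p q' by (simp add: mult_left_mono epowr_mono)
  qed
  have I1: "(\<integral>\<^sup>+ x. isum (\<lambda>n. epowr (pow2 n * T' n x) q) \<partial>\<mu>) \<le> ennreal (C * maxC p powr (q / p))"
  proof -
    have "(\<integral>\<^sup>+ x. isum (\<lambda>n. epowr (pow2 n * T' n x) q) \<partial>\<mu>) = isum (\<lambda>n. \<integral>\<^sup>+ x. epowr (pow2 n * T' n x) q \<partial>\<mu>)"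
      by (rule nn_integral_count_space_nn_integral) auto
    also have "\<dots> \<le> isum (\<lambda>n. ennreal C * (epowr (ennreal (maxC p)) (q / p - 1) * y n))"
      by (intro nn_integral_mono first_part)
    also have "\<dots> = ennreal C * (epowr (ennreal (maxC p)) (q / p - 1) * isum y)"
      by (simp add: nn_integral_cmult)
    also have "\<dots> \<le> ennreal C * (epowr (ennreal (maxC p)) (q / p - 1) * epowr (ennreal (maxC p)) 1)"
      using y_sum by (intro mult_left_mono) (auto simp: epowr_1_right)
    also have "\<dots> = ennreal C * epowr (ennreal (maxC p)) (q / p)"
      using p by (subst epowr_add[symmetric]) auto
    also have "\<dots> = ennreal (C * maxC p powr (q / p))"
      using maxC_pos[of p] p q' C by (simp add: epowr_ennreal_pos ennreal_mult)
    finally show ?thesis .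
  qed
  have I2: "(\<integral>\<^sup>+ x. isum (\<lambda>m. pow2 (m * q') * of_bool (\<exists>k<L. pow2 m \<le> av \<mu> g k x)) \<partial>\<mu>) \<le> ennreal (maxC q')"
  proof -
    have "(\<integral>\<^sup>+ x. isum (\<lambda>m. pow2 (m * q') * of_bool (\<exists>k<L. pow2 m \<le> av \<mu> g k x)) \<partial>\<mu>)
       = isum (\<lambda>m. \<integral>\<^sup>+ x. pow2 (m * q') * of_bool (\<exists>k<L. pow2 m \<le> av \<mu> g k x) \<partial>\<mu>)"
      by (rule nn_integral_count_space_nn_integral) auto
    also have "\<dots> = isum (\<lambda>m. pow2 (m * q') * emeasure \<mu> {x. \<exists>k<L. pow2 m \<le> av \<mu> g k x})"
    proof (rule nn_integral_cong)
      fix m :: int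
      have *: "{x. \<exists>k<L. pow2 m \<le> av \<mu> g k x} \<in> sets \<mu>" unfolding \<mu> by (rule sets_Ex_less) measurable
      show "(\<integral>\<^sup>+ x. pow2 (m * q') * of_bool (\<exists>k<L. pow2 m \<le> av \<mu> g k x) \<partial>\<mu>) = pow2 (m * q') * emeasure \<mu> {x. \<exists>k<L. pow2 m \<le> av \<mu> g k x}"
        unfolding nn_integral_cmult_indicator[OF *, symmetric] by (rule nn_integral_cong) (auto simp: indicator_def)
    qed
    also have "\<dots> \<le> ennreal (maxC q') * (\<integral>\<^sup>+ x. epowr (g x) q' \<partial>\<mu>)"
      using q' by (intro maximal_levels \<mu> fin\<mu>) auto
    also have "\<dots> \<le> ennreal (maxC q') * 1" using g by (intro mult_left_mono) auto
    finally show ?thesis by simp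
  qed
  have "(\<integral>\<^sup>+ x. (\<Sum>k<L. lam k x * cm \<sigma> k x * (av \<sigma> f k x * av \<mu> g k x) * of_bool (P k x)) \<partial>\<mu>)
     \<le> (\<integral>\<^sup>+ x. 4 * (isum (\<lambda>n. epowr (pow2 n * T' n x) q) + isum (\<lambda>m. pow2 (m * q') * of_bool (\<exists>k<L. pow2 m \<le> av \<mu> g k x))) \<partial>\<mu>)"
    by (intro nn_integral_mono point)
  also have "\<dots> = 4 * ((\<integral>\<^sup>+ x. isum (\<lambda>n. epowr (pow2 n * T' n x) q) \<partial>\<mu>) + (\<integral>\<^sup>+ x. isum (\<lambda>m. pow2 (m * q') * of_bool (\<exists>k<L. pow2 m \<le> av \<mu> g k x)) \<partial>\<mu>))"
  proof -
    have [measurable]: "(\<lambda>x. isum (\<lambda>n. epowr (pow2 n * T' n x) q)) \<in> borel_measurable \<mu>"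
      "(\<lambda>x. isum (\<lambda>m. pow2 (m * q') * of_bool (\<exists>k<L. pow2 m \<le> av \<mu> g k x))) \<in> borel_measurable \<mu>"
      by (rule sigma_finite_measure.borel_measurable_nn_integral[OF sigma_finite_measure_count_space]; simp add: measurable_split_conv; measurable)+
    show ?thesis by (simp add: nn_integral_cmult nn_integral_add)
  qed
  also have "\<dots> \<le> 4 * (ennreal (C * maxC p powr (q / p)) + ennreal (maxC q'))"
    by (intro mult_left_mono add_mono I1 I2) auto
  also have "\<dots> = ennreal (4 * (C * maxC p powr (q / p) + maxC q'))"
    using C maxC_pos[of q'] q' by (simp add: ennreal_mult ennreal_plus)
  finally show ?thesis .
qed

end

lemma dual_exp_le:
  assumes "dual_exp p p'" "dual_exp q q'" "p \<le> q" shows "q' \<le> p'"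
proof -
  have "1 / p + 1 / p' = 1" "1 / q + 1 / q' = 1" "0 < p" "0 < q" "0 < p'" "0 < q'"
    using assms by (auto simp: dual_exp_def)
  moreover have "1 / q \<le> 1 / p" using calculation(3,4) assms(3) by (intro divide_left_mono) auto
  ultimately have "1 / p' \<le> 1 / q'" "0 < p'" "0 < q'" by linarith+
  then show ?thesis by (simp add: divide_le_eq le_divide_eq)
qed

text \<open>The constants of \<open>corona_half\<close> for \<sigma>, \<mu>, p, q and for the dual
  situation \<mu>, \<sigma>, q', p', added.\<close>

definition bilC :: "real \<Rightarrow> real \<Rightarrow> real \<Rightarrow> real \<Rightarrow> real \<Rightarrow> real" where
  "bilC p q p' q' C = 4 * (C * maxC p powr (q / p) + maxC q') + 4 * (C * maxC q' powr (p' / q') + maxC p)"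

context filtration
begin

lemma adapted_mult:
  "adapted k \<phi> \<Longrightarrow> adapted k \<psi> \<Longrightarrow> adapted k (\<lambda>x. \<phi> x * \<psi> x :: ennreal)"
  by (rule adapted_comp2)

text \<open>The levels of a point are divided according to which of the two running maxima is the first to
  reach its current power of two.\<close>

definition earlier :: "(nat \<Rightarrow> 'a \<Rightarrow> ennreal) \<Rightarrow> (nat \<Rightarrow> 'a \<Rightarrow> ennreal) \<Rightarrow> nat \<Rightarrow> 'a \<Rightarrow> bool" where
  "earlier A B k x \<longleftrightarrow> 0 < A k x \<and> 0 < B k x \<and>
     (\<exists>l\<le>k. pow2 (lev (A k x)) \<le> A l x \<and> (\<forall>l'<l. \<not> pow2 (lev (B k x)) \<le> B l' x))"

lemma adapted_earlier:
  assumes A: "\<And>k. adapted k (A k)" and B: "\<And>k. adapted k (B k)"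
  shows "adapted k (earlier A B k)"
  unfolding adapted_def
proof (intro allI impI)
  fix x y assume "c k x = c k y"
  then have eq: "A l x = A l y" "B l x = B l y" if "l \<le> k" for l
    using adaptedD[OF A refine_le[OF that]] adaptedD[OF B refine_le[OF that]] by blast+
  have B': "(\<forall>l'<l. \<not> t \<le> B l' x) = (\<forall>l'<l. \<not> t \<le> B l' y)" if "l \<le> k" for l t
  proof (intro all_cong1 imp_cong refl arg_cong[where f = Not])
    fix l' assume "l' < l"
    then show "(t \<le> B l' x) = (t \<le> B l' y)" using eq(2)[of l'] that by simp
  qed
  have "(l \<le> k \<and> s \<le> A l x \<and> (\<forall>l'<l. \<not> t \<le> B l' x)) = (l \<le> k \<and> s \<le> A l y \<and> (\<forall>l'<l. \<not> t \<le> B l' y))" for l s t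
    using eq(1)[of l] B'[of l t] by (cases "l \<le> k") simp_all
  then show "earlier A B k x = earlier A B k y"
    unfolding earlier_def eq[OF order_refl] by simp
qed

text \<open>One of the two least generations a and b is not larger than the other; if they coincide,
  both alternatives hold.\<close>

lemma earlier_cases:
  assumes "0 < A k x" "A k x < top" "0 < B k x" "B k x < top"
  shows "earlier A B k x \<or> earlier B A k x"
proof -
  define a where "a = (LEAST l. pow2 (lev (A k x)) \<le> A l x)"
  define b where "b = (LEAST l. pow2 (lev (B k x)) \<le> B l x)"
  have A: "pow2 (lev (A k x)) \<le> A k x" and B: "pow2 (lev (B k x)) \<le> B k x"
    using assms lev_bounds by auto
  have "pow2 (lev (A k x)) \<le> A a x" "a \<le> k"
    unfolding a_def by (rule LeastI[where P = "\<lambda>l. pow2 (lev (A k x)) \<le> A l x", OF A] Least_le[where P = "\<lambda>l. pow2 (lev (A k x)) \<le> A l x", OF A])+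
  moreover have "pow2 (lev (B k x)) \<le> B b x" "b \<le> k"
    unfolding b_def by (rule LeastI[where P = "\<lambda>l. pow2 (lev (B k x)) \<le> B l x", OF B] Least_le[where P = "\<lambda>l. pow2 (lev (B k x)) \<le> B l x", OF B])+
  moreover have "\<not> pow2 (lev (A k x)) \<le> A l x" if "l < a" for l
    using not_less_Least[of l] that unfolding a_def by blast
  moreover have "\<not> pow2 (lev (B k x)) \<le> B l x" if "l < b" for l
    using not_less_Least[of l] that unfolding b_def by blast
  ultimately have "a \<le> b \<Longrightarrow> earlier A B k x" "b \<le> a \<Longrightarrow> earlier B A k x"
    unfolding earlier_def using assms(1,3) order_less_le_trans by blast+
  then show ?thesis using linear[of a b] by blast
qed

text \<open>A reached its level of generation k not later than B reached its own. By generation l, B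
  has reached that same level, so this moment m is at most l, and A does not decrease after it. No
  order of k and l is assumed, so exchanging them gives equality, which is the condition
  \<open>P_lev\<close> of \<open>corona_half\<close>.\<close>

lemma earlier_lev_le:
  assumes "earlier A B k x" "earlier A B l x" "lev (B k x) = lev (B l x)"
    and "\<And>k. A k x < top" "\<And>k. B k x < top" and mono: "\<And>k l. k \<le> l \<Longrightarrow> A k x \<le> A l x"
  shows "lev (A k x) \<le> lev (A l x)"
proof -
  obtain m where m: "pow2 (lev (A k x)) \<le> A m x" "\<And>l'. l' < m \<Longrightarrow> \<not> pow2 (lev (B k x)) \<le> B l' x"
    using assms(1) by (auto simp: earlier_def)
  have "0 < B l x" "0 < A l x" using assms(2) by (auto simp: earlier_def)
  then have "pow2 (lev (B k x)) \<le> B l x" unfolding assms(3) using assms(5) by (intro lev_bounds)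
  then have "m \<le> l" using m(2)[of l] by (meson not_le)
  then have "pow2 (lev (A k x)) \<le> A l x" by (rule order_trans[OF m(1) mono])
  then show ?thesis using le_lev_iff[OF \<open>0 < A l x\<close> assms(4)] by simp
qed

text \<open>Each summand is a sum over cells of \<lambda>(Q) \<sigma>(Q) \<mu>(Q) times the averages
  of f and g, and so is symmetric in the two sides. The cells of P stay integrals over \<mu>; those
  of P' become integrals over \<sigma>, and there g and q' take the roles of f and p.\<close>

theorem dyadic_bilinear:
  assumes \<sigma> [measurable_cong]: "sets \<sigma> = sets M" and \<mu> [measurable_cong]: "sets \<mu> = sets M"
    and fin\<sigma>: "\<And>k x. cm \<sigma> k x < top" and fin\<mu>: "\<And>k x. cm \<mu> k x < top"
    and p: "dual_exp p p'" and q: "dual_exp q q'" and pq: "p \<le> q"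
    and [measurable]: "f \<in> borel_measurable M" "g \<in> borel_measurable M"
    and f: "(\<integral>\<^sup>+ x. epowr (f x) p \<partial>\<sigma>) \<le> 1" and g: "(\<integral>\<^sup>+ x. epowr (g x) q' \<partial>\<mu>) \<le> 1"
    and lam: "\<And>k. adapted k (lam k)"
    and T: "testing \<sigma> \<mu> lam L p q C" and T': "testing \<mu> \<sigma> lam L q' p' C" and C: "C \<ge> 0"
  shows "(\<integral>\<^sup>+ x. (\<Sum>k<L. lam k x * (\<integral>\<^sup>+ y. f y * indicator (cell k x) y \<partial>\<sigma>)) * g x \<partial>\<mu>) \<le> ennreal (bilC p q p' q' C)"
proof -
  have p1: "p > 1" "p' > 1" and q1: "q > 1" "q' > 1" using dual_expD[OF p] dual_expD[OF q] by auto
  define A where "A = mx \<sigma> f"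
  define B where "B = mx \<mu> g"
  have A_top: "A k x < top" for k x
    unfolding A_def by (rule mx_less_top[OF \<sigma> fin\<sigma> _ _ f]) (use p1 in simp_all)
  have B_top: "B k x < top" for k x
    unfolding B_def by (rule mx_less_top[OF \<mu> fin\<mu> _ _ g]) (use q1 in simp_all)
  have [measurable]: "lam k \<in> borel_measurable M" for k by (rule adapted_measurable[OF lam]) simp
  have adA: "adapted k (A k)" and adB: "adapted k (B k)" for k
    unfolding A_def B_def by (rule adapted_mx)+
  have mono: "k \<le> l \<Longrightarrow> A k x \<le> A l x" "k \<le> l \<Longrightarrow> B k x \<le> B l x" for k l x
    unfolding A_def B_def by (simp_all add: mx_mono)
  define P where "P = earlier A B"
  define P' where "P' = earlier B A"
  have adP: "adapted k (P k)" and adP': "adapted k (P' k)" for k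
    unfolding P_def P'_def by (intro adapted_earlier adA adB)+
  have [measurable]: "Measurable.pred M (P k)" "Measurable.pred M (P' k)" for k
    by (rule adapted_pred adP adP')+
  let ?e = "\<lambda>k x. av \<sigma> f k x * av \<mu> g k x"
  have split: "(\<integral>\<^sup>+ x. (lam k x * (\<integral>\<^sup>+ y. f y * indicator (cell k x) y \<partial>\<sigma>)) * g x \<partial>\<mu>)
      \<le> (\<integral>\<^sup>+ x. lam k x * cm \<sigma> k x * ?e k x * of_bool (P k x) \<partial>\<mu>)
        + (\<integral>\<^sup>+ x. lam k x * cm \<mu> k x * (av \<mu> g k x * av \<sigma> f k x) * of_bool (P' k x) \<partial>\<sigma>)" for k
  proof -
    have ad1: "adapted k (\<lambda>x. lam k x * (av \<sigma> f k x * cm \<sigma> k x))"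
      by (intro adapted_mult lam adapted_av adapted_cm)
    have ad2: "adapted k (\<lambda>x. lam k x * (av \<mu> g k x * av \<sigma> f k x) * of_bool (P' k x))"
      by (intro adapted_mult lam adapted_av adapted_comp[OF adP'])
    have "(\<integral>\<^sup>+ x. (lam k x * (\<integral>\<^sup>+ y. f y * indicator (cell k x) y \<partial>\<sigma>)) * g x \<partial>\<mu>)
       = (\<integral>\<^sup>+ x. (lam k x * (av \<sigma> f k x * cm \<sigma> k x)) * g x \<partial>\<mu>)"
      by (simp add: av_mult_cm[OF \<sigma> fin\<sigma>])
    also have "\<dots> = (\<integral>\<^sup>+ x. (lam k x * (av \<sigma> f k x * cm \<sigma> k x)) * av \<mu> g k x \<partial>\<mu>)"
      by (rule nn_integral_mult_av[OF \<mu> fin\<mu> ad1]) measurable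
    also have "\<dots> \<le> (\<integral>\<^sup>+ x. lam k x * cm \<sigma> k x * ?e k x * of_bool (P k x)
          + lam k x * (av \<mu> g k x * av \<sigma> f k x) * of_bool (P' k x) * cm \<sigma> k x \<partial>\<mu>)"
    proof (rule nn_integral_mono)
      fix x
      show "(lam k x * (av \<sigma> f k x * cm \<sigma> k x)) * av \<mu> g k x \<le> lam k x * cm \<sigma> k x * ?e k x * of_bool (P k x)
          + lam k x * (av \<mu> g k x * av \<sigma> f k x) * of_bool (P' k x) * cm \<sigma> k x"
      \<comment> \<open>Where a running maximum vanishes so does the current average, and with it
        the whole term; elsewhere P or P' holds.\<close>
      proof (cases "A k x = 0 \<or> B k x = 0")
        case True
        then have "av \<sigma> f k x = 0 \<or> av \<mu> g k x = 0"
          using av_le_mx[of k k \<sigma> f x] av_le_mx[of k k \<mu> g x] by (auto simp: A_def B_def)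
        then show ?thesis by auto
      next
        case False
        then have "P k x \<or> P' k x"
          unfolding P_def P'_def using A_top B_top by (intro earlier_cases) (auto simp: zero_less_iff_neq_zero)
        then show ?thesis by (auto simp: mult_ac)
      qed
    qed
    also have "\<dots> = (\<integral>\<^sup>+ x. lam k x * cm \<sigma> k x * ?e k x * of_bool (P k x) \<partial>\<mu>)
          + (\<integral>\<^sup>+ x. lam k x * (av \<mu> g k x * av \<sigma> f k x) * of_bool (P' k x) * cm \<sigma> k x \<partial>\<mu>)"
      by (rule nn_integral_add) measurable
    also have "(\<integral>\<^sup>+ x. lam k x * (av \<mu> g k x * av \<sigma> f k x) * of_bool (P' k x) * cm \<sigma> k x \<partial>\<mu>)
        = (\<integral>\<^sup>+ x. lam k x * (av \<mu> g k x * av \<sigma> f k x) * of_bool (P' k x) * cm \<mu> k x \<partial>\<sigma>)"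
      by (rule nn_integral_cm_swap[OF \<sigma> \<mu> ad2])
    also have "\<dots> = (\<integral>\<^sup>+ x. lam k x * cm \<mu> k x * (av \<mu> g k x * av \<sigma> f k x) * of_bool (P' k x) \<partial>\<sigma>)"
      by (simp only: mult_ac)
    finally show ?thesis .
  qed
  have pos1: "0 < mx \<sigma> f k x \<and> 0 < mx \<mu> g k x" if "P k x" for k x
    using that unfolding P_def earlier_def A_def B_def by blast
  have pos2: "0 < mx \<mu> g k x \<and> 0 < mx \<sigma> f k x" if "P' k x" for k x
    using that unfolding P'_def earlier_def A_def B_def by blast
  have lev1: "lev (A k x) = lev (A l x)" if "P k x" "P l x" "lev (B k x) = lev (B l x)" for k l x
    using that unfolding P_def
    by (intro antisym earlier_lev_le[of A B]) (simp_all only: A_top B_top mono)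
  have lev2: "lev (B k x) = lev (B l x)" if "P' k x" "P' l x" "lev (A k x) = lev (A l x)" for k l x
    using that unfolding P'_def
    by (intro antisym earlier_lev_le[of B A]) (simp_all only: A_top B_top mono)
  note lev1' = lev1[unfolded A_def B_def] and lev2' = lev2[unfolded A_def B_def]
  have measF: "f \<in> borel_measurable M" and measG: "g \<in> borel_measurable M" by measurable
  have "(\<integral>\<^sup>+ x. (\<Sum>k<L. lam k x * (\<integral>\<^sup>+ y. f y * indicator (cell k x) y \<partial>\<sigma>)) * g x \<partial>\<mu>)
      = (\<integral>\<^sup>+ x. (\<Sum>k<L. (lam k x * (av \<sigma> f k x * cm \<sigma> k x)) * g x) \<partial>\<mu>)"
    by (simp add: av_mult_cm[OF \<sigma> fin\<sigma>] sum_distrib_right)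
  also have "\<dots> = (\<Sum>k<L. (\<integral>\<^sup>+ x. (lam k x * (av \<sigma> f k x * cm \<sigma> k x)) * g x \<partial>\<mu>))"
    by (rule nn_integral_sum) measurable
  also have "\<dots> \<le> (\<Sum>k<L. (\<integral>\<^sup>+ x. lam k x * cm \<sigma> k x * ?e k x * of_bool (P k x) \<partial>\<mu>)
        + (\<integral>\<^sup>+ x. lam k x * cm \<mu> k x * (av \<mu> g k x * av \<sigma> f k x) * of_bool (P' k x) \<partial>\<sigma>))"
    using split by (intro sum_mono) (simp add: av_mult_cm[OF \<sigma> fin\<sigma>])
  also have "\<dots> = (\<integral>\<^sup>+ x. (\<Sum>k<L. lam k x * cm \<sigma> k x * ?e k x * of_bool (P k x)) \<partial>\<mu>)
        + (\<integral>\<^sup>+ x. (\<Sum>k<L. lam k x * cm \<mu> k x * (av \<mu> g k x * av \<sigma> f k x) * of_bool (P' k x)) \<partial>\<sigma>)"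
    unfolding sum.distrib by (intro arg_cong2[where f = "(+)"] nn_integral_sum[symmetric]) measurable
  also have "\<dots> \<le> ennreal (4 * (C * maxC p powr (q / p) + maxC q')) + ennreal (4 * (C * maxC q' powr (p' / q') + maxC p))"
  proof (rule add_mono)
    show "(\<integral>\<^sup>+ x. (\<Sum>k<L. lam k x * cm \<sigma> k x * ?e k x * of_bool (P k x)) \<partial>\<mu>) \<le> ennreal (4 * (C * maxC p powr (q / p) + maxC q'))"
      by (rule corona_half[OF \<sigma> \<mu> fin\<sigma> fin\<mu> _ pq q _ _ f g lam adP _ _ T C])
         (simp_all only: p1 pos1 measF measG, rule lev1')
    show "(\<integral>\<^sup>+ x. (\<Sum>k<L. lam k x * cm \<mu> k x * (av \<mu> g k x * av \<sigma> f k x) * of_bool (P' k x)) \<partial>\<sigma>) \<le> ennreal (4 * (C * maxC q' powr (p' / q') + maxC p))"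
      by (rule corona_half[OF \<mu> \<sigma> fin\<mu> fin\<sigma> _ dual_exp_le[OF p q pq] dual_exp_sym[OF p] _ _ g f lam adP' _ _ T' C])
         (simp_all only: q1 pos2 measF measG, rule lev2')
  qed
  also have "\<dots> = ennreal (bilC p q p' q' C)"
    unfolding bilC_def using C maxC_pos p1 q1 by (subst ennreal_plus[symmetric]) (auto simp: less_imp_le)
  finally show ?thesis .
qed


text \<open>The extremal function is a multiple of h^(q - 1), but normalising it requires a finite
  integral of h^q. It is therefore built from the truncations \<open>hn\<close>, which are bounded
  and supported on finitely many cells of generation 0, and monotone convergence gives the bound for
  h.\<close>

lemma dual_norm_le:
  assumes \<mu> [measurable_cong]: "sets \<mu> = sets M" and fin: "\<And>x. cm \<mu> 0 x < top"
    and q: "dual_exp q q'" and [measurable]: "h \<in> borel_measurable M" and D: "D \<ge> 0"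
    and H: "\<And>g. g \<in> borel_measurable M \<Longrightarrow> (\<integral>\<^sup>+ x. epowr (g x) q' \<partial>\<mu>) \<le> 1 \<Longrightarrow> (\<integral>\<^sup>+ x. h x * g x \<partial>\<mu>) \<le> ennreal D"
  shows "(\<integral>\<^sup>+ x. epowr (h x) q \<partial>\<mu>) \<le> ennreal (D powr q)"
proof -
  have q1: "q > 1" "q' > 1" "(q - 1) * q' = q" using dual_expD[OF q] by auto
  have qq: "1 - 1 / q' = 1 / q" using q by (auto simp: dual_exp_def)
  \<comment> \<open>The cells of generation 0 whose label has number at most n in the enumeration
    \<open>to_nat\<close>: a set of finite measure, increasing with n to the whole space.\<close>
  define E where "E n = (\<Union>i\<in>to_nat -` {..n}. {y. c 0 y = i})" for n
  have E_iff: "x \<in> E n \<longleftrightarrow> to_nat (c 0 x) \<le> n" for x n by (auto simp: E_def)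
  have finI: "finite (to_nat -` {..n} :: 'i set)" for n by (intro finite_vimageI) auto
  have [measurable]: "E n \<in> sets M" for n unfolding E_def using finI by (intro sets.finite_UN) auto
  have cell_fin: "emeasure \<mu> {y. c 0 y = i} < top" for i
  proof (cases "\<exists>x. c 0 x = i")
    case True then show ?thesis using fin by (auto simp: cm_def cell_def)
  next
    case False
    then have "{y. c 0 y = i} = {}" by auto
    then show ?thesis by (simp only:) simp
  qed
  have E_fin: "emeasure \<mu> (E n) < top" for n
  proof -
    have "emeasure \<mu> (E n) \<le> (\<Sum>i\<in>to_nat -` {..n}. emeasure \<mu> {y. c 0 y = i})"
      unfolding E_def using finI by (intro emeasure_subadditive_finite) (auto simp: \<mu>)
    also have "\<dots> < top"
      using cell_fin finI by simp
    finally show ?thesis .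
  qed
  define hn where "hn n x = min (h x) (of_nat n) * indicator (E n) x" for n x
  have [measurable]: "hn n \<in> borel_measurable M" for n unfolding hn_def by measurable
  have hn_le: "hn n x \<le> h x" for n x by (auto simp: hn_def indicator_def)
  have Y_le: "(\<integral>\<^sup>+ x. epowr (hn n x) q \<partial>\<mu>) \<le> ennreal (D powr q)" for n
  proof -
    define Y where "Y = (\<integral>\<^sup>+ x. epowr (hn n x) q \<partial>\<mu>)"
    have "Y \<le> (\<integral>\<^sup>+ x. epowr (of_nat n) q * indicator (E n) x \<partial>\<mu>)"
      unfolding Y_def using q1 by (intro nn_integral_mono) (auto simp: hn_def indicator_def epowr_zero intro!: epowr_mono)
    also have "\<dots> = epowr (of_nat n) q * emeasure \<mu> (E n)"
      by (rule nn_integral_cmult_indicator) (simp add: \<mu>)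
    also have "\<dots> < top"
      using E_fin q1 epowr_less_top[of q "of_nat n"]
      by (simp add: ennreal_mult_less_top ennreal_of_nat_eq_real_of_nat)
    finally have "Y < top" .
    then obtain y where y: "Y = ennreal y" "y \<ge> 0" by (cases Y) auto
    show ?thesis
    proof (cases "y = 0")
      case True
      then show ?thesis using y by (simp add: Y_def[symmetric])
    next
      case False
      then have ypos: "y > 0" using y by simp
      \<comment> \<open>Since (q - 1) q' = q, this factor makes the integral of g^q' equal to 1,
        while t y = y^(1/q).\<close>
      define t where "t = y powr (- (1 / q'))"
      have t: "t > 0" using ypos by (simp add: t_def)
      define g where "g x = ennreal t * epowr (hn n x) (q - 1)" for x
      have [measurable]: "g \<in> borel_measurable M" unfolding g_def by measurable
      have "epowr (g x) q' = ennreal (1 / y) * epowr (hn n x) q" for x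
      proof -
        have "epowr (g x) q' = epowr (ennreal t) q' * epowr (epowr (hn n x) (q - 1)) q'"
          unfolding g_def using q1 by (intro epowr_mult) auto
        moreover have "t powr q' = 1 / y"
          unfolding t_def powr_powr using ypos q1 by (simp add: powr_minus_divide)
        then have "epowr (ennreal t) q' = ennreal (1 / y)"
          using t by (simp add: epowr_ennreal_pos)
        ultimately show ?thesis using q1 by (simp add: epowr_epowr)
      qed
      then have "(\<integral>\<^sup>+ x. epowr (g x) q' \<partial>\<mu>) = ennreal (1 / y) * Y"
        unfolding Y_def by (simp add: nn_integral_cmult)
      also have "\<dots> = 1" using ypos by (simp add: y ennreal_mult[symmetric])
      finally have le: "(\<integral>\<^sup>+ x. h x * g x \<partial>\<mu>) \<le> ennreal D"
        by (intro H) auto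
      have "ennreal t * Y = (\<integral>\<^sup>+ x. ennreal t * epowr (hn n x) q \<partial>\<mu>)"
        unfolding Y_def by (simp add: nn_integral_cmult)
      also have "\<dots> \<le> (\<integral>\<^sup>+ x. h x * g x \<partial>\<mu>)"
      proof (rule nn_integral_mono)
        fix x
        have "epowr (hn n x) q = epowr (hn n x) 1 * epowr (hn n x) (q - 1)"
          using q1 by (subst epowr_add[symmetric]) auto
        also have "\<dots> \<le> h x * epowr (hn n x) (q - 1)"
          using hn_le by (intro mult_right_mono) (auto simp: epowr_1_right)
        finally have "ennreal t * epowr (hn n x) q \<le> ennreal t * (h x * epowr (hn n x) (q - 1))"
          by (rule mult_left_mono) simp
        then show "ennreal t * epowr (hn n x) q \<le> h x * g x"
          unfolding g_def by (simp only: mult.left_commute)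
      qed
      also note le
      finally have "t * y \<le> D" using t D y by (simp add: ennreal_mult[symmetric])
      moreover have "t * y = y powr (1 / q)"
      proof -
        have "t * y = y powr (- (1 / q')) * y powr 1" using ypos by (simp add: t_def)
        also have "\<dots> = y powr (- (1 / q') + 1)" by (rule powr_add[symmetric])
        also have "- (1 / q') + 1 = 1 / q" using qq by simp
        finally show ?thesis .
      qed
      ultimately have "(y powr (1 / q)) powr q \<le> D powr q" using q1 by (intro powr_mono2) auto
      then have "y \<le> D powr q" using ypos q1 by (simp add: powr_powr)
      then show ?thesis unfolding Y_def[symmetric] y by (rule ennreal_leI)
    qed
  qed
  have hS: "h x = (SUP n. hn n x)" for x
  proof (rule antisym)
    show "h x \<le> (SUP n. hn n x)"
    proof (rule dense_le)
      fix y assume y: "y < h x"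
      then obtain n0 :: nat where "y < of_nat n0" by (meson less_top ennreal_Ex_less_of_nat order_less_le_trans top_greatest)
      define n where "n = max n0 (to_nat (c 0 x))"
      have "of_nat n0 \<le> (of_nat n :: ennreal)" unfolding n_def by (rule of_nat_mono) simp
      then have "y \<le> of_nat n" using \<open>y < of_nat n0\<close> by (meson less_imp_le order_trans)
      moreover have "x \<in> E n" by (simp add: E_iff n_def)
      ultimately have "y \<le> hn n x" using y by (auto simp: hn_def less_imp_le)
      also have "\<dots> \<le> (SUP n. hn n x)" by (rule SUP_upper) simp
      finally show "y \<le> (SUP n. hn n x)" .
    qed
    show "(SUP n. hn n x) \<le> h x" by (rule SUP_least) (rule hn_le)
  qed
  have "epowr (h x) q = (SUP n. epowr (hn n x) q)" for x
    using q1 by (subst hS, intro epowr_SUP) simp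
  then have "(\<integral>\<^sup>+ x. epowr (h x) q \<partial>\<mu>) = (\<integral>\<^sup>+ x. (SUP n. epowr (hn n x) q) \<partial>\<mu>)"
    by (rule nn_integral_cong)
  also have "\<dots> = (SUP n. \<integral>\<^sup>+ x. epowr (hn n x) q \<partial>\<mu>)"
  proof (rule nn_integral_monotone_convergence_SUP)
    show "incseq (\<lambda>n x. epowr (hn n x) q)"
    proof (rule incseq_SucI, rule le_funI)
      fix n x
      have "hn n x \<le> hn (Suc n) x"
      proof (cases "x \<in> E n")
        case True
        then have "x \<in> E (Suc n)" by (simp add: E_iff)
        moreover have "(of_nat n :: ennreal) \<le> of_nat (Suc n)" by (rule of_nat_mono) simp
        ultimately show ?thesis using True by (simp add: hn_def min.coboundedI2 del: of_nat_Suc)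
      qed (simp add: hn_def)
      then show "epowr (hn n x) q \<le> epowr (hn (Suc n) x) q"
        using q1 by (intro epowr_mono) auto
    qed
  qed measurable
  also have "\<dots> \<le> ennreal (D powr q)" by (rule SUP_least) (rule Y_le)
  finally show ?thesis .
qed

text \<open>Duality settles normalised f, and homogeneity the rest. The two norms that cannot be
  scaled to 1 are harmless: for norm 0 the operator vanishes on f, and for norm \<infinity> so does
  the content of the claim.\<close>

theorem dyadic_norm:
  assumes \<sigma> [measurable_cong]: "sets \<sigma> = sets M" and \<mu> [measurable_cong]: "sets \<mu> = sets M"
    and fin\<sigma>: "\<And>k x. cm \<sigma> k x < top" and fin\<mu>: "\<And>k x. cm \<mu> k x < top"
    and p: "dual_exp p p'" and q: "dual_exp q q'" and pq: "p \<le> q"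
    and f [measurable]: "f \<in> borel_measurable M"
    and lam: "\<And>k. adapted k (lam k)"
    and T: "testing \<sigma> \<mu> lam L p q C" and T': "testing \<mu> \<sigma> lam L q' p' C" and C: "C \<ge> 0"
  shows "(\<integral>\<^sup>+ x. epowr (\<Sum>k<L. lam k x * (\<integral>\<^sup>+ y. f y * indicator (cell k x) y \<partial>\<sigma>)) q \<partial>\<mu>)
    \<le> ennreal (bilC p q p' q' C powr q) * epowr (\<integral>\<^sup>+ x. epowr (f x) p \<partial>\<sigma>) (q / p)"
proof -
  have p1: "p > 1" "p' > 1" and q1: "q > 1" "q' > 1" using dual_expD[OF p] dual_expD[OF q] by auto
  define D where "D = bilC p q p' q' C"
  \<comment> \<open>Strict positivity is wanted: D^q times \<infinity> has to be \<infinity> when f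
    has infinite norm.\<close>
  have D: "D > 0" unfolding D_def bilC_def
    using C maxC_pos[of p] maxC_pos[of q'] p1 q1 by (intro add_pos_pos mult_pos_pos add_nonneg_pos) auto
  have [measurable]: "lam k \<in> borel_measurable M" for k by (rule adapted_measurable[OF lam]) simp
  define T where "T f x = (\<Sum>k<L. lam k x * (\<integral>\<^sup>+ y. f y * indicator (cell k x) y \<partial>\<sigma>))" for f x
  have T_meas: "T f \<in> borel_measurable M" if [measurable]: "f \<in> borel_measurable M" for f
  proof -
    have "(\<lambda>x. \<Sum>k<L. lam k x * (av \<sigma> f k x * cm \<sigma> k x)) \<in> borel_measurable M" by measurable
    then show ?thesis unfolding T_def by (simp only: av_mult_cm[OF \<sigma> fin\<sigma> that])
  qed
  have normalized: "(\<integral>\<^sup>+ x. epowr (T f x) q \<partial>\<mu>) \<le> ennreal (D powr q)"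
    if [measurable]: "f \<in> borel_measurable M" and le: "(\<integral>\<^sup>+ x. epowr (f x) p \<partial>\<sigma>) \<le> 1" for f
  proof (rule dual_norm_le[OF \<mu> fin\<mu> q T_meas[OF that(1)]])
    show "0 \<le> D" using D by simp
    show "(\<integral>\<^sup>+ x. T f x * g x \<partial>\<mu>) \<le> ennreal D"
      if "g \<in> borel_measurable M" "(\<integral>\<^sup>+ x. epowr (g x) q' \<partial>\<mu>) \<le> 1" for g
      unfolding T_def D_def
      by (rule dyadic_bilinear[OF \<sigma> \<mu> fin\<sigma> fin\<mu> p q pq \<open>f \<in> borel_measurable M\<close> that(1) le that(2) lam assms(10) T' C])
  qed
  define X where "X = (\<integral>\<^sup>+ x. epowr (f x) p \<partial>\<sigma>)"
  consider "X = 0" | "X = top" | x where "X = ennreal x" "x > 0"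
    by (cases X) (auto simp: less_le)
  then have "(\<integral>\<^sup>+ x. epowr (T f x) q \<partial>\<mu>) \<le> ennreal (D powr q) * epowr X (q / p)"
  proof cases
    case 1
    then have "AE x in \<sigma>. epowr (f x) p = 0"
      unfolding X_def by (subst (asm) nn_integral_0_iff_AE) auto
    then have AE0: "AE x in \<sigma>. f x = 0" using p1 by (simp add: epowr_eq_0_iff)
    have "T f x = 0" for x
    proof -
      have "(\<integral>\<^sup>+ y. f y * indicator (cell k x) y \<partial>\<sigma>) = 0" for k
        using AE0 by (subst nn_integral_0_iff_AE) auto
      then show ?thesis by (simp add: T_def)
    qed
    then show ?thesis using q1 by (simp add: epowr_zero)
  next
    case 2
    then show ?thesis using D p1 q1 by (simp add: epowr_top ennreal_mult_top)
  next
    case (3 x)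
    define t where "t = x powr (- (1 / p))"
    have t: "t > 0" using 3 by (simp add: t_def)
    have "(\<integral>\<^sup>+ y. epowr (ennreal t * f y) p \<partial>\<sigma>) = epowr (ennreal t) p * X"
      unfolding X_def using p1 by (simp add: epowr_mult nn_integral_cmult)
    also have "\<dots> = 1"
    proof -
      have "t powr p = 1 / x" unfolding t_def powr_powr using 3 p1 by (simp add: powr_minus_divide)
      then show ?thesis using 3 t by (simp add: epowr_ennreal_pos ennreal_mult[symmetric])
    qed
    finally have le: "(\<integral>\<^sup>+ x. epowr (T (\<lambda>y. ennreal t * f y) x) q \<partial>\<mu>) \<le> ennreal (D powr q)"
      by (intro normalized) auto
    have T_scale: "T (\<lambda>y. ennreal t * f y) x = ennreal t * T f x" for x
      unfolding T_def by (simp add: sum_distrib_left nn_integral_cmult mult.assoc mult.left_commute)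
    have [measurable]: "T f \<in> borel_measurable M" by (rule T_meas[OF f])
    have "epowr (ennreal t) q * (\<integral>\<^sup>+ x. epowr (T f x) q \<partial>\<mu>) \<le> ennreal (D powr q)"
      using le q1 unfolding T_scale by (simp add: epowr_mult nn_integral_cmult)
    then have "epowr X (q / p) * (epowr (ennreal t) q * (\<integral>\<^sup>+ x. epowr (T f x) q \<partial>\<mu>)) \<le> epowr X (q / p) * ennreal (D powr q)"
      by (rule mult_left_mono) simp
    moreover have "epowr X (q / p) * epowr (ennreal t) q = 1"
    proof -
      have "x powr (q / p) * t powr q = 1"
        unfolding t_def powr_powr powr_add[symmetric] using 3 by simp
      then show ?thesis using 3 t by (simp add: epowr_ennreal_pos ennreal_mult[symmetric])
    qed
    ultimately show ?thesis by (simp only: mult.assoc[symmetric] mult_1_left) (simp only: mult.commute)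
  qed
  then show ?thesis unfolding T_def D_def X_def .
qed

end

section \<open>Testing conditions\<close>

text \<open>If m is the largest of the numbers (s / 2^a)^\<theta> N(a), then N(a) \<le> (2^a /
  s)^\<theta> m, and for 2^a \<le> s these factors sum geometrically. In the role of Hoelder's
  inequality, this moves a sum over levels outside the q-th power at the price of the weights (s /
  2^a)^(\<theta> q).\<close>

lemma sum_le_weighted:
  fixes N :: "int \<Rightarrow> ennreal"
  assumes F: "finite F" and s: "0 < s" and \<theta>: "\<theta> > 0" and q: "q > 0"
    and le: "\<And>a. a \<in> F \<Longrightarrow> 2 powr a \<le> s"
  shows "epowr (\<Sum>a\<in>F. N a) q
    \<le> ennreal (geoC \<theta> powr q) * isum (\<lambda>a. of_bool (2 powr a \<le> s) * epowr (ennreal ((s / 2 powr a) powr \<theta>) * N a) q)"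
proof (cases "F = {}")
  case True
  then show ?thesis using q by (simp add: epowr_zero)
next
  case False
  define X where "X a = ennreal ((s / 2 powr a) powr \<theta>) * N a" for a :: int
  define m where "m = Max (X ` F)"
  have "m \<in> X ` F" unfolding m_def using F False by (intro Max_in) auto
  then obtain b where b: "b \<in> F" "m = X b" by blast
  have N: "N a \<le> ennreal (s powr - \<theta>) * (pow2 (a * \<theta>) * of_bool (pow2 a \<le> ennreal s)) * m" if "a \<in> F" for a
  proof -
    have "(2 powr (a * \<theta>) * s powr - \<theta>) * (s / 2 powr a) powr \<theta> = 1"
      using s by (simp add: powr_divide powr_powr powr_minus field_simps)
    then have "N a = ennreal (2 powr (a * \<theta>) * s powr - \<theta>) * X a"
      unfolding X_def mult.assoc[symmetric] by (subst ennreal_mult[symmetric]) auto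
    also have "\<dots> \<le> ennreal (2 powr (a * \<theta>) * s powr - \<theta>) * m"
      using that F by (intro mult_left_mono) (auto simp: m_def)
    finally show ?thesis
      using le[OF that] s by (simp add: pow2_def ennreal_mult mult.commute ennreal_leI)
  qed
  have "(\<Sum>a\<in>F. N a) \<le> isum (\<lambda>a. ennreal (s powr - \<theta>) * (pow2 (a * \<theta>) * of_bool (pow2 a \<le> ennreal s)) * m)"
    using N by (rule sum_le_isum[OF F])
  also have "\<dots> = ennreal (s powr - \<theta>) * isum (\<lambda>a. pow2 (a * \<theta>) * of_bool (pow2 a \<le> ennreal s)) * m"
    by (simp add: nn_integral_cmult nn_integral_multc)
  also have "\<dots> \<le> ennreal (s powr - \<theta>) * (ennreal (geoC \<theta>) * epowr (ennreal s) \<theta>) * m"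
    using \<theta> by (intro mult_right_mono mult_left_mono isum_pow2_le) auto
  also have "\<dots> = ennreal (geoC \<theta>) * m"
  proof -
    have eq: "s powr - \<theta> * (geoC \<theta> * s powr \<theta>) = geoC \<theta>"
      using s by (simp add: powr_minus field_simps)
    have "ennreal (s powr - \<theta>) * (ennreal (geoC \<theta>) * ennreal (s powr \<theta>)) = ennreal (s powr - \<theta> * (geoC \<theta> * s powr \<theta>))"
      using geoC_pos[OF \<theta>] by (simp add: ennreal_mult)
    then show ?thesis unfolding epowr_ennreal_pos[OF s] eq by simp
  qed
  finally have "epowr (\<Sum>a\<in>F. N a) q \<le> epowr (ennreal (geoC \<theta>) * m) q"
    using q by (intro epowr_mono) auto
  also have "\<dots> = ennreal (geoC \<theta> powr q) * (of_bool (2 powr b \<le> s) * epowr (X b) q)"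
    using q geoC_pos[OF \<theta>] b le by (simp add: epowr_mult epowr_ennreal_pos)
  also have "\<dots> \<le> ennreal (geoC \<theta> powr q) * isum (\<lambda>a. of_bool (2 powr a \<le> s) * epowr (X a) q)"
    by (intro mult_left_mono isum_member_le) simp
  finally show ?thesis unfolding X_def .
qed

text \<open>Here \<eta> is the exponent of 2^a gained for the group of cells with measure near 2^a.
  Half of it pays for the weights of \<open>sum_le_weighted\<close>, with \<theta> = \<eta> / (2 q);
  the other half makes the series over a converge. The factor (2 G)^q comes from replacing a sum in
  a group by its maximum, and 2^\<eta> from the upper end 2^(a + 1) of the group.\<close>

definition levC :: "real \<Rightarrow> real \<Rightarrow> real \<Rightarrow> real \<Rightarrow> real" where
  "levC q \<eta> G C = geoC (\<eta> / (2 * q)) powr q * ((2 * G) powr q * C * 2 powr \<eta>) * geoC (\<eta> / 2)"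

context filtration
begin

text \<open>With \<kappa> the power \<alpha>/n - 1 of the volume, this is the dyadic fractional
  maximal function of \<sigma> localised to the cell of generation k, up to generation L.\<close>

definition tail_sup :: "(nat \<Rightarrow> ennreal) \<Rightarrow> nat \<Rightarrow> 'a measure \<Rightarrow> nat \<Rightarrow> 'a \<Rightarrow> ennreal" where
  "tail_sup \<kappa> L \<sigma> k x = (SUP l\<in>{k..<L}. \<kappa> l * cm \<sigma> l x)"

lemma measurable_tail_sup [measurable]: "tail_sup \<kappa> L \<sigma> k \<in> borel_measurable M"
  unfolding tail_sup_def by measurable

text \<open>Single cells are enough here: localised maximal functions on disjoint cells do not
  interact, and \<open>max_testing_first\<close> extends the condition to families.\<close>

definition max_testing :: "'a measure \<Rightarrow> 'a measure \<Rightarrow> (nat \<Rightarrow> ennreal) \<Rightarrow> nat \<Rightarrow> real \<Rightarrow> real \<Rightarrow> real \<Rightarrow> bool" where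
  "max_testing \<sigma> \<mu> \<kappa> L p q C \<longleftrightarrow> (\<forall>k<L. \<forall>x.
     (\<integral>\<^sup>+ y. epowr (tail_sup \<kappa> L \<sigma> k y) q * indicator (cell k x) y \<partial>\<mu>) \<le> ennreal C * epowr (cm \<sigma> k x) (q / p))"

text \<open>The maximal cells of E are disjoint, so their tests add up; as q/p \<ge> 1, each
  \<sigma>(Q)^(q/p) is at most t^(q/p - 1) \<sigma>(Q).\<close>

lemma max_testing_first:
  assumes \<sigma> [measurable_cong]: "sets \<sigma> = sets M" and \<mu> [measurable_cong]: "sets \<mu> = sets M"
    and p: "1 < p" "p \<le> q"
    and MT: "max_testing \<sigma> \<mu> \<kappa> L p q C" and E: "\<And>k. adapted k (E k)"
    and bound: "\<And>k x. k < L \<Longrightarrow> E k x \<Longrightarrow> cm \<sigma> k x \<le> t"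
  shows "(\<integral>\<^sup>+ x. (\<Sum>k<L. epowr (tail_sup \<kappa> L \<sigma> k x) q * of_bool (first E k x)) \<partial>\<mu>)
    \<le> ennreal C * (epowr t (q / p - 1) * emeasure \<sigma> {x. \<exists>k<L. E k x})"
proof -
  have r: "q / p - 1 \<ge> 0" using p by simp
  have adF: "adapted k (first E k)" for k by (rule adapted_first[OF E])
  have [measurable]: "Measurable.pred M (E k)" "Measurable.pred M (first E k)" for k
    by (rule adapted_pred E adF)+
  have step: "(\<integral>\<^sup>+ x. of_bool (first E k x) * epowr (tail_sup \<kappa> L \<sigma> k x) q \<partial>\<mu>)
      \<le> (\<integral>\<^sup>+ x. ennreal C * (of_bool (first E k x) * epowr (cm \<sigma> k x) (q / p - 1)) \<partial>\<sigma>)" if "k < L" for k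
  proof (rule nn_integral_cells_mono[OF \<mu> _ \<sigma>])
    fix x
    have ad: "adapted k (\<lambda>x. ennreal C * (of_bool (first E k x) * epowr (cm \<sigma> k x) (q / p - 1)))"
      by (intro adapted_mult adapted_comp[OF adF] adapted_comp[OF adapted_cm])
    have "(\<integral>\<^sup>+ y. (of_bool (first E k y) * epowr (tail_sup \<kappa> L \<sigma> k y) q) * indicator (cell k x) y \<partial>\<mu>)
       = of_bool (first E k x) * (\<integral>\<^sup>+ y. epowr (tail_sup \<kappa> L \<sigma> k y) q * indicator (cell k x) y \<partial>\<mu>)"
      by (rule nn_integral_adapted_cell[OF \<mu> adapted_comp[OF adF]]) measurable
    also have "\<dots> \<le> of_bool (first E k x) * (ennreal C * epowr (cm \<sigma> k x) (q / p))"
      using MT that unfolding max_testing_def by (intro mult_left_mono) auto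
    also have "epowr (cm \<sigma> k x) (q / p) = epowr (cm \<sigma> k x) (q / p - 1) * epowr (cm \<sigma> k x) 1"
      using r by (subst epowr_add[symmetric]) auto
    also have "of_bool (first E k x) * (ennreal C * (epowr (cm \<sigma> k x) (q / p - 1) * epowr (cm \<sigma> k x) 1))
       = (ennreal C * (of_bool (first E k x) * epowr (cm \<sigma> k x) (q / p - 1))) * cm \<sigma> k x"
      unfolding epowr_1_right by (simp only: mult_ac)
    also have "\<dots> = (ennreal C * (of_bool (first E k x) * epowr (cm \<sigma> k x) (q / p - 1))) * (\<integral>\<^sup>+ y. 1 * indicator (cell k x) y \<partial>\<sigma>)"
      by (simp add: cm_def \<sigma>)
    also have "\<dots> = (\<integral>\<^sup>+ y. (ennreal C * (of_bool (first E k y) * epowr (cm \<sigma> k y) (q / p - 1))) * 1 * indicator (cell k x) y \<partial>\<sigma>)"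
      by (rule nn_integral_adapted_cell[OF \<sigma> ad, symmetric]) measurable
    finally show "(\<integral>\<^sup>+ y. (of_bool (first E k y) * epowr (tail_sup \<kappa> L \<sigma> k y) q) * indicator (cell k x) y \<partial>\<mu>)
       \<le> (\<integral>\<^sup>+ y. (ennreal C * (of_bool (first E k y) * epowr (cm \<sigma> k y) (q / p - 1))) * indicator (cell k x) y \<partial>\<sigma>)"
      by (simp only: mult_1_right)
  qed measurable
  have "(\<integral>\<^sup>+ x. (\<Sum>k<L. epowr (tail_sup \<kappa> L \<sigma> k x) q * of_bool (first E k x)) \<partial>\<mu>)
      = (\<Sum>k<L. \<integral>\<^sup>+ x. of_bool (first E k x) * epowr (tail_sup \<kappa> L \<sigma> k x) q \<partial>\<mu>)"
    unfolding mult.commute[of "epowr _ _"] by (rule nn_integral_sum) measurable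
  also have "\<dots> \<le> (\<Sum>k<L. \<integral>\<^sup>+ x. ennreal C * (of_bool (first E k x) * epowr (cm \<sigma> k x) (q / p - 1)) \<partial>\<sigma>)"
    by (intro sum_mono step) simp
  also have "\<dots> \<le> (\<Sum>k<L. \<integral>\<^sup>+ x. ennreal C * epowr t (q / p - 1) * of_bool (first E k x) \<partial>\<sigma>)"
    using bound r by (intro sum_mono nn_integral_mono) (auto simp: first_def intro!: mult_left_mono epowr_mono)
  also have "\<dots> = (\<integral>\<^sup>+ x. ennreal C * epowr t (q / p - 1) * of_bool (\<exists>k<L. E k x) \<partial>\<sigma>)"
    unfolding sum_first[symmetric] sum_distrib_left by (rule nn_integral_sum[symmetric]) measurable
  also have "\<dots> = (\<integral>\<^sup>+ x. ennreal C * epowr t (q / p - 1) * indicator {x. \<exists>k<L. E k x} x \<partial>\<sigma>)"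
    by (intro nn_integral_cong) (simp add: indicator_def)
  also have "\<dots> = ennreal C * epowr t (q / p - 1) * emeasure \<sigma> {x. \<exists>k<L. E k x}"
    by (rule nn_integral_cmult_indicator) (unfold \<sigma>, rule sets_Ex_less, measurable)
  finally show ?thesis by (simp only: mult.assoc)
qed

lemma first_exists:
  assumes "E k x" shows "\<exists>k0\<le>k. first E k0 x"
proof -
  have "E (LEAST k. E k x) x" "(LEAST k. E k x) \<le> k"
    using assms by (rule LeastI, rule Least_le)
  moreover have "\<not> E l x" if "l < (LEAST k. E k x)" for l
    using not_less_Least[OF that] .
  ultimately show ?thesis unfolding first_def by blast
qed

lemma cell_subset_measure:
  assumes "sets \<sigma> = sets M" "\<And>k. adapted k (R k)" "R k x" "k < L"
  shows "cm \<sigma> k x \<le> emeasure \<sigma> {x. \<exists>k<L. R k x}"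
  unfolding cm_def
proof (rule emeasure_mono)
  show "cell k x \<subseteq> {x. \<exists>k<L. R k x}"
  proof
    fix y assume "y \<in> cell k x"
    then have "R k y" using adaptedD[OF assms(2), of k y x] assms(3) by (simp add: cell_def)
    then show "y \<in> {x. \<exists>k<L. R k x}" using assms(4) by blast
  qed
  show "{x. \<exists>k<L. R k x} \<in> sets \<sigma>"
    unfolding assms(1) by (rule sets_Ex_less) (rule adapted_pred[OF assms(2)])
qed

text \<open>Coefficients of total mass at most G turn the sum into at most G times a maximum, which
  on each maximal cell of R is bounded by the localised maximal function. No series over levels
  arises, so p = q is included.\<close>

theorem testing_summable:
  assumes \<sigma> [measurable_cong]: "sets \<sigma> = sets M" and \<mu> [measurable_cong]: "sets \<mu> = sets M"
    and p: "1 < p" "p \<le> q" and \<phi>: "\<And>k. adapted k (\<phi> k)"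
    and MT: "max_testing \<sigma> \<mu> \<kappa> L p q C" and G: "\<And>x. (\<Sum>k<L. \<phi> k x) \<le> ennreal G" and GC: "G \<ge> 0" "C \<ge> 0"
  shows "testing \<sigma> \<mu> (\<lambda>k x. \<kappa> k * \<phi> k x) L p q (G powr q * C)"
  unfolding testing_def
proof (intro allI impI)
  fix R :: "nat \<Rightarrow> 'a \<Rightarrow> bool" assume "\<forall>k. adapted k (R k)"
  then have R: "adapted k (R k)" for k by blast
  have adF: "adapted k (first R k)" for k by (rule adapted_first[OF R])
  have [measurable]: "Measurable.pred M (R k)" "Measurable.pred M (first R k)" for k
    by (rule adapted_pred R adF)+
  define s where "s = emeasure \<sigma> {x. \<exists>k<L. R k x}"
  have point: "epowr (\<Sum>k<L. \<kappa> k * \<phi> k x * cm \<sigma> k x * of_bool (R k x)) q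
      \<le> epowr (ennreal G) q * (\<Sum>k<L. epowr (tail_sup \<kappa> L \<sigma> k x) q * of_bool (first R k x))" for x
  proof (cases "\<exists>k<L. R k x")
    case False
    then have 0: "(\<Sum>k<L. \<kappa> k * \<phi> k x * cm \<sigma> k x * of_bool (R k x)) = 0" by auto
    have "epowr 0 q = 0" using p by (intro epowr_zero) simp
    then show ?thesis unfolding 0 by simp
  next
    case True
    then obtain k where "k < L" "R k x" by blast
    then obtain k0 where "k0 \<le> k" "first R k0 x" using first_exists[of R k x] by blast
    with \<open>k < L\<close> have k0: "k0 < L" "first R k0 x" by simp_all
    have "\<kappa> k * \<phi> k x * cm \<sigma> k x * of_bool (R k x) \<le> \<phi> k x * tail_sup \<kappa> L \<sigma> k0 x" if "k < L" for k
    proof (cases "R k x")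
      case True
      then have "k0 \<le> k" using k0(2) by (auto simp: first_def not_le[symmetric])
      then have "\<kappa> k * cm \<sigma> k x \<le> tail_sup \<kappa> L \<sigma> k0 x"
        unfolding tail_sup_def using that by (intro SUP_upper) auto
      then have "\<phi> k x * (\<kappa> k * cm \<sigma> k x) \<le> \<phi> k x * tail_sup \<kappa> L \<sigma> k0 x"
        by (rule mult_left_mono) simp
      then show ?thesis using True by (simp add: mult_ac)
    qed simp
    then have "(\<Sum>k<L. \<kappa> k * \<phi> k x * cm \<sigma> k x * of_bool (R k x)) \<le> (\<Sum>k<L. \<phi> k x * tail_sup \<kappa> L \<sigma> k0 x)"
      by (intro sum_mono) auto
    also have "\<dots> = (\<Sum>k<L. \<phi> k x) * tail_sup \<kappa> L \<sigma> k0 x" by (rule sum_distrib_right[symmetric])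
    also have "\<dots> \<le> ennreal G * tail_sup \<kappa> L \<sigma> k0 x" by (rule mult_right_mono[OF G]) simp
    finally have "epowr (\<Sum>k<L. \<kappa> k * \<phi> k x * cm \<sigma> k x * of_bool (R k x)) q \<le> epowr (ennreal G * tail_sup \<kappa> L \<sigma> k0 x) q"
      using p by (intro epowr_mono) auto
    also have "\<dots> = epowr (ennreal G) q * (epowr (tail_sup \<kappa> L \<sigma> k0 x) q * of_bool (first R k0 x))"
      using p k0 by (simp add: epowr_mult)
    also have "\<dots> \<le> epowr (ennreal G) q * (\<Sum>k<L. epowr (tail_sup \<kappa> L \<sigma> k x) q * of_bool (first R k x))"
      using k0(1) by (intro mult_left_mono member_le_sum) auto
    finally show ?thesis .
  qed
  have "(\<integral>\<^sup>+ x. epowr (\<Sum>k<L. \<kappa> k * \<phi> k x * cm \<sigma> k x * of_bool (R k x)) q \<partial>\<mu>)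
     \<le> (\<integral>\<^sup>+ x. epowr (ennreal G) q * (\<Sum>k<L. epowr (tail_sup \<kappa> L \<sigma> k x) q * of_bool (first R k x)) \<partial>\<mu>)"
    by (intro nn_integral_mono point)
  also have "\<dots> = epowr (ennreal G) q * (\<integral>\<^sup>+ x. (\<Sum>k<L. epowr (tail_sup \<kappa> L \<sigma> k x) q * of_bool (first R k x)) \<partial>\<mu>)"
    by (rule nn_integral_cmult) measurable
  also have "\<dots> \<le> epowr (ennreal G) q * (ennreal C * (epowr s (q / p - 1) * s))"
    unfolding s_def
    by (intro mult_left_mono max_testing_first[OF \<sigma> \<mu> p MT R] cell_subset_measure[OF \<sigma> R]) auto
  also have "epowr s (q / p - 1) * s = epowr s (q / p - 1) * epowr s 1"
    by (simp add: epowr_1_right)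
  also have "\<dots> = epowr s (q / p)"
    using p by (subst epowr_add[symmetric]) auto
  also have "epowr (ennreal G) q * (ennreal C * epowr s (q / p)) = ennreal (G powr q * C) * epowr s (q / p)"
    using GC p by (simp add: epowr_ennreal ennreal_mult mult.assoc)
  finally show "(\<integral>\<^sup>+ x. epowr (\<Sum>k<L. \<kappa> k * \<phi> k x * cm \<sigma> k x * of_bool (R k x)) q \<partial>\<mu>)
     \<le> ennreal (G powr q * C) * epowr (emeasure \<sigma> {x. \<exists>k<L. R k x}) (q / p)"
    unfolding s_def .
qed


text \<open>Cubes are grouped by the dyadic size of \<open>\<sigma>(Q)\<close>. Within a group the sum is comparable to a maximum,
  and summing over the groups costs only a geometric series: this needs \<open>p < q\<close> (\<open>\<epsilon> = 0\<close>), or a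
  family of nested cells (\<open>\<epsilon> = 1\<close>), where each group has measure comparable to a single cell.\<close>

theorem testing_geometric:
  assumes \<sigma> [measurable_cong]: "sets \<sigma> = sets M" and \<mu> [measurable_cong]: "sets \<mu> = sets M"
    and fin\<sigma>: "\<And>k x. cm \<sigma> k x < top"
    and p: "1 < p" "p \<le> q" and Z: "\<And>k. adapted k (Z k)"
    and MT: "max_testing \<sigma> \<mu> \<kappa> L p q C"
    and G: "\<And>K. finite K \<Longrightarrow> K \<noteq> {} \<Longrightarrow> (\<Sum>k\<in>K. \<kappa> k) \<le> ennreal G * \<kappa> (Max K)" and GC: "G > 0" "C > 0"
    and \<epsilon>: "(\<epsilon> = 0 \<and> p < q) \<or> (\<epsilon> = 1 \<and> (\<forall>k l x y. Z k x \<longrightarrow> Z l y \<longrightarrow> k \<le> l \<longrightarrow> c k x = c k y))"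
  shows "testing \<sigma> \<mu> (\<lambda>k x. \<kappa> k * of_bool (Z k x)) L p q (levC q (q / p - 1 + \<epsilon>) G C)"
  unfolding testing_def
proof (intro allI impI)
  fix R :: "nat \<Rightarrow> 'a \<Rightarrow> bool" assume "\<forall>k. adapted k (R k)"
  then have R: "adapted k (R k)" for k by blast
  have [measurable]: "Measurable.pred M (R k)" "Measurable.pred M (Z k)" for k
    by (rule adapted_pred R Z)+
  define \<Omega> where "\<Omega> = {x. \<exists>k<L. R k x}"
  have \<Omega>_sets [measurable]: "\<Omega> \<in> sets M" unfolding \<Omega>_def by (rule sets_Ex_less) measurable
  define r where "r = q / p"
  define \<eta> where "\<eta> = r - 1 + \<epsilon>"
  have r: "r \<ge> 1" using p by (simp add: r_def)
  have "(\<epsilon> = 0 \<and> p < q) \<or> \<epsilon> = 1" using \<epsilon> by blast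
  then have \<eta>: "\<eta> > 0" using p by (auto simp: \<eta>_def r_def)
  have q: "q > 0" using p by simp
  define D where "D = levC q \<eta> G C"
  have D: "D > 0" unfolding D_def levC_def
    using \<eta> q GC geoC_pos[of "\<eta> / (2 * q)"] geoC_pos[of "\<eta> / 2"] by (intro mult_pos_pos) auto
  have cm_le: "cm \<sigma> k x \<le> emeasure \<sigma> \<Omega>" if "R k x" "k < L" for k x
    unfolding \<Omega>_def using \<sigma> R that by (rule cell_subset_measure)
  let ?S = "\<lambda>x. \<Sum>k<L. \<kappa> k * of_bool (Z k x) * cm \<sigma> k x * of_bool (R k x)"
  consider "emeasure \<sigma> \<Omega> = 0" | "emeasure \<sigma> \<Omega> = top" | s where "emeasure \<sigma> \<Omega> = ennreal s" "s > 0"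
    by (cases "emeasure \<sigma> \<Omega>") (auto simp: less_le)
  then have "(\<integral>\<^sup>+ x. epowr (?S x) q \<partial>\<mu>) \<le> ennreal D * epowr (emeasure \<sigma> \<Omega>) r"
  proof cases
    case 1
    have "?S x = 0" for x
    proof (rule sum.neutral, rule ballI)
      fix k assume "k \<in> {..<L}"
      then show "\<kappa> k * of_bool (Z k x) * cm \<sigma> k x * of_bool (R k x) = 0"
        using cm_le[of k x] 1 by (cases "R k x") auto
    qed
    then show ?thesis using q by (simp only: epowr_zero) simp
  next
    case 2
    then show ?thesis using D r by (simp add: epowr_top ennreal_mult_top)
  next
    case (3 s)
    define E where "E a k x \<longleftrightarrow> (R k x \<and> Z k x) \<and> (0 < cm \<sigma> k x \<and> lev (cm \<sigma> k x) = a)" for a k x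
    have E: "adapted k (E a k)" for a k
      unfolding E_def
      by (rule adapted_comp2[where F = "(\<and>)", OF adapted_comp2[where F = "(\<and>)", OF R Z]
            adapted_comp[OF adapted_cm, of k "\<lambda>z. 0 < z \<and> lev z = a" \<sigma>]])
    have adF: "adapted k (first (E a) k)" for k a by (rule adapted_first[OF E])
    have [measurable]: "Measurable.pred M (E a k)" "Measurable.pred M (first (E a) k)" for k a
      by (rule adapted_pred E adF)+
    define N where "N a x = (\<Sum>k<L. \<kappa> k * cm \<sigma> k x * of_bool (E a k x))" for a x
    have [measurable]: "N a \<in> borel_measurable M" for a unfolding N_def by measurable
    define V where "V a = {x. \<exists>k<L. E a k x}" for a
    have E_bounds: "pow2 a \<le> cm \<sigma> k x" "cm \<sigma> k x \<le> pow2 (of_int a + 1)" if "E a k x" for a k x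
      using that lev_bounds[of "cm \<sigma> k x"] fin\<sigma>[of k x] by (auto simp: E_def less_imp_le)
    \<comment> \<open>In one group all measures agree up to the factor 2, and the sum of the
      \<kappa> is controlled by that of the smallest cell; so this cell, of generation m, dominates
      the group.\<close>
    have N_le: "epowr (N a x) q \<le> ennreal ((2 * G) powr q) * (\<Sum>k<L. epowr (tail_sup \<kappa> L \<sigma> k x) q * of_bool (first (E a) k x))" for a x
    proof (cases "\<exists>k<L. E a k x")
      case False
      then have 0: "N a x = 0" by (auto simp: N_def)
      have "epowr 0 q = 0" using q by (rule epowr_zero)
      then show ?thesis unfolding 0 by simp
    next
      case True
      then obtain k where "k < L" "E a k x" by blast
      then obtain k0 where "k0 \<le> k" "first (E a) k0 x" using first_exists[of "E a" k x] by blast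
      with \<open>k < L\<close> have k0: "k0 < L" "first (E a) k0 x" by simp_all
      define K where "K = {k \<in> {..<L}. E a k x}"
      have K: "finite K" "K \<noteq> {}" using \<open>k < L\<close> \<open>E a k x\<close> by (auto simp: K_def)
      define m where "m = Max K"
      have m: "m < L" "E a m x" using Max_in[OF K] by (auto simp: m_def K_def)
      have "k0 \<le> m" using m k0(2) by (auto simp: first_def not_le[symmetric])
      have "N a x = (\<Sum>k\<in>K. \<kappa> k * cm \<sigma> k x)"
        unfolding N_def K_def by (rule sum.mono_neutral_cong_right) auto
      also have "\<dots> \<le> (\<Sum>k\<in>K. \<kappa> k * pow2 (of_int a + 1))"
        using E_bounds(2)[of a _ x] by (intro sum_mono mult_left_mono) (auto simp: K_def)
      also have "\<dots> = (\<Sum>k\<in>K. \<kappa> k) * pow2 (of_int a + 1)" by (rule sum_distrib_right[symmetric])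
      also have "\<dots> \<le> (ennreal G * \<kappa> m) * (2 * cm \<sigma> m x)"
      proof (rule mult_mono)
        show "(\<Sum>k\<in>K. \<kappa> k) \<le> ennreal G * \<kappa> m" unfolding m_def by (rule G[OF K])
        have "pow2 (of_int a + 1) = 2 * pow2 a" by (simp add: pow2_def powr_add ennreal_mult mult.commute)
        also have "\<dots> \<le> 2 * cm \<sigma> m x" using E_bounds(1)[OF m(2)] by (rule mult_left_mono) simp
        finally show "pow2 (of_int a + 1) \<le> 2 * cm \<sigma> m x" .
      qed auto
      also have "\<dots> = ennreal (2 * G) * (\<kappa> m * cm \<sigma> m x)"
        using GC by (simp add: ennreal_mult mult_ac)
      also have "\<dots> \<le> ennreal (2 * G) * tail_sup \<kappa> L \<sigma> k0 x"
        unfolding tail_sup_def using \<open>k0 \<le> m\<close> m by (intro mult_left_mono SUP_upper) auto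
      finally have "epowr (N a x) q \<le> epowr (ennreal (2 * G) * tail_sup \<kappa> L \<sigma> k0 x) q"
        using q by (intro epowr_mono) auto
      also have "\<dots> = ennreal ((2 * G) powr q) * (epowr (tail_sup \<kappa> L \<sigma> k0 x) q * of_bool (first (E a) k0 x))"
        using q k0 GC by (simp add: epowr_mult epowr_ennreal_pos)
      also have "\<dots> \<le> ennreal ((2 * G) powr q) * (\<Sum>k<L. epowr (tail_sup \<kappa> L \<sigma> k x) q * of_bool (first (E a) k x))"
        using k0(1) by (intro mult_left_mono member_le_sum) auto
      finally show ?thesis .
    qed
    \<comment> \<open>The union of a group is bounded by the total measure s if \<epsilon> = 0, and
      by the measure of its largest cell, at most 2^(a + 1), if \<epsilon> = 1.\<close>
    have V_le: "emeasure \<sigma> (V a) \<le> epowr (pow2 (of_int a + 1)) \<epsilon> * ennreal (s powr (1 - \<epsilon>))" for a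
    proof (cases "\<epsilon> = 0")
      case True
      have "emeasure \<sigma> (V a) \<le> emeasure \<sigma> \<Omega>"
      proof (rule emeasure_mono)
        show "V a \<subseteq> \<Omega>" unfolding V_def \<Omega>_def E_def by blast
        show "\<Omega> \<in> sets \<sigma>" unfolding \<sigma> by (rule \<Omega>_sets)
      qed
      then show ?thesis using True 3 by (simp add: epowr_0_right)
    next
      case False
      then have eps: "\<epsilon> = 1" and chain: "\<And>k l x y. Z k x \<Longrightarrow> Z l y \<Longrightarrow> k \<le> l \<Longrightarrow> c k x = c k y"
        using \<epsilon> by blast+
      have "emeasure \<sigma> (V a) \<le> pow2 (of_int a + 1)"
      proof (cases "V a = {}")
        case False
        then have "\<exists>k. \<exists>x. E a k x" by (auto simp: V_def)
        then obtain x where x: "E a (LEAST k. \<exists>x. E a k x) x" using LeastI_ex[of "\<lambda>k. \<exists>x. E a k x"] by blast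
        \<comment> \<open>In a nested family the cell of least generation contains all the
          others.\<close>
        define k0 where "k0 = (LEAST k. \<exists>x. E a k x)"
        have "V a \<subseteq> cell k0 x"
        proof
          fix y assume "y \<in> V a"
          then obtain l where l: "E a l y" by (auto simp: V_def)
          then have "k0 \<le> l" unfolding k0_def by (intro Least_le) blast
          then have "c k0 x = c k0 y"
            using x l chain[of k0 x l y] by (simp add: E_def k0_def)
          then show "y \<in> cell k0 x" by (simp add: cell_def)
        qed
        then have "emeasure \<sigma> (V a) \<le> cm \<sigma> k0 x"
          unfolding cm_def by (rule emeasure_mono) (simp add: \<sigma>)
        also have "\<dots> \<le> pow2 (of_int a + 1)" using E_bounds(2) x by (simp add: k0_def)
        finally show ?thesis .
      qed simp
      then show ?thesis using eps 3 by (simp add: epowr_1_right)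
    qed
    define c1 where "c1 = (2 * G) powr q * C"
    have N_int: "(\<integral>\<^sup>+ x. epowr (N a x) q \<partial>\<mu>) \<le> ennreal (c1 * 2 powr ((of_int a + 1) * \<eta>) * s powr (1 - \<epsilon>))" for a
    proof -
      have "(\<integral>\<^sup>+ x. epowr (N a x) q \<partial>\<mu>)
          \<le> (\<integral>\<^sup>+ x. ennreal ((2 * G) powr q) * (\<Sum>k<L. epowr (tail_sup \<kappa> L \<sigma> k x) q * of_bool (first (E a) k x)) \<partial>\<mu>)"
        by (intro nn_integral_mono N_le)
      also have "\<dots> = ennreal ((2 * G) powr q) * (\<integral>\<^sup>+ x. (\<Sum>k<L. epowr (tail_sup \<kappa> L \<sigma> k x) q * of_bool (first (E a) k x)) \<partial>\<mu>)"
        by (rule nn_integral_cmult) measurable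
      also have "\<dots> \<le> ennreal ((2 * G) powr q) * (ennreal C * (epowr (pow2 (of_int a + 1)) (r - 1) * emeasure \<sigma> (V a)))"
        unfolding V_def r_def
        by (intro mult_left_mono max_testing_first[OF \<sigma> \<mu> p MT E] E_bounds(2)) auto
      also have "\<dots> \<le> ennreal ((2 * G) powr q) * (ennreal C * (epowr (pow2 (of_int a + 1)) (r - 1) * (epowr (pow2 (of_int a + 1)) \<epsilon> * ennreal (s powr (1 - \<epsilon>)))))"
        by (intro mult_left_mono V_le) auto
      also have "\<dots> = ennreal (c1 * 2 powr ((of_int a + 1) * \<eta>) * s powr (1 - \<epsilon>))"
      proof -
        have "epowr (pow2 (of_int a + 1)) (r - 1) * epowr (pow2 (of_int a + 1)) \<epsilon> = ennreal (2 powr ((of_int a + 1) * \<eta>))"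
          unfolding epowr_pow2 pow2_add[symmetric] by (simp add: pow2_def \<eta>_def distrib_left[symmetric])
        then show ?thesis
          using GC by (simp add: c1_def ennreal_mult mult.assoc[symmetric])
      qed
      finally show ?thesis .
    qed
    define \<theta> where "\<theta> = \<eta> / (2 * q)"
    have \<theta>: "\<theta> > 0" "\<theta> * q = \<eta> / 2" using \<eta> q by (auto simp: \<theta>_def)
    have point: "epowr (?S x) q \<le> ennreal (geoC \<theta> powr q)
        * isum (\<lambda>a. of_bool (2 powr a \<le> s) * epowr (ennreal ((s / 2 powr a) powr \<theta>) * N a x) q)" for x
    proof -
      define K where "K = {k \<in> {..<L}. (R k x \<and> Z k x) \<and> 0 < cm \<sigma> k x}"
      define F where "F = (\<lambda>k. lev (cm \<sigma> k x)) ` K"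
      have K: "finite K" by (simp add: K_def)
      have "?S x = (\<Sum>k\<in>K. \<kappa> k * cm \<sigma> k x)"
        unfolding K_def by (rule sum.mono_neutral_cong_right) (auto simp: zero_less_iff_neq_zero)
      also have "\<dots> = (\<Sum>a\<in>F. \<Sum>k | k \<in> K \<and> lev (cm \<sigma> k x) = a. \<kappa> k * cm \<sigma> k x)"
        unfolding F_def using K by (intro sum.group[symmetric]) auto
      also have "\<dots> = (\<Sum>a\<in>F. N a x)"
        unfolding N_def by (intro sum.cong refl sum.mono_neutral_cong_left) (auto simp: K_def E_def)
      finally have S: "?S x = (\<Sum>a\<in>F. N a x)" .
      show ?thesis unfolding S
      proof (rule sum_le_weighted)
        \<comment> \<open>A level that occurs satisfies 2^a \<le> \<sigma>(Q) \<le> s, so the series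
          over a is bounded above and runs only towards smaller cells.\<close>
        fix a assume "a \<in> F"
        then obtain k where k: "k < L" "E a k x" by (auto simp: F_def K_def E_def)
        then have "pow2 a \<le> ennreal s" using E_bounds(1)[OF k(2)] cm_le[of k x] 3 by (auto simp: E_def intro: order_trans)
        then show "2 powr a \<le> s" using 3 by (simp add: pow2_def ennreal_le_iff)
      qed (use K 3 \<theta> q in \<open>auto simp: F_def\<close>)
    qed
    \<comment> \<open>The powers of s combine to r - \<eta>/2, since r = \<eta> + 1 - \<epsilon>.
      The missing s^(\<eta>/2) is produced by the sum of 2^(a \<eta>/2) over 2^a \<le> s.\<close>
    have term_eq: "ennreal ((s / 2 powr a) powr (\<theta> * q)) * ennreal (c1 * 2 powr ((of_int a + 1) * \<eta>) * s powr (1 - \<epsilon>))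
       = ennreal (c1 * 2 powr \<eta> * s powr (r - \<eta> / 2)) * pow2 (a * (\<eta> / 2))" for a :: int
    proof -
      have e1: "(s / 2 powr a) powr (\<theta> * q) = s powr (\<eta> / 2) * 2 powr (- (a * (\<eta> / 2)))"
        unfolding \<theta>(2) using 3 by (simp add: powr_divide powr_powr powr_minus_divide)
      have "(s / 2 powr a) powr (\<theta> * q) * (c1 * 2 powr ((of_int a + 1) * \<eta>) * s powr (1 - \<epsilon>))
        = c1 * (s powr (\<eta> / 2) * s powr (1 - \<epsilon>)) * (2 powr (- (a * (\<eta> / 2))) * 2 powr ((of_int a + 1) * \<eta>))"
        unfolding e1 by (simp only: mult_ac)
      also have "\<dots> = c1 * s powr (r - \<eta> / 2) * 2 powr (\<eta> + a * (\<eta> / 2))"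
      proof -
        have "\<eta> / 2 + (1 - \<epsilon>) = r - \<eta> / 2" by (simp add: \<eta>_def field_simps)
        moreover have "- (real_of_int a * (\<eta> / 2)) + (of_int a + 1) * \<eta> = \<eta> + a * (\<eta> / 2)" by (simp add: algebra_simps)
        ultimately show ?thesis by (simp only: powr_add[symmetric])
      qed
      also have "\<dots> = (c1 * 2 powr \<eta> * s powr (r - \<eta> / 2)) * 2 powr (a * (\<eta> / 2))"
        by (simp only: powr_add mult_ac)
      finally have "(s / 2 powr a) powr (\<theta> * q) * (c1 * 2 powr ((of_int a + 1) * \<eta>) * s powr (1 - \<epsilon>))
        = (c1 * 2 powr \<eta> * s powr (r - \<eta> / 2)) * 2 powr (a * (\<eta> / 2))" .
      moreover have "0 \<le> c1" using GC by (simp add: c1_def)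
      ultimately show ?thesis unfolding pow2_def by (subst (1 2) ennreal_mult[symmetric]) auto
    qed
    have "(\<integral>\<^sup>+ x. epowr (?S x) q \<partial>\<mu>) \<le> (\<integral>\<^sup>+ x. ennreal (geoC \<theta> powr q)
        * isum (\<lambda>a. of_bool (2 powr a \<le> s) * epowr (ennreal ((s / 2 powr a) powr \<theta>) * N a x) q) \<partial>\<mu>)"
      by (intro nn_integral_mono point)
    also have "\<dots> = (\<integral>\<^sup>+ x. isum (\<lambda>a. ennreal (geoC \<theta> powr q)
        * (of_bool (2 powr a \<le> s) * epowr (ennreal ((s / 2 powr a) powr \<theta>) * N a x) q)) \<partial>\<mu>)"
      by (simp add: nn_integral_cmult)
    also have "\<dots> = isum (\<lambda>a. \<integral>\<^sup>+ x. ennreal (geoC \<theta> powr q)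
        * (of_bool (2 powr a \<le> s) * epowr (ennreal ((s / 2 powr a) powr \<theta>) * N a x) q) \<partial>\<mu>)"
      by (rule nn_integral_count_space_nn_integral) auto
    also have "\<dots> \<le> isum (\<lambda>a. ennreal (geoC \<theta> powr q) * (ennreal (c1 * 2 powr \<eta> * s powr (r - \<eta> / 2))
        * (pow2 (a * (\<eta> / 2)) * of_bool (pow2 a \<le> ennreal s))))"
    proof (rule nn_integral_mono)
      fix a :: int
      have "(\<integral>\<^sup>+ x. ennreal (geoC \<theta> powr q) * (of_bool (2 powr a \<le> s) * epowr (ennreal ((s / 2 powr a) powr \<theta>) * N a x) q) \<partial>\<mu>)
         = ennreal (geoC \<theta> powr q) * (of_bool (2 powr a \<le> s) * (ennreal ((s / 2 powr a) powr (\<theta> * q)) * (\<integral>\<^sup>+ x. epowr (N a x) q \<partial>\<mu>)))"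
        using q 3 by (simp add: epowr_mult epowr_ennreal_pos powr_powr nn_integral_cmult)
      also have "\<dots> \<le> ennreal (geoC \<theta> powr q) * (of_bool (2 powr a \<le> s) * (ennreal ((s / 2 powr a) powr (\<theta> * q)) * ennreal (c1 * 2 powr ((of_int a + 1) * \<eta>) * s powr (1 - \<epsilon>))))"
        by (intro mult_left_mono N_int) auto
      also have "\<dots> = ennreal (geoC \<theta> powr q) * (ennreal (c1 * 2 powr \<eta> * s powr (r - \<eta> / 2)) * (pow2 (a * (\<eta> / 2)) * of_bool (pow2 a \<le> ennreal s)))"
        unfolding term_eq using 3 by (simp add: pow2_def ennreal_le_iff mult_ac)
      finally show "(\<integral>\<^sup>+ x. ennreal (geoC \<theta> powr q) * (of_bool (2 powr a \<le> s) * epowr (ennreal ((s / 2 powr a) powr \<theta>) * N a x) q) \<partial>\<mu>)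
         \<le> ennreal (geoC \<theta> powr q) * (ennreal (c1 * 2 powr \<eta> * s powr (r - \<eta> / 2)) * (pow2 (a * (\<eta> / 2)) * of_bool (pow2 a \<le> ennreal s)))" .
    qed
    also have "\<dots> = ennreal (geoC \<theta> powr q) * (ennreal (c1 * 2 powr \<eta> * s powr (r - \<eta> / 2))
        * isum (\<lambda>a. pow2 (a * (\<eta> / 2)) * of_bool (pow2 a \<le> ennreal s)))"
      by (simp add: nn_integral_cmult)
    also have "\<dots> \<le> ennreal (geoC \<theta> powr q) * (ennreal (c1 * 2 powr \<eta> * s powr (r - \<eta> / 2))
        * (ennreal (geoC (\<eta> / 2)) * epowr (ennreal s) (\<eta> / 2)))"
      using \<eta> by (intro mult_left_mono isum_pow2_le) auto
    also have "\<dots> = ennreal D * epowr (ennreal s) r"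
    proof -
      have "geoC \<theta> powr q * (c1 * 2 powr \<eta> * s powr (r - \<eta> / 2) * (geoC (\<eta> / 2) * s powr (\<eta> / 2)))
        = geoC \<theta> powr q * (c1 * 2 powr \<eta>) * geoC (\<eta> / 2) * (s powr (r - \<eta> / 2) * s powr (\<eta> / 2))"
        by (simp only: mult_ac)
      also have "\<dots> = D * s powr r"
        by (simp add: D_def levC_def c1_def \<theta>_def powr_add[symmetric])
      finally have eq: "geoC \<theta> powr q * (c1 * 2 powr \<eta> * s powr (r - \<eta> / 2) * (geoC (\<eta> / 2) * s powr (\<eta> / 2))) = D * s powr r" .
      have nn: "0 \<le> c1" "0 \<le> geoC (\<eta> / 2)" using GC geoC_pos[of "\<eta> / 2"] \<eta> by (auto simp: c1_def)
      have "ennreal (geoC \<theta> powr q) * (ennreal (c1 * 2 powr \<eta> * s powr (r - \<eta> / 2)) * (ennreal (geoC (\<eta> / 2)) * ennreal (s powr (\<eta> / 2))))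
        = ennreal (geoC \<theta> powr q * (c1 * 2 powr \<eta> * s powr (r - \<eta> / 2) * (geoC (\<eta> / 2) * s powr (\<eta> / 2))))"
        using nn by (simp add: ennreal_mult)
      also have "\<dots> = ennreal D * ennreal (s powr r)"
        unfolding eq using D by (simp add: ennreal_mult)
      finally show ?thesis unfolding epowr_ennreal_pos[OF 3(2)] .
    qed
    finally show ?thesis using 3 by simp
  qed
  then show "(\<integral>\<^sup>+ x. epowr (?S x) q \<partial>\<mu>)
     \<le> ennreal (levC q (q / p - 1 + \<epsilon>) G C) * epowr (emeasure \<sigma> {x. \<exists>k<L. R k x}) (q / p)"
    unfolding D_def \<eta>_def r_def \<Omega>_def .
qed

end

section \<open>Shifted dyadic grids\<close>

text \<open>The one-third trick. Levels \<open>e\<close> and \<open>e + 1\<close> of a shifted grid are nested since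
  \<open>2 * shift b (e + 1) - shift b e\<close> is an integer.\<close>

definition shift :: "bool \<Rightarrow> int \<Rightarrow> real" where
  "shift b e = (if b then if even e then 1 / 3 else 2 / 3 else 0)"

definition gidx :: "('n::finite \<Rightarrow> bool) \<Rightarrow> int \<Rightarrow> real ^ 'n \<Rightarrow> 'n \<Rightarrow> int" where
  "gidx t e x = (\<lambda>i. \<lfloor>x $ i / 2 powr e + shift (t i) e\<rfloor>)"

text \<open>The argument of the floor at scale e + 1 is half of the one at scale e, shifted by an
  integer r, and the floor of (u + r) / 2 depends on u only through its own floor.\<close>

lemma gidx_refine:
  assumes "gidx t e x = gidx t e y"
  shows "gidx t (e + 1) x = gidx t (e + 1) y"
proof -
  have *: "\<exists>r::int. \<forall>z. \<lfloor>z / 2 powr real_of_int (e + 1) + shift b (e + 1)\<rfloor> = (\<lfloor>z / 2 powr e + shift b e\<rfloor> + r) div 2" for b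
  proof -
    define r :: int where "r = (if b \<and> even e then 1 else 0)"
    have s: "shift b (e + 1) = (shift b e + of_int r) / 2" by (auto simp: shift_def r_def)
    have "\<lfloor>z / 2 powr real_of_int (e + 1) + shift b (e + 1)\<rfloor> = (\<lfloor>z / 2 powr e + shift b e\<rfloor> + r) div 2" for z
    proof -
      have "z / 2 powr real_of_int (e + 1) + shift b (e + 1) = ((z / 2 powr e + shift b e) + of_int r) / of_int 2"
        unfolding s by (simp add: powr_add add_divide_distrib)
      also have "\<lfloor>\<dots>\<rfloor> = \<lfloor>(z / 2 powr e + shift b e) + of_int r\<rfloor> div 2"
        by (rule floor_divide_real_eq_div) simp
      also have "\<lfloor>(z / 2 powr e + shift b e) + of_int r\<rfloor> = \<lfloor>z / 2 powr e + shift b e\<rfloor> + r"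
        by (rule floor_add_int[symmetric])
      finally show ?thesis .
    qed
    then show ?thesis by blast
  qed
  show ?thesis
  proof
    fix i
    obtain r where "\<And>z. \<lfloor>z / 2 powr real_of_int (e + 1) + shift (t i) (e + 1)\<rfloor> = (\<lfloor>z / 2 powr e + shift (t i) e\<rfloor> + r) div 2"
      using * by blast
    then show "gidx t (e + 1) x i = gidx t (e + 1) y i"
      using fun_cong[OF assms, of i] unfolding gidx_def by simp
  qed
qed

lemma measurable_vec_nth_lebesgue [measurable]: "(\<lambda>x::real ^ 'n::finite. x $ i) \<in> borel_measurable lebesgue"
proof -
  have "(\<lambda>x::real ^ 'n. x $ i) \<in> borel_measurable borel"
    by (intro borel_measurable_continuous_onI continuous_intros)
  then show ?thesis by (intro measurable_completion) simp
qed

lemma measurable_gidx: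
  fixes t :: "'n::finite \<Rightarrow> bool"
  shows "gidx t e \<in> lebesgue \<rightarrow>\<^sub>M count_space UNIV"
proof -
  have "gidx t e -` {a} \<inter> space lebesgue \<in> sets lebesgue" for a
  proof -
    have "gidx t e -` {a} \<inter> space lebesgue = {x \<in> space lebesgue. \<forall>i. \<lfloor>x $ i / 2 powr e + shift (t i) e\<rfloor> = a i}"
      by (auto simp: gidx_def)
    also have "\<dots> \<in> sets lebesgue" by measurable
    finally show ?thesis .
  qed
  then show ?thesis by (subst measurable_count_space_eq_countable) auto
qed

text \<open>A filtration has a coarsest generation, so generation k is the scale 2^(N - k); N is
  arbitrary and tends to infinity in the end.\<close>

lemma filtration_grid:
  fixes t :: "'n::finite \<Rightarrow> bool"
  shows "filtration (\<lambda>k. gidx t (N - int k)) lebesgue"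
proof
  fix k and x y :: "real ^ 'n"
  assume "gidx t (N - int (Suc k)) x = gidx t (N - int (Suc k)) y"
  from gidx_refine[OF this] show "gidx t (N - int k) x = gidx t (N - int k) y" by (simp add: algebra_simps)
next
  show "gidx t (N - int k) \<in> lebesgue \<rightarrow>\<^sub>M count_space UNIV" for k by (rule measurable_gidx)
  show "space lebesgue = (UNIV :: (real ^ 'n) set)" by simp
qed

abbreviation glevel :: "('n::finite \<Rightarrow> bool) \<Rightarrow> int \<Rightarrow> nat \<Rightarrow> real ^ 'n \<Rightarrow> 'n \<Rightarrow> int" where
  "glevel t N \<equiv> \<lambda>k. gidx t (N - int k)"

definition gcell :: "('n::finite \<Rightarrow> bool) \<Rightarrow> int \<Rightarrow> real ^ 'n \<Rightarrow> (real ^ 'n) set" where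
  "gcell t e x = {y. gidx t e y = gidx t e x}"

definition gcorner :: "('n::finite \<Rightarrow> bool) \<Rightarrow> int \<Rightarrow> real ^ 'n \<Rightarrow> real ^ 'n" where
  "gcorner t e x = (\<chi> i. 2 powr e * (of_int (gidx t e x i) - shift (t i) e))"

text \<open>Cells are half-open so as to form a partition, while \<open>cubes\<close> consists of
  closed cubes; the two differ by a null set.\<close>

definition gcube :: "('n::finite \<Rightarrow> bool) \<Rightarrow> int \<Rightarrow> real ^ 'n \<Rightarrow> (real ^ 'n) set" where
  "gcube t e x = cbox (gcorner t e x) (\<chi> i. gcorner t e x $ i + 2 powr e)"

lemma gcube_cubes: "gcube t e x \<in> cubes"
  unfolding gcube_def cubes_def by (intro CollectI exI[of _ "gcorner t e x"] exI[of _ "2 powr e"]) auto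

lemma gcell_self: "x \<in> gcell t e x"
  by (simp add: gcell_def)

lemma mem_gcell_iff:
  "y \<in> gcell t e x \<longleftrightarrow> (\<forall>i. gcorner t e x $ i \<le> y $ i \<and> y $ i < gcorner t e x $ i + 2 powr e)"
proof -
  have "\<lfloor>z / 2 powr e + s\<rfloor> = m \<longleftrightarrow> 2 powr e * (of_int m - s) \<le> z \<and> z < 2 powr e * (of_int m - s) + 2 powr e" for z s and m :: int
  proof -
    have "(0::real) < 2 powr e" by simp
    then have "of_int m \<le> z / 2 powr e + s \<longleftrightarrow> 2 powr e * (of_int m - s) \<le> z"
      "z / 2 powr e + s < of_int m + 1 \<longleftrightarrow> z < 2 powr e * (of_int m - s) + 2 powr e"
      by (simp_all add: field_simps)
    then show ?thesis by (simp only: floor_eq_iff)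
  qed
  then show ?thesis by (auto simp: gcell_def gidx_def gcorner_def fun_eq_iff)
qed

lemma gcell_subset_gcube: "gcell t e x \<subseteq> gcube t e x"
  by (auto simp: gcube_def mem_gcell_iff mem_box_cart less_imp_le)

lemma box_subset_gcell: "box (gcorner t e x) (\<chi> i. gcorner t e x $ i + 2 powr e) \<subseteq> gcell t e x"
  by (auto simp: mem_gcell_iff mem_box_cart less_imp_le)

lemma AE_gcube_gcell: "AE y in lebesgue. y \<in> gcube t e x \<longleftrightarrow> y \<in> gcell t e x"
proof -
  have "gcube t e x - box (gcorner t e x) (\<chi> i. gcorner t e x $ i + 2 powr e) \<in> null_sets lebesgue"
    unfolding gcube_def negligible_iff_null_sets[symmetric] by (rule negligible_frontier_interval)
  then show ?thesis
    by (rule AE_I') (use gcell_subset_gcube[of t e x] box_subset_gcell[of t e x] in auto)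
qed

lemma measure_gcube: "measure lebesgue (gcube t e x :: (real ^ 'n::finite) set) = 2 powr (real_of_int e * real CARD('n))"
proof -
  have ne: "gcube t e x \<noteq> {}" using gcell_self gcell_subset_gcube by blast
  have "measure lebesgue (gcube t e x) = measure lborel (gcube t e x)"
    unfolding gcube_def by (simp add: measure_completion)
  also have "\<dots> = (\<Prod>i\<in>(UNIV::'n set). 2 powr real_of_int e)"
    using ne unfolding gcube_def by (subst content_cbox_cart) auto
  also have "\<dots> = 2 powr (real_of_int e * real CARD('n))"
    by (simp add: powr_realpow[symmetric] powr_powr)
  finally show ?thesis .
qed

lemma gcell_mono: "e \<le> e' \<Longrightarrow> gcell t e x \<subseteq> gcell t e' x"
proof -
  assume "e \<le> e'"
  then have "gidx t e y = gidx t e x \<longrightarrow> gidx t e' y = gidx t e' x" for y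
  proof (induction e' rule: int_ge_induct)
    case (step i)
    then show ?case using gidx_refine[of t i y x] by simp
  qed simp
  then show ?thesis unfolding gcell_def by blast
qed

text \<open>After rescaling to side 1, if both grids had an endpoint in an interval of length at
  most 1/3, an integer would lie at distance less than 1/3 from the shift. But the shift is 1/3 or
  2/3.\<close>

lemma same_gcell_interval:
  assumes "a \<le> b" "b - a \<le> 2 powr e / 3"
  shows "\<exists>b'. \<lfloor>a / 2 powr e + shift b' e\<rfloor> = \<lfloor>b / 2 powr e + shift b' e\<rfloor>"
proof (rule ccontr)
  assume "\<not> ?thesis"
  then have ne: "\<lfloor>a / 2 powr e + s\<rfloor> \<noteq> \<lfloor>b / 2 powr e + s\<rfloor>" if "s \<in> {shift False e, shift True e}" for s
    using that by auto
  define u v where "u = a / 2 powr e" and "v = b / 2 powr e"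
  have uv: "u \<le> v" "v - u \<le> 1 / 3"
    using assms by (auto simp: u_def v_def divide_right_mono diff_divide_distrib[symmetric] field_simps)
  have ex: "\<exists>m::int. u + s < of_int m \<and> of_int m \<le> v + s" if "s \<in> {shift False e, shift True e}" for s
  proof -
    have "\<lfloor>u + s\<rfloor> < \<lfloor>v + s\<rfloor>"
      using ne[OF that] uv(1) floor_mono[of "u + s" "v + s"] unfolding u_def[symmetric] v_def[symmetric] by linarith
    then show ?thesis by (intro exI[of _ "\<lfloor>v + s\<rfloor>"]) (auto simp: floor_less_iff)
  qed
  obtain m :: int where m: "u < of_int m" "of_int m \<le> v" using ex[of "shift False e"] by (auto simp: shift_def)
  obtain l :: int where l: "u + shift True e < of_int l" "of_int l \<le> v + shift True e" using ex[of "shift True e"] by auto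
  have sh: "shift True e = 1 / 3 \<or> shift True e = 2 / 3" by (auto simp: shift_def)
  have "real_of_int l - real_of_int m - shift True e < 1 / 3" "- (1 / 3) < real_of_int l - real_of_int m - shift True e"
    using m l uv by linarith+
  then have "real_of_int m < real_of_int l" "real_of_int l < real_of_int (m + 1)" using sh by auto
  then have "m < l" "l < m + 1" by (simp_all only: of_int_less_iff)
  then show False by simp
qed

text \<open>The shift is chosen in each coordinate separately, which is why there are 2^n grids.
  More than two points are allowed because the origin sometimes has to lie in the same cell as x and
  y.\<close>

lemma same_gcell:
  fixes S :: "(real ^ 'n::finite) set"
  assumes "finite S" "S \<noteq> {}" and diff: "\<And>x y i. x \<in> S \<Longrightarrow> y \<in> S \<Longrightarrow> x $ i - y $ i \<le> 2 powr e / 3"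
  shows "\<exists>t. \<forall>x\<in>S. \<forall>y\<in>S. gidx t e x = gidx t e y"
proof -
  have "\<exists>b'. \<forall>x\<in>S. \<forall>y\<in>S. \<lfloor>x $ i / 2 powr e + shift b' e\<rfloor> = \<lfloor>y $ i / 2 powr e + shift b' e\<rfloor>" for i
  proof -
    define lo hi where "lo = Min ((\<lambda>x. x $ i) ` S)" and "hi = Max ((\<lambda>x. x $ i) ` S)"
    have "lo \<in> (\<lambda>x. x $ i) ` S" "hi \<in> (\<lambda>x. x $ i) ` S"
      unfolding lo_def hi_def using assms by (auto intro!: Min_in Max_in)
    then have "hi - lo \<le> 2 powr e / 3" using diff by auto
    have bnd: "lo \<le> x $ i" "x $ i \<le> hi" if "x \<in> S" for x
      using that assms by (auto simp: lo_def hi_def)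
    then have "lo \<le> hi" using assms(2) by fastforce
    then obtain b' where b': "\<lfloor>lo / 2 powr e + shift b' e\<rfloor> = \<lfloor>hi / 2 powr e + shift b' e\<rfloor>"
      using same_gcell_interval \<open>hi - lo \<le> 2 powr e / 3\<close> by blast
    have "\<lfloor>x $ i / 2 powr e + shift b' e\<rfloor> = \<lfloor>hi / 2 powr e + shift b' e\<rfloor>" if "x \<in> S" for x
    proof (rule antisym)
      show "\<lfloor>x $ i / 2 powr e + shift b' e\<rfloor> \<le> \<lfloor>hi / 2 powr e + shift b' e\<rfloor>"
        using bnd[OF that] by (intro floor_mono add_right_mono divide_right_mono) auto
      show "\<lfloor>hi / 2 powr e + shift b' e\<rfloor> \<le> \<lfloor>x $ i / 2 powr e + shift b' e\<rfloor>"
        unfolding b'[symmetric] using bnd[OF that] by (intro floor_mono add_right_mono divide_right_mono) auto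
    qed
    then show ?thesis by metis
  qed
  then have "\<forall>i. \<exists>b'. \<forall>x\<in>S. \<forall>y\<in>S. \<lfloor>x $ i / 2 powr e + shift b' e\<rfloor> = \<lfloor>y $ i / 2 powr e + shift b' e\<rfloor>"
    by blast
  from choice[OF this] obtain t where t: "\<And>i x y. x \<in> S \<Longrightarrow> y \<in> S \<Longrightarrow> \<lfloor>x $ i / 2 powr e + shift (t i) e\<rfloor> = \<lfloor>y $ i / 2 powr e + shift (t i) e\<rfloor>"
    by blast
  show ?thesis
  proof (intro exI[of _ t] ballI)
    fix x y assume "x \<in> S" "y \<in> S"
    then show "gidx t e x = gidx t e y" unfolding gidx_def using t by (intro ext) blast
  qed
qed

section \<open>From testing constants to testing of dyadic maximal functions\<close>

lemma testing_const_bound: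
  fixes \<mu> \<nu> :: "real ^ 'n::finite \<Rightarrow> ennreal"
  assumes "weight \<nu>" and T: "testing_const \<alpha> a b \<mu> \<nu> \<le> ennreal C" and C: "C > 0" and Q: "Q \<in> cubes" and ab: "a > 0" "b > 0"
  shows "(\<integral>\<^sup>+ x \<in> Q. epowr (frac_max \<alpha> (\<lambda>y. \<nu> y * indicator Q y) x) b * \<mu> x \<partial>lebesgue)
    \<le> ennreal (C powr b) * epowr (\<integral>\<^sup>+ x \<in> Q. \<nu> x \<partial>lebesgue) (b / a)"
proof -
  define V where "V = (\<integral>\<^sup>+ x \<in> Q. \<nu> x \<partial>lebesgue)"
  define I where "I = (\<integral>\<^sup>+ x \<in> Q. epowr (frac_max \<alpha> (\<lambda>y. \<nu> y * indicator Q y) x) b * \<mu> x \<partial>lebesgue)"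
  have "compact Q" using Q by (auto simp: cubes_def)
  then have "V < top" using assms(1) by (auto simp: weight_def V_def)
  have le: "epowr V (- (1 / a)) * epowr I (1 / b) \<le> ennreal C"
    using Q unfolding V_def I_def by (intro order_trans[OF _ T]) (auto simp: testing_const_def intro!: SUP_upper)
  have "I \<le> ennreal (C powr b) * epowr V (b / a)"
  proof (cases "V = 0")
    case True
    \<comment> \<open>On a cube with \<nu>(Q) = 0 the first factor is a negative power of 0, that is
      \<infinity>; a finite testing constant thus forces the integral to vanish.\<close>
    then have "top * epowr I (1 / b) \<le> ennreal C" using le ab by (simp add: epowr_def[of 0])
    then have "epowr I (1 / b) = 0" by (cases "epowr I (1 / b) = 0") (auto simp: ennreal_top_mult top_unique)
    then show ?thesis using ab by (simp add: epowr_eq_0_iff)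
  next
    case False
    then have V: "0 < V" "V < top" using \<open>V < top\<close> by (auto simp: zero_less_iff_neq_zero)
    have "epowr I (1 / b) = (epowr V (1 / a) * epowr V (- (1 / a))) * epowr I (1 / b)"
      using V by (simp add: epowr_add_pos[symmetric] epowr_0_right)
    also have "\<dots> \<le> epowr V (1 / a) * ennreal C"
      unfolding mult.assoc by (intro mult_left_mono le) simp
    finally have "epowr (epowr I (1 / b)) b \<le> epowr (epowr V (1 / a) * ennreal C) b"
      using ab by (intro epowr_mono) auto
    then show ?thesis
      using ab C by (simp add: epowr_mult epowr_epowr epowr_1_right epowr_ennreal_pos mult.commute)
  qed
  then show ?thesis by (simp add: I_def V_def)
qed

text \<open>This is \<open>\<bar>Q\<bar>\<close> to the power \<open>\<alpha> / n - 1\<close> for a cube \<open>Q\<close> of side \<open>2\<close> to the power \<open>e\<close>.\<close>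

definition gscale :: "real \<Rightarrow> 'n::finite itself \<Rightarrow> int \<Rightarrow> ennreal" where
  "gscale \<alpha> _ e = ennreal (2 powr (real_of_int e * (\<alpha> - real CARD('n))))"

lemma grid_cell: "filtration.cell (glevel t N) k = gcell t (N - int k)"
  by (rule ext) (simp add: filtration.cell_def[OF filtration_grid] gcell_def)

lemma sets_gcell [measurable]: "gcell t e x \<in> sets lebesgue"
  using filtration.cell_sets(2)[OF filtration_grid, of t e 0 x] by (simp add: grid_cell)

lemma grid_cm:
  fixes u :: "real ^ 'n::finite \<Rightarrow> ennreal"
  assumes "weight u"
  shows "filtration.cm (glevel t N) (density lebesgue u) k x = (\<integral>\<^sup>+ y\<in>gcell t (N - int k) x. u y \<partial>lebesgue)"
    "filtration.cm (glevel t N) (density lebesgue u) k x = (\<integral>\<^sup>+ y\<in>gcube t (N - int k) x. u y \<partial>lebesgue)"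
    "filtration.cm (glevel t N) (density lebesgue u) k x < top"
proof -
  show 1: "filtration.cm (glevel t N) (density lebesgue u) k x = (\<integral>\<^sup>+ y\<in>gcell t (N - int k) x. u y \<partial>lebesgue)"
    using assms by (simp add: filtration.cm_def[OF filtration_grid] grid_cell emeasure_density weight_def)
  also have "\<dots> = (\<integral>\<^sup>+ y\<in>gcube t (N - int k) x. u y \<partial>lebesgue)"
    using AE_gcube_gcell[of t "N - int k" x] by (intro nn_integral_cong_AE) (auto simp: indicator_def)
  finally show 2: "filtration.cm (glevel t N) (density lebesgue u) k x = (\<integral>\<^sup>+ y\<in>gcube t (N - int k) x. u y \<partial>lebesgue)" .
  show "filtration.cm (glevel t N) (density lebesgue u) k x < top"
    using assms unfolding 2 weight_def gcube_def by (auto simp: compact_cbox)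
qed

text \<open>For y in the cell, the smaller cells around y stay inside Q, and their closed cubes
  compete in the supremum that defines the maximal function of \<nu> restricted to Q.\<close>

lemma grid_max_testing:
  fixes \<mu> \<nu> :: "real ^ 'n::finite \<Rightarrow> ennreal"
  assumes \<nu>: "weight \<nu>" and \<mu>: "weight \<mu>" and T: "testing_const \<alpha> p q \<mu> \<nu> \<le> ennreal C" and C: "C > 0" and pq: "p > 0" "q > 0"
  shows "filtration.max_testing (glevel t N) (density lebesgue \<nu>) (density lebesgue \<mu>) (\<lambda>k. gscale \<alpha> TYPE('n) (N - int k)) L p q (C powr q)"
  unfolding filtration.max_testing_def[OF filtration_grid]
proof (intro allI impI)
  fix k x assume "k < L"
  have [measurable]: "\<mu> \<in> borel_measurable lebesgue" "\<nu> \<in> borel_measurable lebesgue"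
    using assms by (auto simp: weight_def)
  let ?\<sigma> = "density lebesgue \<nu>"
  let ?\<kappa> = "\<lambda>k. gscale \<alpha> TYPE('n) (N - int k)"
  define Q where "Q = gcube t (N - int k) x"
  have sup_le: "filtration.tail_sup (glevel t N) ?\<kappa> L ?\<sigma> k y \<le> frac_max \<alpha> (\<lambda>y. \<nu> y * indicator Q y) y" if y: "y \<in> gcell t (N - int k) x" for y
    unfolding filtration.tail_sup_def[OF filtration_grid]
  proof (rule SUP_least)
    fix l assume "l \<in> {k..<L}"
    then have "gcell t (N - int l) y \<subseteq> gcell t (N - int k) y" by (intro gcell_mono) auto
    also have "\<dots> = gcell t (N - int k) x" using y by (simp add: gcell_def)
    also have "\<dots> \<subseteq> Q" unfolding Q_def by (rule gcell_subset_gcube)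
    finally have sub: "gcell t (N - int l) y \<subseteq> Q" .
    let ?Q = "gcube t (N - int l) y"
    have \<kappa>: "?\<kappa> l = ennreal (measure lebesgue ?Q powr (\<alpha> / real CARD('n) - 1))"
    proof -
      have "real CARD('n) * (\<alpha> / real CARD('n) - 1) = \<alpha> - real CARD('n)"
        by (simp add: field_simps)
      then show ?thesis unfolding gscale_def measure_gcube powr_powr mult.assoc by simp
    qed
    have "?\<kappa> l * filtration.cm (glevel t N) ?\<sigma> l y \<le> ?\<kappa> l * (\<integral>\<^sup>+ z\<in>?Q. (\<nu> z * indicator Q z) \<partial>lebesgue)"
      unfolding grid_cm(1)[OF \<nu>] using sub gcell_subset_gcube[of t "N - int l" y]
      by (intro mult_left_mono nn_integral_mono) (auto simp: indicator_def)
    also have "?\<kappa> l * (\<integral>\<^sup>+ z\<in>?Q. (\<nu> z * indicator Q z) \<partial>lebesgue) \<le> frac_max \<alpha> (\<lambda>y. \<nu> y * indicator Q y) y"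
      unfolding frac_max_def \<kappa>
      by (intro SUP_upper) (use gcube_cubes gcell_subset_gcube gcell_self in blast)
    finally show "?\<kappa> l * filtration.cm (glevel t N) ?\<sigma> l y \<le> frac_max \<alpha> (\<lambda>y. \<nu> y * indicator Q y) y" .
  qed
  have [measurable]: "filtration.tail_sup (glevel t N) ?\<kappa> L ?\<sigma> k \<in> borel_measurable lebesgue"
    by (rule filtration.measurable_tail_sup[OF filtration_grid])
  have "(\<integral>\<^sup>+ y. epowr (filtration.tail_sup (glevel t N) ?\<kappa> L ?\<sigma> k y) q * indicator (filtration.cell (glevel t N) k x) y \<partial>density lebesgue \<mu>)
     = (\<integral>\<^sup>+ y. \<mu> y * (epowr (filtration.tail_sup (glevel t N) ?\<kappa> L ?\<sigma> k y) q * indicator (gcell t (N - int k) x) y) \<partial>lebesgue)"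
    unfolding grid_cell by (rule nn_integral_density) measurable
  also have "\<dots> \<le> (\<integral>\<^sup>+ y\<in>Q. epowr (frac_max \<alpha> (\<lambda>y. \<nu> y * indicator Q y) y) q * \<mu> y \<partial>lebesgue)"
  proof (rule nn_integral_mono)
    fix y
    show "\<mu> y * (epowr (filtration.tail_sup (glevel t N) ?\<kappa> L ?\<sigma> k y) q * indicator (gcell t (N - int k) x) y)
      \<le> epowr (frac_max \<alpha> (\<lambda>y. \<nu> y * indicator Q y) y) q * \<mu> y * indicator Q y"
    proof (cases "y \<in> gcell t (N - int k) x")
      case True
      then have "y \<in> Q" using gcell_subset_gcube unfolding Q_def by blast
      moreover have "epowr (filtration.tail_sup (glevel t N) ?\<kappa> L ?\<sigma> k y) q \<le> epowr (frac_max \<alpha> (\<lambda>y. \<nu> y * indicator Q y) y) q"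
        using pq sup_le[OF True] by (intro epowr_mono) auto
      ultimately show ?thesis using True by (simp add: mult.commute mult_left_mono)
    qed simp
  qed
  also have "\<dots> \<le> ennreal (C powr q) * epowr (\<integral>\<^sup>+ y\<in>Q. \<nu> y \<partial>lebesgue) (q / p)"
    unfolding Q_def by (intro testing_const_bound[OF \<nu> T C gcube_cubes] pq)
  finally show "(\<integral>\<^sup>+ y. epowr (filtration.tail_sup (glevel t N) ?\<kappa> L ?\<sigma> k y) q * indicator (filtration.cell (glevel t N) k x) y \<partial>density lebesgue \<mu>)
     \<le> ennreal (C powr q) * epowr (filtration.cm (glevel t N) ?\<sigma> k x) (q / p)"
    unfolding grid_cm(2)[OF \<nu>] Q_def .
qed

section \<open>Operators summed over scales and shifted grids\<close>

definition cellwise :: "(('n::finite \<Rightarrow> bool) \<Rightarrow> int \<Rightarrow> real ^ 'n \<Rightarrow> ennreal) \<Rightarrow> bool" where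
  "cellwise W \<longleftrightarrow> (\<forall>t e x y. gidx t e x = gidx t e y \<longrightarrow> W t e x = W t e y)"

text \<open>Truncated to the scales from 2^(-m) to 2^m, because the dyadic theorems concern finitely
  many generations; the kernel of interest is the supremum over m.\<close>

definition gkern :: "real \<Rightarrow> (('n::finite \<Rightarrow> bool) \<Rightarrow> int \<Rightarrow> real ^ 'n \<Rightarrow> ennreal) \<Rightarrow> nat \<Rightarrow> real ^ 'n \<Rightarrow> real ^ 'n \<Rightarrow> ennreal" where
  "gkern \<alpha> W m x y = (\<Sum>t\<in>UNIV. \<Sum>e\<in>{- int m..int m}. gscale \<alpha> TYPE('n) e * W t e x * indicator (gcell t e x) y)"

text \<open>One constant for all grids and all truncations, so that the limit in m costs
  nothing.\<close>

definition gtesting :: "real \<Rightarrow> (('n::finite \<Rightarrow> bool) \<Rightarrow> int \<Rightarrow> real ^ 'n \<Rightarrow> ennreal) \<Rightarrow>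
    (real ^ 'n \<Rightarrow> ennreal) \<Rightarrow> (real ^ 'n \<Rightarrow> ennreal) \<Rightarrow> real \<Rightarrow> real \<Rightarrow> real \<Rightarrow> bool" where
  "gtesting \<alpha> W \<nu> \<mu> p q C \<longleftrightarrow> (\<forall>t N L. filtration.testing (glevel t N) (density lebesgue \<nu>) (density lebesgue \<mu>)
      (\<lambda>k x. gscale \<alpha> TYPE('n) (N - int k) * W t (N - int k) x) L p q C)"

lemma (in filtration) testing_mono:
  assumes "testing \<sigma> \<mu> lam L p q C" "C \<le> C'" shows "testing \<sigma> \<mu> lam L p q C'"
  unfolding testing_def
proof (intro allI impI)
  fix R :: "nat \<Rightarrow> 'a \<Rightarrow> bool" assume "\<forall>k. adapted k (R k)"
  then have "(\<integral>\<^sup>+ x. epowr (\<Sum>k<L. lam k x * cm \<sigma> k x * of_bool (R k x)) q \<partial>\<mu>)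
       \<le> ennreal C * epowr (emeasure \<sigma> {x. \<exists>k<L. R k x}) (q / p)"
    using assms(1) unfolding testing_def by blast
  also have "\<dots> \<le> ennreal C' * epowr (emeasure \<sigma> {x. \<exists>k<L. R k x}) (q / p)"
    using assms(2) by (intro mult_right_mono ennreal_leI) auto
  finally show "(\<integral>\<^sup>+ x. epowr (\<Sum>k<L. lam k x * cm \<sigma> k x * of_bool (R k x)) q \<partial>\<mu>)
       \<le> ennreal C' * epowr (emeasure \<sigma> {x. \<exists>k<L. R k x}) (q / p)" .
qed

lemma adapted_glevel:
  assumes "\<And>x y. gidx t (N - int k) x = gidx t (N - int k) y \<Longrightarrow> \<phi> x = \<phi> y"
  shows "filtration.adapted (glevel t N) k \<phi>"
  unfolding filtration.adapted_def[OF filtration_grid] using assms by blast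

lemma cellwise_measurable:
  assumes "\<And>x y. gidx t e x = gidx t e y \<Longrightarrow> \<phi> x = \<phi> y"
  shows "\<phi> \<in> borel_measurable lebesgue"
proof (rule filtration.adapted_measurable[OF filtration_grid[of t e] adapted_glevel[of t e 0]])
  fix x y assume "gidx t (e - int 0) x = gidx t (e - int 0) y"
  then show "\<phi> x = \<phi> y" by (intro assms) simp
qed simp

lemma cellwiseD: "cellwise W \<Longrightarrow> gidx t e x = gidx t e y \<Longrightarrow> W t e x = W t e y"
  unfolding cellwise_def by blast

lemma gcell_eq: "gidx t e x = gidx t e y \<Longrightarrow> gcell t e x = gcell t e y"
  by (simp add: gcell_def)

lemma gkern_mono: "m \<le> m' \<Longrightarrow> gkern \<alpha> W m x y \<le> gkern \<alpha> W m' x y"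
  unfolding gkern_def by (intro sum_mono sum_mono2) auto

lemma measurable_gkern [measurable]: "gkern \<alpha> W m x \<in> borel_measurable lebesgue"
  unfolding gkern_def by measurable

definition gsum :: "real \<Rightarrow> (('n::finite \<Rightarrow> bool) \<Rightarrow> int \<Rightarrow> real ^ 'n \<Rightarrow> ennreal) \<Rightarrow> nat \<Rightarrow> (real ^ 'n \<Rightarrow> ennreal) \<Rightarrow> real ^ 'n \<Rightarrow> ennreal" where
  "gsum \<alpha> W m h x = (\<Sum>t\<in>UNIV. \<Sum>e\<in>{- int m..int m}. gscale \<alpha> TYPE('n) e * W t e x * (\<integral>\<^sup>+ y\<in>gcell t e x. h y \<partial>lebesgue))"

lemma measurable_gsum_summand:
  fixes h :: "real ^ 'n::finite \<Rightarrow> ennreal"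
  assumes W: "cellwise W"
  shows "(\<lambda>x. gscale \<alpha> TYPE('n) e * W t e x * (\<integral>\<^sup>+ y\<in>gcell t e x. h y \<partial>lebesgue)) \<in> borel_measurable lebesgue"
proof (rule cellwise_measurable[of t e])
  fix x y assume "gidx t e x = gidx t e y"
  then show "gscale \<alpha> TYPE('n) e * W t e x * (\<integral>\<^sup>+ y\<in>gcell t e x. h y \<partial>lebesgue)
    = gscale \<alpha> TYPE('n) e * W t e y * (\<integral>\<^sup>+ y\<in>gcell t e y. h y \<partial>lebesgue)"
    using cellwiseD[OF W, of t e x y] gcell_eq[of t e x y] by simp
qed

theorem grid_single_bound:
  fixes \<mu> \<nu> f :: "real ^ 'n::finite \<Rightarrow> ennreal"
  assumes \<nu>: "weight \<nu>" and \<mu>: "weight \<mu>" and p: "dual_exp p p'" and q: "dual_exp q q'" and pq: "p \<le> q"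
    and W: "cellwise W" and T: "gtesting \<alpha> W \<nu> \<mu> p q C" and T': "gtesting \<alpha> W \<mu> \<nu> q' p' C" and C: "C \<ge> 0"
    and f [measurable]: "f \<in> borel_measurable lebesgue"
  shows "(\<integral>\<^sup>+ x. epowr (\<Sum>e\<in>{- int m..int m}. gscale \<alpha> TYPE('n) e * W t e x * (\<integral>\<^sup>+ y\<in>gcell t e x. f y * \<nu> y \<partial>lebesgue)) q * \<mu> x \<partial>lebesgue)
    \<le> ennreal (bilC p q p' q' C powr q) * epowr (\<integral>\<^sup>+ x. epowr (f x) p * \<nu> x \<partial>lebesgue) (q / p)"
proof -
  have [measurable]: "\<mu> \<in> borel_measurable lebesgue" "\<nu> \<in> borel_measurable lebesgue"
    using assms by (auto simp: weight_def)
  \<comment> \<open>The generations 0 to 2 m are the scales m down to - m.\<close>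
  let ?N = "int m" and ?L = "2 * m + 1"
  let ?\<sigma> = "density lebesgue \<nu>"
  let ?lam = "\<lambda>k x. gscale \<alpha> TYPE('n) (?N - int k) * W t (?N - int k) x"
  let ?F = "\<lambda>e x. gscale \<alpha> TYPE('n) e * W t e x * (\<integral>\<^sup>+ y\<in>gcell t e x. f y * \<nu> y \<partial>lebesgue)"
  have bij: "bij_betw (\<lambda>k. ?N - int k) {..<?L} {- int m..int m}"
    by (rule bij_betw_byWitness[where f' = "\<lambda>e. nat (?N - e)"]) auto
  have int_eq: "(\<integral>\<^sup>+ y. f y * indicator (filtration.cell (glevel t ?N) k x) y \<partial>?\<sigma>) = (\<integral>\<^sup>+ y\<in>gcell t (?N - int k) x. f y * \<nu> y \<partial>lebesgue)" for k x
    unfolding grid_cell by (subst nn_integral_density) (auto simp: mult_ac)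
  have F_eq: "(\<Sum>k<?L. ?lam k x * (\<integral>\<^sup>+ y. f y * indicator (filtration.cell (glevel t ?N) k x) y \<partial>?\<sigma>)) = (\<Sum>e\<in>{- int m..int m}. ?F e x)" for x
    unfolding int_eq by (rule sum.reindex_bij_betw[OF bij, of "\<lambda>e. ?F e x"])
  have [measurable]: "?F e \<in> borel_measurable lebesgue" for e
    by (rule measurable_gsum_summand[OF W])
  have "(\<integral>\<^sup>+ x. epowr (\<Sum>e\<in>{- int m..int m}. ?F e x) q * \<mu> x \<partial>lebesgue)
     = (\<integral>\<^sup>+ x. \<mu> x * epowr (\<Sum>e\<in>{- int m..int m}. ?F e x) q \<partial>lebesgue)"
    by (rule nn_integral_cong) (rule mult.commute)
  also have "\<dots> = (\<integral>\<^sup>+ x. epowr (\<Sum>k<?L. ?lam k x * (\<integral>\<^sup>+ y. f y * indicator (filtration.cell (glevel t ?N) k x) y \<partial>?\<sigma>)) q \<partial>density lebesgue \<mu>)"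
    unfolding F_eq by (rule nn_integral_density[symmetric]) measurable
  also have "\<dots> \<le> ennreal (bilC p q p' q' C powr q) * epowr (\<integral>\<^sup>+ x. epowr (f x) p \<partial>?\<sigma>) (q / p)"
  proof (rule filtration.dyadic_norm[OF filtration_grid _ _ _ _ p q pq _ _ _ _ C])
    show "filtration.testing (glevel t ?N) ?\<sigma> (density lebesgue \<mu>) ?lam ?L p q C"
      using T unfolding gtesting_def by blast
    show "filtration.testing (glevel t ?N) (density lebesgue \<mu>) ?\<sigma> ?lam ?L q' p' C"
      using T' unfolding gtesting_def by blast
    show "filtration.adapted (glevel t ?N) k (?lam k)" for k
    proof (rule adapted_glevel)
      fix x y assume "gidx t (?N - int k) x = gidx t (?N - int k) y"
      then show "?lam k x = ?lam k y" using cellwiseD[OF W, of t "?N - int k" x y] by simp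
    qed
  qed (use grid_cm(3)[OF \<nu>] grid_cm(3)[OF \<mu>] in auto)
  also have "(\<integral>\<^sup>+ x. epowr (f x) p \<partial>?\<sigma>) = (\<integral>\<^sup>+ x. epowr (f x) p * \<nu> x \<partial>lebesgue)"
    by (subst nn_integral_density) (auto simp: mult.commute)
  finally show ?thesis .
qed

lemma measurable_gsum: "cellwise W \<Longrightarrow> gsum \<alpha> W m h \<in> borel_measurable lebesgue"
  unfolding gsum_def by (intro borel_measurable_sum measurable_gsum_summand)

lemma nn_integral_gkern:
  fixes h :: "real ^ 'n::finite \<Rightarrow> ennreal"
  assumes [measurable]: "h \<in> borel_measurable lebesgue"
  shows "(\<integral>\<^sup>+ y. (SUP m. gkern \<alpha> W m x y) * h y \<partial>lebesgue) = (SUP m. gsum \<alpha> W m h x)"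
proof -
  have S_eq: "(\<integral>\<^sup>+ y. gkern \<alpha> W m x y * h y \<partial>lebesgue) = gsum \<alpha> W m h x" for m
  proof -
    have "(\<integral>\<^sup>+ y. gkern \<alpha> W m x y * h y \<partial>lebesgue)
      = (\<integral>\<^sup>+ y. (\<Sum>t\<in>UNIV. \<Sum>e\<in>{- int m..int m}. (gscale \<alpha> TYPE('n) e * W t e x) * (h y * indicator (gcell t e x) y)) \<partial>lebesgue)"
      unfolding gkern_def sum_distrib_right by (simp only: mult_ac)
    also have "\<dots> = (\<Sum>t\<in>UNIV. \<Sum>e\<in>{- int m..int m}. \<integral>\<^sup>+ y. (gscale \<alpha> TYPE('n) e * W t e x) * (h y * indicator (gcell t e x) y) \<partial>lebesgue)"
      by (simp add: nn_integral_sum)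
    also have "\<dots> = gsum \<alpha> W m h x"
      unfolding gsum_def by (intro sum.cong refl nn_integral_cmult) measurable
    finally show ?thesis .
  qed
  have "(\<integral>\<^sup>+ y. (SUP m. gkern \<alpha> W m x y) * h y \<partial>lebesgue) = (\<integral>\<^sup>+ y. (SUP m. gkern \<alpha> W m x y * h y) \<partial>lebesgue)"
    by (simp only: SUP_mult_right_ennreal)
  also have "\<dots> = (SUP m. \<integral>\<^sup>+ y. gkern \<alpha> W m x y * h y \<partial>lebesgue)"
    by (rule nn_integral_monotone_convergence_SUP) (auto intro!: incseq_SucI le_funI mult_right_mono gkern_mono)
  finally show ?thesis unfolding S_eq .
qed

lemma measurable_nn_integral_gkern:
  fixes h :: "real ^ 'n::finite \<Rightarrow> ennreal"
  assumes "cellwise W" and [measurable]: "h \<in> borel_measurable lebesgue"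
  shows "(\<lambda>x. \<integral>\<^sup>+ y. (SUP m. gkern \<alpha> W m x y) * h y \<partial>lebesgue) \<in> borel_measurable lebesgue"
proof -
  note [measurable] = measurable_gsum[OF assms(1)]
  show ?thesis unfolding nn_integral_gkern[OF assms(2)] by measurable
qed

text \<open>The q-th power of a sum over the 2^n grids costs 2^(n q), and adding up the bounds for
  the grids another 2^n; the limit in m is monotone convergence.\<close>

theorem grid_op_bound:
  fixes \<mu> \<nu> f :: "real ^ 'n::finite \<Rightarrow> ennreal"
  assumes \<nu>: "weight \<nu>" and \<mu>: "weight \<mu>" and p: "dual_exp p p'" and q: "dual_exp q q'" and pq: "p \<le> q"
    and W: "cellwise W" and T: "gtesting \<alpha> W \<nu> \<mu> p q C" and T': "gtesting \<alpha> W \<mu> \<nu> q' p' C" and C: "C \<ge> 0"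
    and f [measurable]: "f \<in> borel_measurable lebesgue"
  shows "(\<integral>\<^sup>+ x. epowr (\<integral>\<^sup>+ y. (SUP m. gkern \<alpha> W m x y) * (f y * \<nu> y) \<partial>lebesgue) q * \<mu> x \<partial>lebesgue)
    \<le> ennreal (real CARD('n \<Rightarrow> bool) powr q * (real CARD('n \<Rightarrow> bool) * bilC p q p' q' C powr q)) *
      epowr (\<integral>\<^sup>+ x. epowr (f x) p * \<nu> x \<partial>lebesgue) (q / p)"
proof -
  have [measurable]: "\<mu> \<in> borel_measurable lebesgue" "\<nu> \<in> borel_measurable lebesgue"
    using assms by (auto simp: weight_def)
  have q0: "q > 0" using dual_expD[OF q] by simp
  let ?X = "epowr (\<integral>\<^sup>+ x. epowr (f x) p * \<nu> x \<partial>lebesgue) (q / p)"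
  let ?n = "real CARD('n \<Rightarrow> bool)"
  define F where "F t e x = gscale \<alpha> TYPE('n) e * W t e x * (\<integral>\<^sup>+ y\<in>gcell t e x. f y * \<nu> y \<partial>lebesgue)" for t e x
  have [measurable]: "F t e \<in> borel_measurable lebesgue" for t e
    unfolding F_def by (rule measurable_gsum_summand[OF W])
  define S where "S m x = (\<Sum>t\<in>UNIV. \<Sum>e\<in>{- int m..int m}. F t e x)" for m x
  have [measurable]: "S m \<in> borel_measurable lebesgue" for m unfolding S_def by measurable
  have S_eq: "gsum \<alpha> W m (\<lambda>y. f y * \<nu> y) x = S m x" for m x
    unfolding gsum_def S_def F_def ..
  have SUP_eq: "(\<integral>\<^sup>+ y. (SUP m. gkern \<alpha> W m x y) * (f y * \<nu> y) \<partial>lebesgue) = (SUP m. S m x)" for x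
    using nn_integral_gkern[of "\<lambda>y. f y * \<nu> y" \<alpha> W x] unfolding S_eq by simp
  have S_mono: "S m x \<le> S (Suc m) x" for m x
    unfolding S_def by (intro sum_mono sum_mono2) auto
  have single: "(\<integral>\<^sup>+ x. epowr (S m x) q * \<mu> x \<partial>lebesgue) \<le> ennreal (?n powr q * (?n * bilC p q p' q' C powr q)) * ?X" for m
  proof -
    have "(\<integral>\<^sup>+ x. epowr (S m x) q * \<mu> x \<partial>lebesgue)
      \<le> (\<integral>\<^sup>+ x. ennreal (?n powr q) * (\<Sum>t\<in>UNIV. epowr (\<Sum>e\<in>{- int m..int m}. F t e x) q * \<mu> x) \<partial>lebesgue)"
    proof (rule nn_integral_mono)
      fix x
      have "epowr (S m x) q * \<mu> x \<le> (ennreal (?n powr q) * (\<Sum>t\<in>UNIV. epowr (\<Sum>e\<in>{- int m..int m}. F t e x) q)) * \<mu> x"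
        unfolding S_def by (intro mult_right_mono epowr_sum_le q0) auto
      then show "epowr (S m x) q * \<mu> x \<le> ennreal (?n powr q) * (\<Sum>t\<in>UNIV. epowr (\<Sum>e\<in>{- int m..int m}. F t e x) q * \<mu> x)"
        by (simp only: sum_distrib_right mult.assoc)
    qed
    also have "\<dots> = ennreal (?n powr q) * (\<Sum>t\<in>UNIV. \<integral>\<^sup>+ x. epowr (\<Sum>e\<in>{- int m..int m}. F t e x) q * \<mu> x \<partial>lebesgue)"
      by (simp add: nn_integral_cmult nn_integral_sum)
    also have "\<dots> \<le> ennreal (?n powr q) * (\<Sum>t\<in>(UNIV :: ('n \<Rightarrow> bool) set). ennreal (bilC p q p' q' C powr q) * ?X)"
      unfolding F_def by (intro mult_left_mono sum_mono grid_single_bound[OF \<nu> \<mu> p q pq W T T' C f]) auto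
    also have "\<dots> = ennreal (?n powr q * (?n * bilC p q p' q' C powr q)) * ?X"
      by (simp add: ennreal_mult mult.assoc ennreal_of_nat_eq_real_of_nat[symmetric])
    finally show ?thesis .
  qed
  have "(\<integral>\<^sup>+ x. epowr (SUP m. S m x) q * \<mu> x \<partial>lebesgue) = (\<integral>\<^sup>+ x. (SUP m. epowr (S m x) q * \<mu> x) \<partial>lebesgue)"
    by (simp only: epowr_SUP[OF q0] SUP_mult_right_ennreal)
  also have "\<dots> = (SUP m. \<integral>\<^sup>+ x. epowr (S m x) q * \<mu> x \<partial>lebesgue)"
    using q0 by (intro nn_integral_monotone_convergence_SUP)
      (auto intro!: incseq_SucI le_funI mult_right_mono epowr_mono S_mono)
  also have "\<dots> \<le> ennreal (?n powr q * (?n * bilC p q p' q' C powr q)) * ?X"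
    by (rule SUP_least) (rule single)
  finally show ?thesis unfolding SUP_eq .
qed

text \<open>The coefficient grows by the factor 2^(n - \<alpha>) > 1 from one generation to the
  next, so the finest generation dominates. This is the growth condition of
  \<open>testing_geometric\<close>.\<close>

lemma gscale_geometric:
  fixes N :: int
  assumes \<alpha>: "\<alpha> < real CARD('n::finite)" and K: "finite K" "K \<noteq> {}"
  shows "(\<Sum>k\<in>K. gscale \<alpha> TYPE('n) (N - int k)) \<le> ennreal (geoC (real CARD('n) - \<alpha>)) * gscale \<alpha> TYPE('n) (N - int (Max K))"
proof -
  define \<gamma> where "\<gamma> = real CARD('n) - \<alpha>"
  have \<gamma>: "\<gamma> > 0" using \<alpha> by (simp add: \<gamma>_def)
  have g: "gscale \<alpha> TYPE('n) (N - int k) = pow2 (real_of_int (int k - N) * \<gamma>)" for k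
    unfolding gscale_def pow2_def \<gamma>_def by (simp add: algebra_simps)
  have "(\<Sum>k\<in>K. gscale \<alpha> TYPE('n) (N - int k)) = (\<Sum>i\<in>(\<lambda>k. int k - N) ` K. pow2 (real_of_int i * \<gamma>))"
    unfolding g by (subst sum.reindex) (auto simp: inj_on_def)
  also have "\<dots> \<le> isum (\<lambda>i. pow2 (real_of_int i * \<gamma>) * of_bool (pow2 i \<le> pow2 (int (Max K) - N)))"
    using K by (intro sum_le_isum) (auto simp: pow2_le_iff)
  also have "\<dots> \<le> ennreal (geoC \<gamma>) * epowr (pow2 (int (Max K) - N)) \<gamma>"
    by (rule isum_pow2_le[OF \<gamma>])
  also have "epowr (pow2 (int (Max K) - N)) \<gamma> = gscale \<alpha> TYPE('n) (N - int (Max K))"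
    unfolding epowr_pow2 g by simp
  finally show ?thesis unfolding \<gamma>_def .
qed

section \<open>Coefficients for cells at the origin and away from it\<close>

definition W0 :: "('n::finite \<Rightarrow> bool) \<Rightarrow> int \<Rightarrow> real ^ 'n \<Rightarrow> ennreal" where
  "W0 t e x = of_bool (gidx t e x = gidx t e 0)"

definition cell_dist :: "('n::finite \<Rightarrow> bool) \<Rightarrow> int \<Rightarrow> real ^ 'n \<Rightarrow> real" where
  "cell_dist t e x = Inf (norm ` gcell t e x)"

text \<open>On a cell with side comparable to |x - y| and distance to the origin comparable to max
  |x| |y|, this is the ratio between the kernel with exponents -\<delta> and \<delta> - n and the
  power - n of |x - y|, up to constants.\<close>

definition Wfar :: "real \<Rightarrow> ('n::finite \<Rightarrow> bool) \<Rightarrow> int \<Rightarrow> real ^ 'n \<Rightarrow> ennreal" where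
  "Wfar \<delta> t e x = ennreal ((2 powr e / cell_dist t e x) powr \<delta>) * of_bool (2 powr e \<le> cell_dist t e x)"

lemma cellwise_1: "cellwise (\<lambda>t e x. 1)"
  by (simp add: cellwise_def)

lemma cellwise_W0: "cellwise W0"
  unfolding cellwise_def W0_def by simp

lemma cellwise_Wfar: "cellwise (Wfar \<delta>)"
  unfolding cellwise_def
proof (intro allI impI)
  fix t e and x y :: "real ^ 'a" assume "gidx t e x = gidx t e y"
  then show "Wfar \<delta> t e x = Wfar \<delta> t e y"
    using gcell_eq[of t e x y] by (simp add: Wfar_def cell_dist_def)
qed

lemma cell_dist_le: "z \<in> gcell t e x \<Longrightarrow> cell_dist t e x \<le> norm z"
  unfolding cell_dist_def by (intro cInf_lower bdd_belowI[of _ 0]) auto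

lemma gcell_diam:
  fixes x :: "real ^ 'n::finite"
  assumes "z \<in> gcell t e x" shows "norm (z - x) \<le> real CARD('n) * 2 powr e"
proof -
  have "norm (z - x) \<le> (\<Sum>i\<in>UNIV. \<bar>(z - x) $ i\<bar>)" by (rule norm_le_l1_cart)
  also have "\<dots> \<le> (\<Sum>i\<in>(UNIV :: 'n set). 2 powr e)"
  proof (rule sum_mono)
    fix i
    show "\<bar>(z - x) $ i\<bar> \<le> 2 powr e"
      using assms gcell_self[of x t e] unfolding mem_gcell_iff[of _ t e x] by (simp add: abs_le_iff) (smt (verit))
  qed
  finally show ?thesis by simp
qed

lemma norm_le_cell_dist:
  fixes x :: "real ^ 'n::finite"
  shows "norm x \<le> cell_dist t e x + real CARD('n) * 2 powr e"
proof -
  have "norm x - real CARD('n) * 2 powr e \<le> cell_dist t e x"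
    unfolding cell_dist_def
  proof (rule cInf_greatest)
    show "norm ` gcell t e x \<noteq> {}" using gcell_self by blast
    fix r assume "r \<in> norm ` gcell t e x"
    then obtain z where "z \<in> gcell t e x" "r = norm z" by blast
    then show "norm x - real CARD('n) * 2 powr e \<le> r"
      using gcell_diam[of z t e x] norm_triangle_ineq2[of x z] by (simp add: norm_minus_commute)
  qed
  then show ?thesis by simp
qed

text \<open>If the side is at most the distance of the cell from the origin, that distance lies
  between |x| / (n + 1) and |x|. The coefficients are then at most ((n + 1) 2^e / |x|)^\<delta> with
  2^e \<le> |x|, a geometric series. At x = 0 all of them vanish.\<close>

lemma Wfar_summable:
  fixes x :: "real ^ 'n::finite"
  assumes \<delta>: "\<delta> > 0"
  shows "(\<Sum>k<L. Wfar \<delta> t (N - int k) x) \<le> ennreal ((real CARD('n) + 1) powr \<delta> * geoC \<delta>)"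
proof (cases "x = 0")
  case True
  have "Wfar \<delta> t e x = 0" for e
  proof -
    have "cell_dist t e x \<le> 0" using cell_dist_le[OF gcell_self, of t e x] True by simp
    then have "\<not> 2 powr e \<le> cell_dist t e x" by (simp add: not_le order_le_less_trans)
    then show ?thesis by (simp add: Wfar_def)
  qed
  then show ?thesis by simp
next
  case False
  define r where "r = norm x"
  define n where "n = real CARD('n) + 1"
  have r: "r > 0" "n > 0" using False by (auto simp: r_def n_def)
  have le: "Wfar \<delta> t e x \<le> ennreal ((n / r) powr \<delta>) * (pow2 (real_of_int e * \<delta>) * of_bool (pow2 e \<le> ennreal r))" for e
  proof (cases "2 powr e \<le> cell_dist t e x")
    case True
    have d: "r \<le> n * cell_dist t e x"
    proof -
      have "real CARD('n) * 2 powr e \<le> real CARD('n) * cell_dist t e x" using True by (intro mult_left_mono) auto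
      then show ?thesis using norm_le_cell_dist[of x t e] unfolding r_def n_def distrib_right mult_1 by linarith
    qed
    have pos: "cell_dist t e x > 0" using True by (rule less_le_trans[rotated]) simp
    have "2 powr e \<le> r" using True cell_dist_le[OF gcell_self, of t e x] by (simp add: r_def)
    moreover have "(2 powr e / cell_dist t e x) powr \<delta> \<le> (n / r * 2 powr e) powr \<delta>"
      using d r pos \<delta> by (intro powr_mono2) (auto simp: field_simps)
    moreover have "(n / r * 2 powr e) powr \<delta> = (n / r) powr \<delta> * 2 powr (e * \<delta>)"
      using r by (subst powr_mult) (auto simp: powr_powr)
    ultimately show ?thesis using True
      by (simp add: Wfar_def pow2_def ennreal_mult[symmetric] ennreal_leI)
  qed (simp add: Wfar_def)
  have "(\<Sum>k<L. Wfar \<delta> t (N - int k) x) = (\<Sum>e\<in>(\<lambda>k. N - int k) ` {..<L}. Wfar \<delta> t e x)"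
    by (subst sum.reindex) (auto simp: inj_on_def)
  also have "\<dots> \<le> isum (\<lambda>e. ennreal ((n / r) powr \<delta>) * (pow2 (real_of_int e * \<delta>) * of_bool (pow2 e \<le> ennreal r)))"
    by (intro sum_le_isum le) simp
  also have "\<dots> = ennreal ((n / r) powr \<delta>) * isum (\<lambda>e. pow2 (real_of_int e * \<delta>) * of_bool (pow2 e \<le> ennreal r))"
    by (rule nn_integral_cmult) simp
  also have "\<dots> \<le> ennreal ((n / r) powr \<delta>) * (ennreal (geoC \<delta>) * epowr (ennreal r) \<delta>)"
    by (intro mult_left_mono isum_pow2_le \<delta>) simp
  also have "\<dots> = ennreal (n powr \<delta> * geoC \<delta>)"
  proof -
    have "(n / r) powr \<delta> * (geoC \<delta> * r powr \<delta>) = n powr \<delta> * geoC \<delta>"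
      using r by (simp add: powr_divide)
    moreover have "ennreal ((n / r) powr \<delta>) * (ennreal (geoC \<delta>) * ennreal (r powr \<delta>)) = ennreal ((n / r) powr \<delta> * (geoC \<delta> * r powr \<delta>))"
      using geoC_pos[OF \<delta>] by (simp add: ennreal_mult)
    ultimately show ?thesis unfolding epowr_ennreal_pos[OF r(1)] by (simp only:)
  qed
  finally show ?thesis unfolding n_def .
qed

lemma gtesting_mono: "gtesting \<alpha> W \<nu> \<mu> p q C \<Longrightarrow> C \<le> C' \<Longrightarrow> gtesting \<alpha> W \<nu> \<mu> p q C'"
  unfolding gtesting_def using filtration.testing_mono[OF filtration_grid] by blast

lemma levC_nonneg: "q > 0 \<Longrightarrow> \<eta> > 0 \<Longrightarrow> G > 0 \<Longrightarrow> C > 0 \<Longrightarrow> 0 \<le> levC q \<eta> G C"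
  unfolding levC_def using geoC_pos[of "\<eta> / 2"] by (intro mult_nonneg_nonneg) auto

lemma gtesting_one:
  fixes \<mu> \<nu> :: "real ^ 'n::finite \<Rightarrow> ennreal"
  assumes \<nu>: "weight \<nu>" and \<mu>: "weight \<mu>" and T: "testing_const \<alpha> p q \<mu> \<nu> \<le> ennreal C" and C: "C > 0"
    and p: "1 < p" "p < q" and \<alpha>: "\<alpha> < real CARD('n)"
  shows "gtesting \<alpha> (\<lambda>t e x. 1) \<nu> \<mu> p q (levC q (q / p - 1 + 0) (geoC (real CARD('n) - \<alpha>)) (C powr q))"
  unfolding gtesting_def
proof (intro allI)
  fix t :: "'n \<Rightarrow> bool" and N L
  have "filtration.testing (glevel t N) (density lebesgue \<nu>) (density lebesgue \<mu>)
     (\<lambda>k x. gscale \<alpha> TYPE('n) (N - int k) * of_bool True) L p q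
     (levC q (q / p - 1 + 0) (geoC (real CARD('n) - \<alpha>)) (C powr q))"
  proof (rule filtration.testing_geometric[OF filtration_grid, where Z = "\<lambda>k x. True"])
    show "filtration.max_testing (glevel t N) (density lebesgue \<nu>) (density lebesgue \<mu>) (\<lambda>k. gscale \<alpha> TYPE('n) (N - int k)) L p q (C powr q)"
      using p by (intro grid_max_testing \<nu> \<mu> T C) auto
    show "filtration.adapted (glevel t N) k (\<lambda>x. True)" for k by (rule adapted_glevel) simp
    show "(\<Sum>k\<in>K. gscale \<alpha> TYPE('n) (N - int k)) \<le> ennreal (geoC (real CARD('n) - \<alpha>)) * gscale \<alpha> TYPE('n) (N - int (Max K))"
      if "finite K" "K \<noteq> {}" for K using \<alpha> that by (rule gscale_geometric)
  qed (use p C \<alpha> geoC_pos[of "real CARD('n) - \<alpha>"] in \<open>simp_all add: grid_cm(3)[OF \<nu>]\<close>)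
  then show "filtration.testing (glevel t N) (density lebesgue \<nu>) (density lebesgue \<mu>)
     (\<lambda>k x. gscale \<alpha> TYPE('n) (N - int k) * 1) L p q
     (levC q (q / p - 1 + 0) (geoC (real CARD('n) - \<alpha>)) (C powr q))" by simp
qed

text \<open>The case \<epsilon> = 1: the cells containing the origin are nested, and the exponent
  q/p is positive even for p = q.\<close>

lemma gtesting_W0:
  fixes \<mu> \<nu> :: "real ^ 'n::finite \<Rightarrow> ennreal"
  assumes \<nu>: "weight \<nu>" and \<mu>: "weight \<mu>" and T: "testing_const \<alpha> p q \<mu> \<nu> \<le> ennreal C" and C: "C > 0"
    and p: "1 < p" "p \<le> q" and \<alpha>: "\<alpha> < real CARD('n)"
  shows "gtesting \<alpha> W0 \<nu> \<mu> p q (levC q (q / p - 1 + 1) (geoC (real CARD('n) - \<alpha>)) (C powr q))"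
  unfolding gtesting_def W0_def
proof (intro allI)
  fix t :: "'n \<Rightarrow> bool" and N L
  show "filtration.testing (glevel t N) (density lebesgue \<nu>) (density lebesgue \<mu>)
     (\<lambda>k x. gscale \<alpha> TYPE('n) (N - int k) * of_bool (gidx t (N - int k) x = gidx t (N - int k) 0)) L p q
     (levC q (q / p - 1 + 1) (geoC (real CARD('n) - \<alpha>)) (C powr q))"
  proof (rule filtration.testing_geometric[OF filtration_grid])
    show "filtration.max_testing (glevel t N) (density lebesgue \<nu>) (density lebesgue \<mu>) (\<lambda>k. gscale \<alpha> TYPE('n) (N - int k)) L p q (C powr q)"
      using p by (intro grid_max_testing \<nu> \<mu> T C) auto
    show "filtration.adapted (glevel t N) k (\<lambda>x. gidx t (N - int k) x = gidx t (N - int k) 0)" for k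
      by (rule adapted_glevel) simp
    show "(\<Sum>k\<in>K. gscale \<alpha> TYPE('n) (N - int k)) \<le> ennreal (geoC (real CARD('n) - \<alpha>)) * gscale \<alpha> TYPE('n) (N - int (Max K))"
      if "finite K" "K \<noteq> {}" for K using \<alpha> that by (rule gscale_geometric)
    have "gidx t (N - int k) x = gidx t (N - int k) y"
      if "gidx t (N - int k) x = gidx t (N - int k) 0" "gidx t (N - int l) y = gidx t (N - int l) 0" "k \<le> l" for k l x y
    proof -
      have "gidx t (N - int k) y = gidx t (N - int k) 0"
        by (rule filtration.refine_le[OF filtration_grid that(3,2)])
      then show ?thesis using that(1) by simp
    qed
    then show "(1 = 0 \<and> p < q) \<or> ((1::real) = 1 \<and> (\<forall>k l x y. gidx t (N - int k) x = gidx t (N - int k) 0 \<longrightarrow>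
         gidx t (N - int l) y = gidx t (N - int l) 0 \<longrightarrow> k \<le> l \<longrightarrow> gidx t (N - int k) x = gidx t (N - int k) y))"
      by blast
  qed (use p C \<alpha> geoC_pos[of "real CARD('n) - \<alpha>"] in \<open>simp_all add: grid_cm(3)[OF \<nu>]\<close>)
qed

lemma gtesting_Wfar:
  fixes \<mu> \<nu> :: "real ^ 'n::finite \<Rightarrow> ennreal"
  assumes \<nu>: "weight \<nu>" and \<mu>: "weight \<mu>" and T: "testing_const \<alpha> p q \<mu> \<nu> \<le> ennreal C" and C: "C > 0"
    and p: "1 < p" "p \<le> q" and \<delta>: "\<delta> > 0"
  shows "gtesting \<alpha> (Wfar \<delta>) \<nu> \<mu> p q (((real CARD('n) + 1) powr \<delta> * geoC \<delta>) powr q * (C powr q))"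
  unfolding gtesting_def
proof (intro allI)
  fix t :: "'n \<Rightarrow> bool" and N L
  show "filtration.testing (glevel t N) (density lebesgue \<nu>) (density lebesgue \<mu>)
     (\<lambda>k x. gscale \<alpha> TYPE('n) (N - int k) * Wfar \<delta> t (N - int k) x) L p q
     (((real CARD('n) + 1) powr \<delta> * geoC \<delta>) powr q * (C powr q))"
  proof (rule filtration.testing_summable[OF filtration_grid])
    show "filtration.max_testing (glevel t N) (density lebesgue \<nu>) (density lebesgue \<mu>) (\<lambda>k. gscale \<alpha> TYPE('n) (N - int k)) L p q (C powr q)"
      using p by (intro grid_max_testing \<nu> \<mu> T C) auto
    show "filtration.adapted (glevel t N) k (Wfar \<delta> t (N - int k))" for k
      by (rule adapted_glevel) (rule cellwiseD[OF cellwise_Wfar])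
    show "(\<Sum>k<L. Wfar \<delta> t (N - int k) x) \<le> ennreal ((real CARD('n) + 1) powr \<delta> * geoC \<delta>)" for x
      by (rule Wfar_summable[OF \<delta>])
  qed (use p C geoC_pos[OF \<delta>] in simp_all)
qed

section \<open>Domination of the positive kernels by grid kernels\<close>

lemma epowr_add_le:
  assumes "r > 0" shows "epowr (a + b) r \<le> ennreal (2 powr r) * (epowr a r + epowr b r)"
  using epowr_sum_le[OF assms, of "UNIV :: bool set" "\<lambda>i. if i then a else b"]
  by (simp add: UNIV_bool add.commute)

lemma ex_power_of_two:
  assumes "r > 0" shows "\<exists>e::int. r \<le> 2 powr e \<and> 2 powr e < 2 * r"
proof -
  define e where "e = \<lceil>log 2 r\<rceil>"
  have "log 2 r \<le> e" "e < log 2 r + 1" unfolding e_def by linarith+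
  then have "2 powr log 2 r \<le> 2 powr e" "2 powr e < 2 powr (log 2 r + 1)"
    by (intro powr_mono powr_less_mono; simp)+
  then show ?thesis using assms by (intro exI[of _ e]) (simp add: powr_add)
qed

lemma same_gcell_pair:
  fixes x y :: "real ^ 'n::finite"
  assumes "norm (x - y) \<le> 2 powr e / 3" shows "\<exists>t. gidx t e x = gidx t e y"
proof -
  have "u $ i - v $ i \<le> 2 powr e / 3" if "u \<in> {x, y}" "v \<in> {x, y}" for u v i
  proof -
    have "u $ i - v $ i \<le> norm (u - v)" using component_le_norm_cart[of "u - v" i] by simp
    also have "\<dots> \<le> norm (x - y)" using that by (auto simp: norm_minus_commute)
    finally show ?thesis using assms by simp
  qed
  then show ?thesis using same_gcell[of "{x, y}" e] by auto
qed

text \<open>Homogeneous of degree \<alpha> - n for every \<delta>; for \<delta> = 0 and x, y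
  distinct it is the Riesz kernel.\<close>

definition hker :: "real \<Rightarrow> real \<Rightarrow> real ^ 'n::finite \<Rightarrow> real ^ 'n \<Rightarrow> ennreal" where
  "hker \<alpha> \<delta> x y = ennreal (max (norm x) (norm y) powr (- \<delta>) * norm (x - y) powr (\<alpha> + \<delta> - real CARD('n)))"

lemma gkern_ge:
  fixes x y :: "real ^ 'n::finite"
  assumes "gidx t e x = gidx t e y"
  shows "gscale \<alpha> TYPE('n) e * W t e x \<le> (SUP m. gkern \<alpha> W m x y)"
proof -
  define m where "m = nat \<bar>e\<bar>"
  have "gscale \<alpha> TYPE('n) e * W t e x = gscale \<alpha> TYPE('n) e * W t e x * indicator (gcell t e x) y"
    using assms by (simp add: gcell_def)
  also have "\<dots> \<le> (\<Sum>e\<in>{- int m..int m}. gscale \<alpha> TYPE('n) e * W t e x * indicator (gcell t e x) y)"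
    by (rule member_le_sum) (auto simp: m_def)
  also have "\<dots> \<le> gkern \<alpha> W m x y"
    unfolding gkern_def
    by (rule member_le_sum[of t UNIV "\<lambda>t. \<Sum>e\<in>{- int m..int m}. gscale \<alpha> TYPE('n) e * W t e x * indicator (gcell t e x) y"]) auto
  also have "\<dots> \<le> (SUP m. gkern \<alpha> W m x y)" by (rule SUP_upper) simp
  finally show ?thesis .
qed

lemma hker_le_one:
  fixes x y :: "real ^ 'n::finite"
  assumes "x \<noteq> y" "\<alpha> < real CARD('n)"
  shows "hker \<alpha> 0 x y \<le> ennreal (6 powr (real CARD('n) - \<alpha>)) * (SUP m. gkern \<alpha> (\<lambda>t e x. 1) m x y)"
proof -
  define d where "d = norm (x - y)"
  have d: "d > 0" using assms by (simp add: d_def)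
  \<comment> \<open>A side of at least 3 |x - y| is what the one-third trick requires; the upper
    bound 6 |x - y| gives the constant.\<close>
  obtain e :: int where e: "3 * d \<le> 2 powr e" "2 powr e < 2 * (3 * d)" using ex_power_of_two[of "3 * d"] d by auto
  obtain t where t: "gidx t e x = gidx t e y" using same_gcell_pair[of x y e] e by (auto simp: d_def)
  \<comment> \<open>On the reals \<open>0 powr 0 = 0\<close>, so the factor with exponent 0 is 1
    only away from x = y = 0.\<close>
  have "x \<noteq> 0 \<or> y \<noteq> 0" using assms by auto
  then have mx: "max (norm x) (norm y) powr (- 0) = 1" by (auto simp: max_def)
  have "d powr (\<alpha> + 0 - real CARD('n)) = 6 powr (real CARD('n) - \<alpha>) * (6 * d) powr (\<alpha> - real CARD('n))"
    using d by (subst powr_mult) (auto simp: mult.assoc[symmetric] powr_add[symmetric])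
  also have "\<dots> \<le> 6 powr (real CARD('n) - \<alpha>) * (2 powr e) powr (\<alpha> - real CARD('n))"
    using e d assms by (intro mult_left_mono powr_mono2') auto
  finally have "hker \<alpha> 0 x y \<le> ennreal (6 powr (real CARD('n) - \<alpha>) * (2 powr e) powr (\<alpha> - real CARD('n)))"
    unfolding hker_def mx d_def[symmetric] by (intro ennreal_leI) simp
  also have "\<dots> = ennreal (6 powr (real CARD('n) - \<alpha>)) * (gscale \<alpha> TYPE('n) e * 1)"
    by (simp add: gscale_def powr_powr ennreal_mult)
  also have "\<dots> \<le> ennreal (6 powr (real CARD('n) - \<alpha>)) * (SUP m. gkern \<alpha> (\<lambda>t e x. 1) m x y)"
    using gkern_ge[OF t, of \<alpha> "\<lambda>t e x. 1"] by (intro mult_left_mono) auto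
  finally show ?thesis .
qed

text \<open>Points with \<open>\<bar>x - y\<bar> \<ge> c max \<bar>x\<bar> \<bar>y\<bar>\<close> lie in a cube that also contains the origin; otherwise
  a cube of size comparable to \<open>\<bar>x - y\<bar>\<close> is far from the origin.\<close>

lemma hker_le_far:
  fixes x y :: "real ^ 'n::finite"
  assumes xy: "x \<noteq> y" and \<delta>: "0 < \<delta>" "\<delta> \<le> real CARD('n)"
  defines "n \<equiv> real CARD('n)"
  shows "hker 0 \<delta> x y \<le> ennreal ((6 * n + 7) powr (n - \<delta>) * 12 powr n) * (SUP m. gkern 0 W0 m x y)
     + ennreal (6 powr n) * (SUP m. gkern 0 (Wfar \<delta>) m x y)"
proof -
  define D where "D = max (norm x) (norm y)"
  define d where "d = norm (x - y)"
  have n: "n > 0" by (simp add: n_def)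
  have d: "d > 0" using xy by (simp add: d_def)
  have D: "D > 0" using xy by (auto simp: D_def less_max_iff_disj)
  have nx: "norm x \<le> D" "norm y \<le> D" by (auto simp: D_def)
  have hk: "hker 0 \<delta> x y = ennreal (D powr (- \<delta>) * d powr (\<delta> - n))"
    by (simp add: hker_def D_def d_def n_def)
  show ?thesis
  \<comment> \<open>The threshold: a cell of side less than 6 d has diameter at most 6 n d, and D
    \<le> |x| + d. So D > (6 n + 7) d leaves a distance of more than 6 d between the cell and the
    origin, which exceeds the side.\<close>
  proof (cases "D \<le> (6 * n + 7) * d")
    case True
    \<comment> \<open>The points 0, x and y are pairwise at distance at most 2 D, and the one-third
      trick asks for three times that.\<close>
    obtain e :: int where e: "6 * D \<le> 2 powr e" "2 powr e < 2 * (6 * D)" using ex_power_of_two[of "6 * D"] D by auto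
    have "u $ i - v $ i \<le> 2 powr e / 3" if "u \<in> {0, x, y}" "v \<in> {0, x, y}" for u v i
    proof -
      have "u $ i - v $ i \<le> norm (u - v)" using component_le_norm_cart[of "u - v" i] by simp
      also have "\<dots> \<le> norm u + norm v" by (rule norm_triangle_ineq4)
      also have "\<dots> \<le> D + D" using that nx D by (intro add_mono) auto
      finally show ?thesis using e by simp
    qed
    then obtain t where t: "gidx t e x = gidx t e y" "gidx t e x = gidx t e 0" using same_gcell[of "{0, x, y}" e] by auto
    have "d powr (\<delta> - n) \<le> (D / (6 * n + 7)) powr (\<delta> - n)"
      using True D n \<delta> by (intro powr_mono2') (auto simp: n_def pos_divide_le_eq mult.commute)
    also have "\<dots> = (6 * n + 7) powr (n - \<delta>) * D powr (\<delta> - n)"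
      using D n by (simp add: powr_divide powr_minus_divide[of "6 * n + 7" "n - \<delta>", symmetric] field_simps powr_diff)
    finally have "D powr (- \<delta>) * d powr (\<delta> - n) \<le> D powr (- \<delta>) * ((6 * n + 7) powr (n - \<delta>) * D powr (\<delta> - n))"
      by (intro mult_left_mono) auto
    also have "\<dots> = (6 * n + 7) powr (n - \<delta>) * (D powr (- \<delta>) * D powr (\<delta> - n))" by (simp only: mult_ac)
    also have "D powr (- \<delta>) * D powr (\<delta> - n) = D powr (- n)" by (simp add: powr_add[symmetric])
    also have "D powr (- n) = 12 powr n * (2 * (6 * D)) powr (- n)"
      using D by (simp add: powr_mult powr_minus field_simps)
    also have "\<dots> \<le> 12 powr n * (2 powr e) powr (- n)"
      using e D n by (intro mult_left_mono powr_mono2') auto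
    finally have "D powr (- \<delta>) * d powr (\<delta> - n) \<le> (6 * n + 7) powr (n - \<delta>) * 12 powr n * 2 powr (e * (0 - n))"
      using n by (simp add: powr_powr mult.assoc)
    then have "hker 0 \<delta> x y \<le> ennreal ((6 * n + 7) powr (n - \<delta>) * 12 powr n * 2 powr (e * (0 - n)))"
      unfolding hk by (rule ennreal_leI)
    also have "\<dots> = ennreal ((6 * n + 7) powr (n - \<delta>) * 12 powr n) * (gscale 0 TYPE('n) e * W0 t e x)"
      using t by (simp add: gscale_def W0_def ennreal_mult n_def)
    also have "\<dots> \<le> ennreal ((6 * n + 7) powr (n - \<delta>) * 12 powr n) * (SUP m. gkern 0 W0 m x y)"
      by (intro mult_left_mono gkern_ge t) auto
    finally show ?thesis by (simp add: add_increasing2)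
  next
    case False
    obtain e :: int where e: "3 * d \<le> 2 powr e" "2 powr e < 2 * (3 * d)" using ex_power_of_two[of "3 * d"] d by auto
    obtain t where t: "gidx t e x = gidx t e y" using same_gcell_pair[of x y e] e by (auto simp: d_def)
    define r where "r = cell_dist t e x"
    have "D \<le> norm x + d"
      using norm_triangle_sub[of y x] unfolding D_def d_def by (simp add: norm_minus_commute)
    moreover have "norm x \<le> r + n * 2 powr e" unfolding r_def n_def by (rule norm_le_cell_dist)
    moreover have "n * 2 powr e \<le> n * (6 * d)" using e n by (intro mult_left_mono) auto
    moreover have "(6 * n + 7) * d = n * (6 * d) + 7 * d" by (simp add: algebra_simps)
    ultimately have r: "2 powr e \<le> r" using e False by linarith
    have rD: "r \<le> D" using cell_dist_le[OF gcell_self, of t e x] nx by (simp add: r_def)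
    have rpos: "r > 0" using r by (rule less_le_trans[rotated]) simp
    have "(3 * d / D) powr \<delta> \<le> (2 powr e / r) powr \<delta>"
      using e r rD rpos d D \<delta> by (intro powr_mono2 frac_le) auto
    moreover have "(d / D) powr \<delta> \<le> (3 * d / D) powr \<delta>"
      using d D \<delta> by (intro powr_mono2) (auto simp: divide_right_mono)
    moreover have "(6 * d) powr (- n) \<le> (2 powr e) powr (- n)"
      using e d n by (intro powr_mono2') auto
    ultimately have "(6 * d) powr (- n) * (d / D) powr \<delta> \<le> 2 powr (e * (0 - n)) * (2 powr e / r) powr \<delta>"
      by (intro mult_mono) (auto simp: powr_powr)
    then have "6 powr n * ((6 * d) powr (- n) * (d / D) powr \<delta>) \<le> 6 powr n * (2 powr (e * (0 - n)) * (2 powr e / r) powr \<delta>)"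
      by (rule mult_left_mono) simp
    moreover have "6 powr n * ((6 * d) powr (- n) * (d / D) powr \<delta>) = D powr (- \<delta>) * d powr (\<delta> - n)"
      using d D by (simp add: powr_mult powr_divide powr_minus powr_diff field_simps)
    ultimately have "hker 0 \<delta> x y \<le> ennreal (6 powr n * (2 powr (e * (0 - n)) * (2 powr e / r) powr \<delta>))"
      unfolding hk by (intro ennreal_leI) simp
    also have "\<dots> = ennreal (6 powr n) * (gscale 0 TYPE('n) e * Wfar \<delta> t e x)"
      using r by (simp add: gscale_def Wfar_def ennreal_mult n_def r_def)
    also have "\<dots> \<le> ennreal (6 powr n) * (SUP m. gkern 0 (Wfar \<delta>) m x y)"
      by (intro mult_left_mono gkern_ge t) auto
    finally show ?thesis by (simp add: add_increasing)
  qed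
qed

lemma AE_neq_lebesgue: "AE y in lebesgue. x \<noteq> (y :: real ^ 'n::finite)"
proof (rule AE_I'[of "{x}"])
  show "{x} \<in> null_sets lebesgue"
    by (simp add: negligible_iff_null_sets[symmetric])
qed auto

text \<open>For p < q the kernel is dominated by the sum over all cells. For \<alpha> = 0 it is
  split between the cells containing the origin and the far ones, each with its own testing
  argument; both testing constants are used, one for each half of the corona.\<close>

theorem hker_two_weight:
  fixes \<mu> \<nu> :: "real ^ 'n::finite \<Rightarrow> ennreal"
  assumes \<nu>: "weight \<nu>" and \<mu>: "weight \<mu>" and p: "dual_exp p p'" and q: "dual_exp q q'" and pq: "p \<le> q"
    and T: "testing_const \<alpha> p q \<mu> \<nu> < top" and T': "testing_const \<alpha> q' p' \<nu> \<mu> < top"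
    and \<alpha>: "\<alpha> < real CARD('n)"
    and cases: "(\<delta> = 0 \<and> p < q) \<or> (\<alpha> = 0 \<and> 0 < \<delta> \<and> \<delta> \<le> real CARD('n))"
  shows "\<exists>D\<ge>0. \<forall>f \<in> borel_measurable lebesgue.
    (\<integral>\<^sup>+ x. epowr (\<integral>\<^sup>+ y. hker \<alpha> \<delta> x y * (f y * \<nu> y) \<partial>lebesgue) q * \<mu> x \<partial>lebesgue)
      \<le> ennreal D * epowr (\<integral>\<^sup>+ x. epowr (f x) p * \<nu> x \<partial>lebesgue) (q / p)"
proof -
  have p1: "p > 1" "p' > 1" and q1: "q > 1" "q' > 1" using dual_expD[OF p] dual_expD[OF q] by auto
  have [measurable]: "\<mu> \<in> borel_measurable lebesgue" "\<nu> \<in> borel_measurable lebesgue"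
    using assms by (auto simp: weight_def)
  obtain C where C: "C > 0" "testing_const \<alpha> p q \<mu> \<nu> \<le> ennreal C" "testing_const \<alpha> q' p' \<nu> \<mu> \<le> ennreal C"
  proof -
    obtain a where a: "testing_const \<alpha> p q \<mu> \<nu> = ennreal a" "a \<ge> 0" using T by (cases "testing_const \<alpha> p q \<mu> \<nu>") auto
    obtain b where b: "testing_const \<alpha> q' p' \<nu> \<mu> = ennreal b" "b \<ge> 0" using T' by (cases "testing_const \<alpha> q' p' \<nu> \<mu>") auto
    show ?thesis by (rule that[of "a + b + 1"]) (use a b in \<open>auto intro!: ennreal_leI\<close>)
  qed
  have bil0: "bilC p q p' q' c powr q \<ge> 0" for c by simp
  define N where "N = real CARD('n \<Rightarrow> bool)"
  have N: "N \<ge> 0" by (simp add: N_def)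
  have op: "\<exists>D\<ge>0. \<forall>f \<in> borel_measurable lebesgue.
    (\<integral>\<^sup>+ x. epowr (\<integral>\<^sup>+ y. (SUP m. gkern \<alpha> W m x y) * (f y * \<nu> y) \<partial>lebesgue) q * \<mu> x \<partial>lebesgue)
      \<le> ennreal D * epowr (\<integral>\<^sup>+ x. epowr (f x) p * \<nu> x \<partial>lebesgue) (q / p)"
    if W: "cellwise W" and 1: "gtesting \<alpha> W \<nu> \<mu> p q c1" and 2: "gtesting \<alpha> W \<mu> \<nu> q' p' c2" and c: "0 \<le> c1" "0 \<le> c2"
    for W c1 c2
  proof (intro exI conjI ballI)
    show "0 \<le> N powr q * (N * bilC p q p' q' (c1 + c2) powr q)" using N by simp
    fix f :: "real ^ 'n \<Rightarrow> ennreal" assume "f \<in> borel_measurable lebesgue"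
    then show "(\<integral>\<^sup>+ x. epowr (\<integral>\<^sup>+ y. (SUP m. gkern \<alpha> W m x y) * (f y * \<nu> y) \<partial>lebesgue) q * \<mu> x \<partial>lebesgue)
      \<le> ennreal (N powr q * (N * bilC p q p' q' (c1 + c2) powr q)) * epowr (\<integral>\<^sup>+ x. epowr (f x) p * \<nu> x \<partial>lebesgue) (q / p)"
      unfolding N_def
      by (intro grid_op_bound[OF \<nu> \<mu> p q pq W gtesting_mono[OF 1] gtesting_mono[OF 2]]) (use c in auto)
  qed
  have q'p': "q' \<le> p'" by (rule dual_exp_le[OF p q pq])
  show ?thesis
  proof (cases "\<delta> = 0 \<and> p < q")
    case True
    \<comment> \<open>The dual testing condition has the gain p'/q' - 1, so strictness must pass to
      the conjugate exponents.\<close>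
    have q'p's: "q' < p'"
    proof -
      have "q' \<noteq> p'"
      proof
        assume "q' = p'"
        then have "1 / p + 1 / p' = 1" "1 / q + 1 / p' = 1" using p q by (simp_all add: dual_exp_def)
        then have "1 / p = 1 / q" by linarith
        then show False using True by simp
      qed
      then show ?thesis using q'p' by simp
    qed
    let ?G = "geoC (real CARD('n) - \<alpha>)"
    have G: "?G > 0" using \<alpha> by (intro geoC_pos) simp
    obtain D where D: "D \<ge> 0" "\<And>f. f \<in> borel_measurable lebesgue \<Longrightarrow>
      (\<integral>\<^sup>+ x. epowr (\<integral>\<^sup>+ y. (SUP m. gkern \<alpha> (\<lambda>t e x. 1) m x y) * (f y * \<nu> y) \<partial>lebesgue) q * \<mu> x \<partial>lebesgue)
      \<le> ennreal D * epowr (\<integral>\<^sup>+ x. epowr (f x) p * \<nu> x \<partial>lebesgue) (q / p)"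
    proof -
      have "0 \<le> levC q (q / p - 1 + 0) ?G (C powr q)" "0 \<le> levC p' (p' / q' - 1 + 0) ?G (C powr p')"
        using True q'p's p1 q1 C G by (auto intro!: levC_nonneg)
      with op[OF cellwise_1 gtesting_one[OF \<nu> \<mu> C(2,1) p1(1) _ \<alpha>] gtesting_one[OF \<mu> \<nu> C(3,1) q1(2) q'p's \<alpha>]] True
      show ?thesis using that by blast
    qed
    define c where "c = 6 powr (real CARD('n) - \<alpha>)"
    have c: "c > 0" by (simp add: c_def)
    show ?thesis
    proof (intro exI[of _ "c powr q * D"] conjI ballI)
      show "0 \<le> c powr q * D" using D by simp
      fix f :: "real ^ 'n \<Rightarrow> ennreal" assume f[measurable]: "f \<in> borel_measurable lebesgue"
      note [measurable] = measurable_nn_integral_gkern[OF cellwise_1, of "\<lambda>y. f y * \<nu> y" \<alpha>]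
      let ?I = "\<lambda>x. \<integral>\<^sup>+ y. (SUP m. gkern \<alpha> (\<lambda>t e x. 1) m x y) * (f y * \<nu> y) \<partial>lebesgue"
      have "(\<integral>\<^sup>+ x. epowr (\<integral>\<^sup>+ y. hker \<alpha> \<delta> x y * (f y * \<nu> y) \<partial>lebesgue) q * \<mu> x \<partial>lebesgue)
         \<le> (\<integral>\<^sup>+ x. ennreal (c powr q) * (epowr (?I x) q * \<mu> x) \<partial>lebesgue)"
      proof (rule nn_integral_mono)
        fix x
        have "(\<integral>\<^sup>+ y. hker \<alpha> \<delta> x y * (f y * \<nu> y) \<partial>lebesgue) \<le> (\<integral>\<^sup>+ y. ennreal c * ((SUP m. gkern \<alpha> (\<lambda>t e x. 1) m x y) * (f y * \<nu> y)) \<partial>lebesgue)"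
        proof (rule nn_integral_mono_AE)
          show "AE y in lebesgue. hker \<alpha> \<delta> x y * (f y * \<nu> y) \<le> ennreal c * ((SUP m. gkern \<alpha> (\<lambda>t e x. 1) m x y) * (f y * \<nu> y))"
            using AE_neq_lebesgue[of x]
          proof eventually_elim
            case (elim y)
            then have "hker \<alpha> \<delta> x y \<le> ennreal c * (SUP m. gkern \<alpha> (\<lambda>t e x. 1) m x y)"
              using hker_le_one[OF _ \<alpha>, of x y] True by (simp add: c_def)
            then show ?case unfolding mult.assoc[symmetric] by (intro mult_right_mono) auto
          qed
        qed
        also have "\<dots> = ennreal c * ?I x" by (rule nn_integral_cmult) measurable
        finally have "epowr (\<integral>\<^sup>+ y. hker \<alpha> \<delta> x y * (f y * \<nu> y) \<partial>lebesgue) q \<le> epowr (ennreal c * ?I x) q"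
          using q1 by (intro epowr_mono) auto
        also have "\<dots> = ennreal (c powr q) * epowr (?I x) q"
          using q1 c by (simp add: epowr_mult epowr_ennreal_pos)
        finally show "epowr (\<integral>\<^sup>+ y. hker \<alpha> \<delta> x y * (f y * \<nu> y) \<partial>lebesgue) q * \<mu> x \<le> ennreal (c powr q) * (epowr (?I x) q * \<mu> x)"
          unfolding mult.assoc[symmetric] by (rule mult_right_mono) simp
      qed
      also have "\<dots> = ennreal (c powr q) * (\<integral>\<^sup>+ x. epowr (?I x) q * \<mu> x \<partial>lebesgue)"
        by (rule nn_integral_cmult) measurable
      also have "\<dots> \<le> ennreal (c powr q) * (ennreal D * epowr (\<integral>\<^sup>+ x. epowr (f x) p * \<nu> x \<partial>lebesgue) (q / p))"
        by (intro mult_left_mono D(2) f) auto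
      finally show "(\<integral>\<^sup>+ x. epowr (\<integral>\<^sup>+ y. hker \<alpha> \<delta> x y * (f y * \<nu> y) \<partial>lebesgue) q * \<mu> x \<partial>lebesgue)
         \<le> ennreal (c powr q * D) * epowr (\<integral>\<^sup>+ x. epowr (f x) p * \<nu> x \<partial>lebesgue) (q / p)"
        using D(1) by (simp add: ennreal_mult mult.assoc)
    qed
  next
    case False
    then have \<alpha>0: "\<alpha> = 0" and \<delta>: "0 < \<delta>" "\<delta> \<le> real CARD('n)" using cases by auto
    let ?G = "geoC (real CARD('n) - \<alpha>)"
    have G: "?G > 0" using \<alpha> by (intro geoC_pos) simp
    obtain D1 where D1: "D1 \<ge> 0" "\<And>f. f \<in> borel_measurable lebesgue \<Longrightarrow>
      (\<integral>\<^sup>+ x. epowr (\<integral>\<^sup>+ y. (SUP m. gkern \<alpha> W0 m x y) * (f y * \<nu> y) \<partial>lebesgue) q * \<mu> x \<partial>lebesgue)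
      \<le> ennreal D1 * epowr (\<integral>\<^sup>+ x. epowr (f x) p * \<nu> x \<partial>lebesgue) (q / p)"
    proof -
      have "0 \<le> levC q (q / p - 1 + 1) ?G (C powr q)" "0 \<le> levC p' (p' / q' - 1 + 1) ?G (C powr p')"
        using p1 q1 C G by (auto intro!: levC_nonneg)
      with op[OF cellwise_W0 gtesting_W0[OF \<nu> \<mu> C(2,1) p1(1) pq \<alpha>] gtesting_W0[OF \<mu> \<nu> C(3,1) q1(2) q'p' \<alpha>]]
      show ?thesis using that by blast
    qed
    obtain D2 where D2: "D2 \<ge> 0" "\<And>f. f \<in> borel_measurable lebesgue \<Longrightarrow>
      (\<integral>\<^sup>+ x. epowr (\<integral>\<^sup>+ y. (SUP m. gkern \<alpha> (Wfar \<delta>) m x y) * (f y * \<nu> y) \<partial>lebesgue) q * \<mu> x \<partial>lebesgue)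
      \<le> ennreal D2 * epowr (\<integral>\<^sup>+ x. epowr (f x) p * \<nu> x \<partial>lebesgue) (q / p)"
    proof -
      have "0 \<le> ((real CARD('n) + 1) powr \<delta> * geoC \<delta>) powr q * (C powr q)"
        "0 \<le> ((real CARD('n) + 1) powr \<delta> * geoC \<delta>) powr p' * (C powr p')" by auto
      with op[OF cellwise_Wfar gtesting_Wfar[OF \<nu> \<mu> C(2,1) p1(1) pq \<delta>(1)] gtesting_Wfar[OF \<mu> \<nu> C(3,1) q1(2) q'p' \<delta>(1)]]
      show ?thesis using that by blast
    qed
    define c where "c = (6 * real CARD('n) + 7) powr (real CARD('n) - \<delta>) * 12 powr real CARD('n) + 6 powr real CARD('n)"
    have c: "c > 0" unfolding c_def by (intro add_nonneg_pos) auto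
    show ?thesis
    proof (intro exI[of _ "c powr q * 2 powr q * (D1 + D2)"] conjI ballI)
      show "0 \<le> c powr q * 2 powr q * (D1 + D2)" using D1 D2 by simp
      fix f :: "real ^ 'n \<Rightarrow> ennreal" assume f[measurable]: "f \<in> borel_measurable lebesgue"
      note [measurable] = measurable_nn_integral_gkern[OF cellwise_W0, of "\<lambda>y. f y * \<nu> y" \<alpha>]
        measurable_nn_integral_gkern[OF cellwise_Wfar, of "\<lambda>y. f y * \<nu> y" \<alpha> \<delta>]
      let ?I = "\<lambda>W x. \<integral>\<^sup>+ y. (SUP m. gkern \<alpha> W m x y) * (f y * \<nu> y) \<partial>lebesgue"
      let ?X = "epowr (\<integral>\<^sup>+ x. epowr (f x) p * \<nu> x \<partial>lebesgue) (q / p)"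
      have "(\<integral>\<^sup>+ x. epowr (\<integral>\<^sup>+ y. hker \<alpha> \<delta> x y * (f y * \<nu> y) \<partial>lebesgue) q * \<mu> x \<partial>lebesgue)
         \<le> (\<integral>\<^sup>+ x. ennreal (c powr q * 2 powr q) * (epowr (?I W0 x) q * \<mu> x + epowr (?I (Wfar \<delta>) x) q * \<mu> x) \<partial>lebesgue)"
      proof (rule nn_integral_mono)
        fix x
        have "(\<integral>\<^sup>+ y. hker \<alpha> \<delta> x y * (f y * \<nu> y) \<partial>lebesgue)
          \<le> (\<integral>\<^sup>+ y. ennreal c * ((SUP m. gkern \<alpha> W0 m x y) * (f y * \<nu> y) + (SUP m. gkern \<alpha> (Wfar \<delta>) m x y) * (f y * \<nu> y)) \<partial>lebesgue)"
        proof (rule nn_integral_mono_AE)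
          show "AE y in lebesgue. hker \<alpha> \<delta> x y * (f y * \<nu> y)
            \<le> ennreal c * ((SUP m. gkern \<alpha> W0 m x y) * (f y * \<nu> y) + (SUP m. gkern \<alpha> (Wfar \<delta>) m x y) * (f y * \<nu> y))"
            using AE_neq_lebesgue[of x]
          proof eventually_elim
            case (elim y)
            have "hker \<alpha> \<delta> x y \<le> ennreal ((6 * real CARD('n) + 7) powr (real CARD('n) - \<delta>) * 12 powr real CARD('n)) * (SUP m. gkern \<alpha> W0 m x y)
              + ennreal (6 powr real CARD('n)) * (SUP m. gkern \<alpha> (Wfar \<delta>) m x y)"
              unfolding \<alpha>0 by (rule hker_le_far[OF elim \<delta>])
            also have "\<dots> \<le> ennreal c * (SUP m. gkern \<alpha> W0 m x y) + ennreal c * (SUP m. gkern \<alpha> (Wfar \<delta>) m x y)"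
              unfolding c_def by (intro add_mono mult_right_mono ennreal_leI) auto
            finally have "hker \<alpha> \<delta> x y \<le> ennreal c * ((SUP m. gkern \<alpha> W0 m x y) + (SUP m. gkern \<alpha> (Wfar \<delta>) m x y))"
              by (simp only: distrib_left)
            then show ?case unfolding distrib_right[symmetric] mult.assoc[symmetric] by (intro mult_right_mono) auto
          qed
        qed
        also have "\<dots> = ennreal c * (?I W0 x + ?I (Wfar \<delta>) x)" by (simp add: nn_integral_cmult nn_integral_add)
        finally have "epowr (\<integral>\<^sup>+ y. hker \<alpha> \<delta> x y * (f y * \<nu> y) \<partial>lebesgue) q \<le> epowr (ennreal c * (?I W0 x + ?I (Wfar \<delta>) x)) q"
          using q1 by (intro epowr_mono) auto
        also have "\<dots> = ennreal (c powr q) * epowr (?I W0 x + ?I (Wfar \<delta>) x) q"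
          using q1 c by (simp add: epowr_mult epowr_ennreal_pos)
        also have "\<dots> \<le> ennreal (c powr q) * (ennreal (2 powr q) * (epowr (?I W0 x) q + epowr (?I (Wfar \<delta>) x) q))"
          using q1 by (intro mult_left_mono epowr_add_le) auto
        also have "\<dots> = ennreal (c powr q * 2 powr q) * (epowr (?I W0 x) q + epowr (?I (Wfar \<delta>) x) q)"
          by (simp add: ennreal_mult mult.assoc)
        finally show "epowr (\<integral>\<^sup>+ y. hker \<alpha> \<delta> x y * (f y * \<nu> y) \<partial>lebesgue) q * \<mu> x
           \<le> ennreal (c powr q * 2 powr q) * (epowr (?I W0 x) q * \<mu> x + epowr (?I (Wfar \<delta>) x) q * \<mu> x)"
          unfolding distrib_right[symmetric] mult.assoc[symmetric] by (rule mult_right_mono) simp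
      qed
      also have "\<dots> = ennreal (c powr q * 2 powr q) * ((\<integral>\<^sup>+ x. epowr (?I W0 x) q * \<mu> x \<partial>lebesgue) + (\<integral>\<^sup>+ x. epowr (?I (Wfar \<delta>) x) q * \<mu> x \<partial>lebesgue))"
        by (simp add: nn_integral_cmult nn_integral_add)
      also have "\<dots> \<le> ennreal (c powr q * 2 powr q) * (ennreal D1 * ?X + ennreal D2 * ?X)"
        by (intro mult_left_mono add_mono D1(2) D2(2) f) auto
      finally show "(\<integral>\<^sup>+ x. epowr (\<integral>\<^sup>+ y. hker \<alpha> \<delta> x y * (f y * \<nu> y) \<partial>lebesgue) q * \<mu> x \<partial>lebesgue)
         \<le> ennreal (c powr q * 2 powr q * (D1 + D2)) * ?X"
        using D1(1) D2(1) by (simp add: ennreal_mult ennreal_plus distrib_right mult.assoc)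
    qed
  qed
qed

section \<open>Linear changes of variables and the product kernel\<close>

lemma borel_measurable_matrix_vector_mult [measurable (raw)]:
  fixes A :: "real ^ 'n::finite ^ 'm::finite"
  assumes "f \<in> borel_measurable M" shows "(\<lambda>x. A *v f x) \<in> borel_measurable M"
proof -
  have "(\<lambda>x. A *v x) \<in> borel_measurable borel"
    by (intro borel_measurable_continuous_onI linear_continuous_on matrix_vector_mul_bounded_linear)
  from measurable_compose[OF assms this] show ?thesis .
qed

lemma matrix_inv_mult:
  fixes A :: "real ^ 'n::finite ^ 'n"
  assumes "invertible A" shows "A ** matrix_inv A = mat 1 \<and> matrix_inv A ** A = mat 1"
  unfolding matrix_inv_def by (rule someI_ex) (use assms in \<open>simp add: invertible_def\<close>)

lemma matrix_inv_vector:
  fixes A :: "real ^ 'n::finite ^ 'n"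
  assumes "invertible A"
  shows "A *v (matrix_inv A *v x) = x" "matrix_inv A *v (A *v x) = x"
  using matrix_inv_mult[OF assms] by (simp_all add: matrix_vector_mul_assoc)

text \<open>Translations and reflections in one statement: the Jacobian |c|^n is 1.\<close>

lemma nn_integral_lborel_affine_sign:
  fixes F :: "'a::euclidean_space \<Rightarrow> ennreal"
  assumes [measurable]: "F \<in> borel_measurable borel" and "\<bar>c\<bar> = 1"
  shows "(\<integral>\<^sup>+ x. F (t + c *\<^sub>R x) \<partial>lborel) = (\<integral>\<^sup>+ x. F x \<partial>lborel)"
proof -
  have "c \<noteq> 0" using assms(2) by auto
  have "(\<integral>\<^sup>+ x. F x \<partial>lborel) = (\<integral>\<^sup>+ x. F x \<partial>density (distr lborel borel (\<lambda>x. t + c *\<^sub>R x)) (\<lambda>_. \<bar>c\<bar> ^ DIM('a)))"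
    using lborel_affine[OF \<open>c \<noteq> 0\<close>, of t] by simp
  also have "\<dots> = (\<integral>\<^sup>+ x. F (t + c *\<^sub>R x) \<partial>lborel)"
    using assms(2) by (simp add: density_1 nn_integral_distr)
  finally show ?thesis by simp
qed

text \<open>Both sides, times the volume of a fixed cube \<open>Q\<close>, are iterated integrals of
  \<open>F (A x + y) 1\<^sub>Q (y)\<close>; this replaces the determinant formula, which the library provides for
  well-ordered index types only.\<close>

lemma nn_integral_lborel_matrix:
  fixes A :: "real ^ 'n::finite ^ 'n"
  assumes A: "invertible A"
  shows "\<exists>c\<ge>0. \<forall>F \<in> borel_measurable borel. (\<integral>\<^sup>+ x. F (A *v x) \<partial>lborel) = ennreal c * (\<integral>\<^sup>+ x. F x \<partial>lborel)"
proof -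
  define B where "B = matrix_inv A"
  have AB: "A *v (B *v x) = x" "B *v (A *v x) = x" for x
    unfolding B_def by (rule matrix_inv_vector[OF A])+
  define Q :: "(real ^ 'n) set" where "Q = cbox 0 One"
  have Q1: "emeasure lborel Q = 1" unfolding Q_def by (subst emeasure_lborel_cbox_eq) (simp add: inner_Basis)
  have [measurable]: "Q \<in> sets borel" by (simp add: Q_def)
  \<comment> \<open>The volume of the preimage of Q under A, that is 1 / |det A|; it becomes the
    constant c.\<close>
  define m where "m = (\<integral>\<^sup>+ x. indicator Q (A *v x) \<partial>lborel)"
  have "m < top"
  proof -
    obtain b where b: "b > 0" "\<And>x. norm (B *v x) \<le> b * norm x"
      using linear_bounded_pos[OF matrix_vector_mul_linear[of B]] by blast
    obtain r where r: "\<And>x. x \<in> Q \<Longrightarrow> norm x \<le> r"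
      using bounded_cbox[of 0 "One :: real ^ 'n"] unfolding Q_def bounded_iff by blast
    have "m \<le> (\<integral>\<^sup>+ x. indicator (cball 0 (b * r)) x \<partial>(lborel :: (real ^ 'n) measure))"
      unfolding m_def
    proof (rule nn_integral_mono)
      fix x :: "real ^ 'n"
      have "norm x \<le> b * r" if "A *v x \<in> Q"
      proof -
        have "norm x \<le> b * norm (A *v x)" using b(2)[of "A *v x"] by (simp add: AB)
        also have "\<dots> \<le> b * r" using b(1) r[OF that] by (intro mult_left_mono) auto
        finally show ?thesis .
      qed
      then show "indicator Q (A *v x) \<le> (indicator (cball 0 (b * r)) x :: ennreal)"
        by (auto simp: indicator_def)
    qed
    also have "\<dots> = emeasure lborel (cball 0 (b * r) :: (real ^ 'n) set)" by simp
    also have "\<dots> < top" using emeasure_bounded_finite[OF bounded_cball] by (simp add: less_top)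
    finally show ?thesis .
  qed
  then obtain c where c: "m = ennreal c" "c \<ge> 0" by (cases m) auto
  show ?thesis
  proof (intro exI[of _ c] conjI ballI)
    show "c \<ge> 0" by (rule c)
    fix F :: "real ^ 'n \<Rightarrow> ennreal" assume F [measurable]: "F \<in> borel_measurable borel"
    define I where "I = (\<integral>\<^sup>+ x. (\<integral>\<^sup>+ y. F (A *v x + y) * indicator Q y \<partial>lborel) \<partial>(lborel :: (real ^ 'n) measure))"
    have "I = (\<integral>\<^sup>+ y. (\<integral>\<^sup>+ x. F (A *v x + y) * indicator Q y \<partial>lborel) \<partial>lborel)"
      unfolding I_def by (rule lborel_pair.Fubini') measurable
    also have "\<dots> = (\<integral>\<^sup>+ y. (\<integral>\<^sup>+ x. F (A *v x) \<partial>lborel) * indicator Q y \<partial>lborel)"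
    \<comment> \<open>With y = A (B y), the shift by y is a translation of x, so the inner integral
      does not depend on y.\<close>
    proof (rule nn_integral_cong)
      fix y
      have "(\<integral>\<^sup>+ x. F (A *v x + y) \<partial>lborel) = (\<integral>\<^sup>+ x. F (A *v (B *v y + 1 *\<^sub>R x)) \<partial>lborel)"
        by (simp add: matrix_vector_right_distrib AB add.commute)
      also have "\<dots> = (\<integral>\<^sup>+ x. F (A *v x) \<partial>lborel)"
        by (rule nn_integral_lborel_affine_sign[of "\<lambda>x. F (A *v x)"]) auto
      finally show "(\<integral>\<^sup>+ x. F (A *v x + y) * indicator Q y \<partial>lborel) = (\<integral>\<^sup>+ x. F (A *v x) \<partial>lborel) * indicator Q y"
        by (simp add: nn_integral_multc)
    qed
    also have "\<dots> = (\<integral>\<^sup>+ x. F (A *v x) \<partial>lborel)"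
      by (simp add: nn_integral_cmult Q1)
    finally have 1: "I = (\<integral>\<^sup>+ x. F (A *v x) \<partial>lborel)" .
    have "I = (\<integral>\<^sup>+ x. (\<integral>\<^sup>+ z. F z * indicator Q (z - A *v x) \<partial>lborel) \<partial>lborel)"
      unfolding I_def
    proof (rule nn_integral_cong)
      fix x :: "real ^ 'n"
      show "(\<integral>\<^sup>+ y. F (A *v x + y) * indicator Q y \<partial>lborel) = (\<integral>\<^sup>+ z. F z * indicator Q (z - A *v x) \<partial>lborel)"
        using nn_integral_lborel_affine_sign[of "\<lambda>z. F z * indicator Q (z - A *v x)" 1 "A *v x"] by simp
    qed
    also have "\<dots> = (\<integral>\<^sup>+ z. (\<integral>\<^sup>+ x. F z * indicator Q (z - A *v x) \<partial>lborel) \<partial>lborel)"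
      by (rule lborel_pair.Fubini') measurable
    also have "\<dots> = (\<integral>\<^sup>+ z. F z * m \<partial>lborel)"
    proof (rule nn_integral_cong)
      fix z
      \<comment> \<open>Replacing x by B z - x turns A x into z - A x.\<close>
      have "m = (\<integral>\<^sup>+ x. indicator Q (z - A *v (B *v z + (-1) *\<^sub>R x)) \<partial>lborel)"
        unfolding m_def by (simp add: matrix_vector_mult_diff_distrib AB)
      also have "\<dots> = (\<integral>\<^sup>+ x. indicator Q (z - A *v x) \<partial>lborel)"
        by (rule nn_integral_lborel_affine_sign[of "\<lambda>x. indicator Q (z - A *v x)"]) auto
      finally show "(\<integral>\<^sup>+ x. F z * indicator Q (z - A *v x) \<partial>lborel) = F z * m"
        by (simp add: nn_integral_cmult)
    qed
    also have "\<dots> = ennreal c * (\<integral>\<^sup>+ x. F x \<partial>lborel)"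
      unfolding c by (subst mult.commute) (rule nn_integral_cmult, measurable)
    finally show "(\<integral>\<^sup>+ x. F (A *v x) \<partial>lborel) = ennreal c * (\<integral>\<^sup>+ x. F x \<partial>lborel)" using 1 by simp
  qed
qed

text \<open>P need not be measurable, so its exceptional set is first enclosed in a Borel null set,
  whose preimage under y to x - A y is null by the change of variables.\<close>

lemma AE_lebesgue_affine:
  fixes A :: "real ^ 'n::finite ^ 'n"
  assumes A: "invertible A" and P: "AE z in lebesgue. P z"
  shows "AE y in lebesgue. P (x - A *v y)"
proof -
  have "AE z in lborel. P z" using P by (simp add: AE_completion_iff)
  then obtain N where N: "{z. \<not> P z} \<subseteq> N" "N \<in> null_sets lborel" by (auto elim!: AE_E simp: null_sets_def)
  have [measurable]: "N \<in> sets borel" using N by auto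
  obtain c where c: "\<And>F. F \<in> borel_measurable borel \<Longrightarrow> (\<integral>\<^sup>+ x. F (A *v x) \<partial>lborel) = ennreal c * (\<integral>\<^sup>+ x. F x \<partial>lborel)"
    using nn_integral_lborel_matrix[OF A] by blast
  have "(\<integral>\<^sup>+ y. indicator N (x - A *v y) \<partial>lborel) = ennreal c * (\<integral>\<^sup>+ z. indicator N (x - z) \<partial>lborel)"
    by (rule c[of "\<lambda>z. indicator N (x - z)"]) measurable
  also have "(\<integral>\<^sup>+ z. indicator N (x - z) \<partial>lborel) = (\<integral>\<^sup>+ z. indicator N z \<partial>lborel)"
    using nn_integral_lborel_affine_sign[of "indicator N" "-1" x] by simp
  also have "\<dots> = 0" using N by auto
  finally have "(\<integral>\<^sup>+ y. indicator N (x - A *v y) \<partial>lborel) = 0" by simp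
  then have "AE y in lborel. indicator N (x - A *v y) = (0::ennreal)"
    by (subst (asm) nn_integral_0_iff_AE) measurable
  then have "AE y in lborel. P (x - A *v y)"
    by eventually_elim (use N(1) in \<open>auto simp: indicator_def split: if_splits\<close>)
  then show ?thesis by (rule AE_completion)
qed

text \<open>An inequality permits replacing F by a Borel majorant G with the same integral, equal to
  \<infinity> on a null set that contains all points where F differs from its Borel version; the
  Borel formula then applies to G.\<close>

lemma nn_integral_lebesgue_matrix_le:
  fixes A :: "real ^ 'n::finite ^ 'n"
  assumes A: "invertible A"
  shows "\<exists>c\<ge>0. \<forall>F \<in> borel_measurable lebesgue. (\<integral>\<^sup>+ x. F (A *v x) \<partial>lebesgue) \<le> ennreal c * (\<integral>\<^sup>+ x. F x \<partial>lebesgue)"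
proof -
  obtain c where c: "c \<ge> 0" "\<And>F. F \<in> borel_measurable borel \<Longrightarrow> (\<integral>\<^sup>+ x. F (A *v x) \<partial>lborel) = ennreal c * (\<integral>\<^sup>+ x. F x \<partial>lborel)"
    using nn_integral_lborel_matrix[OF A] by blast
  show ?thesis
  proof (intro exI[of _ c] conjI ballI)
    fix F :: "real ^ 'n \<Rightarrow> ennreal" assume "F \<in> borel_measurable lebesgue"
    then obtain g where g [measurable]: "g \<in> borel_measurable lborel" and ae: "AE x in lborel. F x = g x"
      using completion_ex_borel_measurable[of F lborel] by blast
    obtain N where N: "{z. \<not> F z = g z} \<subseteq> N" "N \<in> null_sets lborel" using ae by (auto elim!: AE_E simp: null_sets_def)
    have [measurable]: "N \<in> sets borel" "g \<in> borel_measurable borel" using N g by auto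
    define G where "G x = g x + top * indicator N x" for x
    have [measurable]: "G \<in> borel_measurable borel" unfolding G_def by measurable
    have "F x \<le> G x" for x
    proof (cases "x \<in> N")
      case False
      then have "F x = g x" using N(1) by blast
      then show ?thesis using False by (simp add: G_def)
    qed (simp add: G_def)
    then have "(\<integral>\<^sup>+ x. F (A *v x) \<partial>lebesgue) \<le> (\<integral>\<^sup>+ x. G (A *v x) \<partial>lborel)"
      unfolding nn_integral_completion by (intro nn_integral_mono)
    also have "\<dots> = ennreal c * (\<integral>\<^sup>+ x. G x \<partial>lborel)" by (rule c) measurable
    also have "(\<integral>\<^sup>+ x. G x \<partial>lborel) = (\<integral>\<^sup>+ x. F x \<partial>lborel)"
      using ae AE_not_in[OF N(2)] by (intro nn_integral_cong_AE) (auto simp: G_def)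
    finally show "(\<integral>\<^sup>+ x. F (A *v x) \<partial>lebesgue) \<le> ennreal c * (\<integral>\<^sup>+ x. F x \<partial>lebesgue)"
      unfolding nn_integral_completion .
  qed (rule c)
qed

section \<open>Pointwise bounds for the product kernel\<close>

lemma finite_matrices_bounded:
  fixes S :: "(real ^ 'n::finite ^ 'n) set"
  assumes "finite S"
  shows "\<exists>K\<ge>1. \<forall>M\<in>S. \<forall>x. norm (M *v x) \<le> K * norm x"
  using assms
proof (induction S)
  case (insert M S)
  then obtain K where K: "K \<ge> 1" "\<And>M x. M \<in> S \<Longrightarrow> norm (M *v x) \<le> K * norm x" by blast
  obtain b where b: "b > 0" "\<And>x. norm (M *v x) \<le> b * norm x"
    using linear_bounded_pos[OF matrix_vector_mul_linear[of M]] by blast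
  show ?case
  proof (intro exI[of _ "K + b"] conjI ballI allI)
    show "1 \<le> K + b" using K b by simp
    fix M' x assume "M' \<in> insert M S"
    then have "norm (M' *v x) \<le> K * norm x \<or> norm (M' *v x) \<le> b * norm x" using K b by auto
    moreover have "K * norm x \<le> (K + b) * norm x" "b * norm x \<le> (K + b) * norm x"
      using K b by (auto intro!: mult_right_mono)
    ultimately show "norm (M' *v x) \<le> (K + b) * norm x" by linarith
  qed
qed (auto intro: exI[of _ 1])

text \<open>Let j minimise |x - A_j y|. For i different from j, (A_i - A_j) y is the difference of x
  - A_j y and x - A_i y, so invertibility bounds |y|, and then |x|, by a multiple of |x - A_i y|.
  With x' the preimage of x under A_j, the product is at most a constant times |x' - y|^(-a_j)
  d^(a_j - s), where d = max |x'| |y|. As |x' - y| \<le> 2 d, all of the decay in d except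
  d^(-\<delta>) can be traded for decay in |x' - y|.\<close>

lemma prod_powr_le:
  fixes A :: "nat \<Rightarrow> real ^ 'n::finite ^ 'n" and a :: "nat \<Rightarrow> real"
  assumes m: "m \<ge> 1" and a: "\<And>i. i \<in> {1..m} \<Longrightarrow> 0 \<le> a i" and sum: "(\<Sum>i = 1..m. a i) = s"
    and inv: "\<And>i. i \<in> {1..m} \<Longrightarrow> invertible (A i)"
    and inv2: "\<And>i j. i \<in> {1..m} \<Longrightarrow> j \<in> {1..m} \<Longrightarrow> i \<noteq> j \<Longrightarrow> invertible (A i - A j)"
    and \<delta>: "0 \<le> \<delta>" "\<And>i. i \<in> {1..m} \<Longrightarrow> \<delta> \<le> s - a i"
  shows "\<exists>C\<ge>0. \<forall>x y. (\<forall>i\<in>{1..m}. x \<noteq> A i *v y) \<longrightarrow>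
    (\<Prod>i = 1..m. norm (x - A i *v y) powr (- a i)) \<le> C * (\<Sum>i = 1..m.
       max (norm (matrix_inv (A i) *v x)) (norm y) powr (- \<delta>) * norm (matrix_inv (A i) *v x - y) powr (\<delta> - s))"
proof -
  let ?I = "{1..m}"
  let ?B = "\<lambda>i. matrix_inv (A i)"
  define S where "S = A ` ?I \<union> ?B ` ?I \<union> (\<lambda>(i, j). matrix_inv (A i - A j)) ` (?I \<times> ?I)"
  have "finite S" unfolding S_def by auto
  from finite_matrices_bounded[OF this]
  obtain K where K: "K \<ge> 1" and KS': "\<forall>M\<in>S. \<forall>x. norm (M *v x) \<le> K * norm x"
    by (elim exE conjE)
  have KS: "norm (M *v x) \<le> K * norm x" if "M \<in> S" for M x
    using KS' that by blast
  have in_S: "A i \<in> S" "?B i \<in> S" if "i \<in> ?I" for i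
    unfolding S_def using that by blast+
  have KA: "norm (A i *v x) \<le> K * norm x" and KB: "norm (?B i *v x) \<le> K * norm x" if "i \<in> ?I" for i x
    by (rule KS[OF in_S(1)[OF that]] KS[OF in_S(2)[OF that]])+
  have AB: "A i *v (?B i *v x) = x" if "i \<in> ?I" for i x
    by (rule matrix_inv_vector[OF inv[OF that]])
  have BA: "?B i *v (A i *v x) = x" if "i \<in> ?I" for i x
    by (rule matrix_inv_vector[OF inv[OF that]])
  have KD: "norm x \<le> K * norm ((A i - A j) *v x)" if "i \<in> ?I" "j \<in> ?I" "i \<noteq> j" for i j x
  proof -
    have eq: "matrix_inv (A i - A j) *v ((A i - A j) *v x) = x"
      by (rule matrix_inv_vector[OF inv2[OF that]])
    have "(\<lambda>(i, j). matrix_inv (A i - A j)) (i, j) \<in> S" unfolding S_def using that by blast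
    then have "matrix_inv (A i - A j) \<in> S" by simp
    from KS[OF this, of "(A i - A j) *v x"] show ?thesis unfolding eq .
  qed
  \<comment> \<open>Large enough for both parts of d: |y| \<le> 2 K u_i and |x'| \<le> K (1 + 2 K^2)
    u_i.\<close>
  define L where "L = K * (1 + 2 * K * K)"
  have L: "L \<ge> 2 * K" "L \<ge> 1"
  proof -
    have "1 \<le> K * K" using K mult_mono[of 1 K 1 K] by simp
    then have "K * 2 \<le> L" unfolding L_def using K by (intro mult_left_mono) auto
    then show "L \<ge> 2 * K" "L \<ge> 1" using K by linarith+
  qed
  have s: "s \<ge> 0" using a sum sum_nonneg[of ?I a] by simp
  have quot: "(b / c) powr (- r) = c powr r * b powr (- r)" if "b > 0" "c > 0" for b c r :: real
    using that by (simp add: powr_divide powr_minus_divide)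
  define C where "C = (K * L * 2) powr s"
  show ?thesis
  proof (intro exI[of _ C] conjI allI impI)
    show "C \<ge> 0" by (simp add: C_def)
    fix x y assume ne: "\<forall>i\<in>?I. x \<noteq> A i *v y"
    define u where "u i = norm (x - A i *v y)" for i
    have u: "u i > 0" if "i \<in> ?I" for i using ne that by (simp add: u_def)
    have "Min (u ` ?I) \<in> u ` ?I" using m by (intro Min_in) auto
    then obtain j where "j \<in> ?I" "u j = Min (u ` ?I)" by (metis imageE)
    then have j: "j \<in> ?I" "\<And>i. i \<in> ?I \<Longrightarrow> u j \<le> u i" by simp_all
    define x' where "x' = ?B j *v x"
    define h where "h = norm (x' - y)"
    define d where "d = max (norm x') (norm y)"
    have Ax': "A j *v x' = x" unfolding x'_def by (rule AB[OF j(1)])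
    have "x' \<noteq> y" using ne j(1) Ax' by auto
    then have h: "h > 0" by (simp add: h_def)
    have hd: "h \<le> 2 * d" using norm_triangle_ineq4[of x' y] by (auto simp: h_def d_def max_def)
    then have d: "d > 0" using h by linarith
    have hu: "h \<le> K * u j"
    proof -
      have "x' - y = ?B j *v (x - A j *v y)"
        using BA[OF j(1)] by (simp add: matrix_vector_mult_diff_distrib x'_def)
      then show ?thesis using KB[OF j(1), of "x - A j *v y"] by (simp add: h_def u_def)
    qed
    have du: "d \<le> L * u i" if i: "i \<in> ?I" "i \<noteq> j" for i
    proof -
      have "(A i - A j) *v y = (x - A j *v y) - (x - A i *v y)"
        by (simp add: matrix_vector_mult_diff_rdistrib)
      then have "norm ((A i - A j) *v y) \<le> u j + u i" unfolding u_def by (metis norm_triangle_ineq4)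
      also have "\<dots> \<le> 2 * u i" using j(2)[OF i(1)] by simp
      finally have "K * norm ((A i - A j) *v y) \<le> K * (2 * u i)" using K by (intro mult_left_mono) auto
      then have ny: "norm y \<le> K * (2 * u i)" using KD[OF i(1) j(1) i(2), of y] by (rule order_trans[rotated])
      have "norm x' \<le> L * u i"
      proof -
        have "norm x \<le> u i + norm (A i *v y)" unfolding u_def using norm_triangle_sub[of x "A i *v y"] by simp
        also have "norm (A i *v y) \<le> K * norm y" by (rule KA[OF i(1)])
        also have "K * norm y \<le> K * (K * (2 * u i))" using K ny by (intro mult_left_mono) auto
        finally have "norm x \<le> (1 + 2 * K * K) * u i" by (simp add: algebra_simps)
        then have "K * norm x \<le> K * ((1 + 2 * K * K) * u i)" using K by (intro mult_left_mono) auto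
        then show ?thesis using KB[OF j(1), of x] unfolding x'_def L_def by (simp add: mult.assoc)
      qed
      moreover have "K * (2 * u i) \<le> L * u i"
        using L(1) u[OF i(1)] mult_right_mono[of "2 * K" L "u i"] by (simp add: mult_ac)
      ultimately show ?thesis using ny by (simp add: d_def)
    qed
    define \<beta> where "\<beta> = s - a j"
    have "(\<Sum>i\<in>?I - {j}. a i) = s - a j"
      using j(1) sum by (subst sum_diff1) auto
    then have \<beta>: "\<beta> \<ge> \<delta>" "(\<Sum>i\<in>?I - {j}. - a i) = - \<beta>"
      using \<delta>(2)[OF j(1)] by (simp_all add: \<beta>_def sum_negf)
    have "(\<Prod>i\<in>?I. u i powr (- a i)) = u j powr (- a j) * (\<Prod>i\<in>?I - {j}. u i powr (- a i))"
      using j(1) by (subst prod.remove[of _ j]) auto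
    also have "\<dots> \<le> (h / K) powr (- a j) * (\<Prod>i\<in>?I - {j}. (d / L) powr (- a i))"
    proof (intro mult_mono prod_mono conjI prod_nonneg ballI)
      show "u j powr (- a j) \<le> (h / K) powr (- a j)"
        using hu h K a[OF j(1)] by (intro powr_mono2') (auto simp: pos_divide_le_eq mult.commute)
      show "u i powr (- a i) \<le> (d / L) powr (- a i)" if "i \<in> ?I - {j}" for i
        using du[of i] d L a[of i] that by (intro powr_mono2') (auto simp: pos_divide_le_eq mult.commute)
    qed auto
    also have "(\<Prod>i\<in>?I - {j}. (d / L) powr (- a i)) = (d / L) powr (- \<beta>)"
      unfolding \<beta>(2)[symmetric] using d L by (subst powr_sum) auto
    also have "(h / K) powr (- a j) * (d / L) powr (- \<beta>) = K powr a j * L powr \<beta> * (h powr (- a j) * (d powr (- \<delta>) * d powr (- (\<beta> - \<delta>))))"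
    proof -
      have "(h / K) powr (- a j) = K powr a j * h powr (- a j)" "(d / L) powr (- \<beta>) = L powr \<beta> * d powr (- \<beta>)"
        using h d K L by (auto intro!: quot)
      moreover have "d powr (- \<beta>) = d powr (- \<delta>) * d powr (- (\<beta> - \<delta>))" by (simp add: powr_add[symmetric])
      ultimately show ?thesis by (simp only: mult_ac)
    qed
    also have "\<dots> \<le> K powr s * L powr s * (h powr (- a j) * (d powr (- \<delta>) * (2 powr s * h powr (- (\<beta> - \<delta>)))))"
    proof (intro mult_mono)
      show "K powr a j \<le> K powr s" using K \<delta> \<beta> by (intro powr_mono) (auto simp: \<beta>_def)
      show "L powr \<beta> \<le> L powr s" using L a[OF j(1)] by (intro powr_mono) (auto simp: \<beta>_def)
      have "d powr (- (\<beta> - \<delta>)) \<le> (h / 2) powr (- (\<beta> - \<delta>))"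
        using hd h \<beta> by (intro powr_mono2') auto
      also have "\<dots> = 2 powr (\<beta> - \<delta>) * h powr (- (\<beta> - \<delta>))"
        using h by (intro quot) auto
      also have "\<dots> \<le> 2 powr s * h powr (- (\<beta> - \<delta>))"
        using \<delta>(1) a[OF j(1)] by (intro mult_right_mono powr_mono) (auto simp: \<beta>_def)
      finally show "d powr (- (\<beta> - \<delta>)) \<le> 2 powr s * h powr (- (\<beta> - \<delta>))" .
    qed auto
    also have "\<dots> = C * (d powr (- \<delta>) * (h powr (- a j) * h powr (- (\<beta> - \<delta>))))"
    proof -
      have "C = K powr s * L powr s * 2 powr s" using K L by (simp add: C_def powr_mult)
      then show ?thesis by (simp only: mult_ac)
    qed
    also have "h powr (- a j) * h powr (- (\<beta> - \<delta>)) = h powr (\<delta> - s)"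
      by (simp add: powr_add[symmetric] \<beta>_def)
    also have "C * (d powr (- \<delta>) * h powr (\<delta> - s)) \<le> C * (\<Sum>i = 1..m.
       max (norm (?B i *v x)) (norm y) powr (- \<delta>) * norm (?B i *v x - y) powr (\<delta> - s))"
      unfolding d_def h_def x'_def
      by (intro mult_left_mono member_le_sum[of j ?I "\<lambda>i. max (norm (?B i *v x)) (norm y) powr (- \<delta>) * norm (?B i *v x - y) powr (\<delta> - s)"] j(1))
        (auto simp: C_def)
    finally show "(\<Prod>i = 1..m. norm (x - A i *v y) powr (- a i)) \<le> C * (\<Sum>i = 1..m.
       max (norm (?B i *v x)) (norm y) powr (- \<delta>) * norm (?B i *v x - y) powr (\<delta> - s))"
      unfolding u_def .
  qed
qed

text \<open>Countably many dyadic annuli cover everything but the origin, so the exceptional sets of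
  the essential suprema unite to a null set.\<close>

lemma S_inf_bound:
  fixes k :: "real ^ 'n::finite \<Rightarrow> complex"
  assumes k: "k \<in> S_inf (real CARD('n) - a)" and a: "a \<ge> 0"
  shows "\<exists>C\<ge>0. AE z in lebesgue. norm (k z) \<le> C * norm z powr (- a)"
proof -
  obtain C where C: "C > 0" "\<And>t. t > 0 \<Longrightarrow> annulus_norm k t \<le> ennreal (C * t powr (- a))"
    using k by (auto simp: S_inf_def)
  have ann: "AE z in lebesgue. z \<in> annulus (2 powr e) \<longrightarrow> norm (k z) \<le> C * 2 powr (e * - a)" for e :: int
  proof -
    have [measurable]: "annulus (2 powr e) \<in> sets (lebesgue :: (real ^ 'n) measure)"
    proof -
      have "annulus (2 powr e) = cball 0 (2 * 2 powr e) - cball (0 :: real ^ 'n) (2 powr e)"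
        by (auto simp: annulus_def)
      then show ?thesis by simp
    qed
    have "AE z in restrict_space lebesgue (annulus (2 powr e)). ennreal (norm (k z)) \<le> annulus_norm k (2 powr e)"
      unfolding annulus_norm_def by (rule esssup_AE)
    then have "AE z in lebesgue. z \<in> annulus (2 powr e) \<longrightarrow> ennreal (norm (k z)) \<le> annulus_norm k (2 powr e)"
      by (subst (asm) AE_restrict_space_iff) auto
    then show ?thesis
    proof eventually_elim
      case (elim z)
      show ?case
      proof
        assume "z \<in> annulus (2 powr e)"
        then have "ennreal (norm (k z)) \<le> ennreal (C * (2 powr e) powr (- a))"
          using elim C(2)[of "2 powr e"] by (auto intro: order_trans)
        then show "norm (k z) \<le> C * 2 powr (e * - a)"
          using C(1) by (simp add: ennreal_le_iff powr_powr)
      qed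
    qed
  qed
  then have "AE z in lebesgue. \<forall>e::int. z \<in> annulus (2 powr e) \<longrightarrow> norm (k z) \<le> C * 2 powr (e * - a)"
    by (subst AE_all_countable) blast
  moreover have "AE z in lebesgue. 0 \<noteq> (z :: real ^ 'n)" by (rule AE_neq_lebesgue)
  ultimately have "AE z in lebesgue. norm (k z) \<le> C * 2 powr a * norm z powr (- a)"
  proof eventually_elim
    case (elim z)
    then have nz: "norm z > 0" by simp
    \<comment> \<open>Ceiling minus one rather than floor: the annulus excludes its inner radius and
      includes its outer one.\<close>
    define e where "e = \<lceil>log 2 (norm z)\<rceil> - 1"
    have "real_of_int e < log 2 (norm z)" "log 2 (norm z) \<le> e + 1" unfolding e_def by linarith+
    then have "2 powr e < 2 powr log 2 (norm z)" "2 powr log 2 (norm z) \<le> 2 powr (e + 1)"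
      by (intro powr_less_mono powr_mono; simp)+
    moreover have "2 powr log 2 (norm z) = norm z" using nz by simp
    moreover have "(2::real) powr (real_of_int e + 1) = 2 * 2 powr e" by (simp add: powr_add)
    ultimately have e: "2 powr e < norm z" "norm z \<le> 2 * 2 powr e" by simp_all
    then have "z \<in> annulus (2 powr e)" by (simp add: annulus_def)
    then have "norm (k z) \<le> C * 2 powr (e * - a)" using elim by blast
    also have "2 powr (e * - a) = 2 powr a * (2 * 2 powr e) powr (- a)"
      by (simp add: powr_mult powr_powr powr_minus field_simps)
    also have "C * (2 powr a * (2 * 2 powr e) powr (- a)) \<le> C * (2 powr a * norm z powr (- a))"
      using C e nz a by (intro mult_left_mono powr_mono2') auto
    finally show ?case by (simp add: mult.assoc)
  qed
  then show ?thesis using C by (intro exI[of _ "C * 2 powr a"]) auto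
qed

section \<open>Measurability and almost everywhere properties\<close>

lemma borel_measurable_lebesgue_AE:
  fixes g h :: "'a::euclidean_space \<Rightarrow> 'b::topological_space"
  assumes g: "g \<in> borel_measurable lebesgue" and ae: "AE x in lebesgue. h x = g x"
  shows "h \<in> borel_measurable lebesgue"
proof (rule measurableI)
  fix S :: "'b set" assume "S \<in> sets borel"
  then have "g -` S \<inter> space lebesgue \<in> sets lebesgue" using g by (rule measurable_sets[rotated])
  then show "h -` S \<inter> space lebesgue \<in> sets lebesgue"
    by (rule completion.in_sets_AE[rotated]) (use ae in auto)
qed simp

text \<open>Borel versions make f(y) and k(x - A y) jointly measurable in x and y, as is required
  for the measurability of integrals in y as functions of x.\<close>

lemma ex_borel_complex:
  fixes f :: "'a::euclidean_space \<Rightarrow> complex"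
  assumes [measurable]: "f \<in> borel_measurable lebesgue"
  shows "\<exists>g\<in>borel_measurable borel. AE x in lebesgue. f x = g x"
proof -
  have "(\<lambda>x. Re (f x)) \<in> borel_measurable lebesgue" "(\<lambda>x. Im (f x)) \<in> borel_measurable lebesgue" by measurable
  from this[THEN completion_ex_borel_measurable_real]
  obtain a b where ab: "a \<in> borel_measurable lborel" "b \<in> borel_measurable lborel"
    and ae: "AE x in lborel. Re (f x) = a x" "AE x in lborel. Im (f x) = b x" by blast
  from ae have "AE x in lborel. f x = Complex (a x) (b x)"
    by eventually_elim (simp add: complex_eq_iff)
  moreover have "(\<lambda>x. Complex (a x) (b x)) \<in> borel_measurable borel"
    using ab unfolding Complex_eq by simp
  ultimately show ?thesis by (intro bexI[of _ "\<lambda>x. Complex (a x) (b x)"] AE_completion)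
qed

lemma weight_AE_less_top:
  assumes "weight u" shows "AE x in lebesgue. u x < top"
proof -
  have [measurable]: "u \<in> borel_measurable lebesgue" using assms by (simp add: weight_def)
  have "AE x in lebesgue. x \<in> cball 0 (real k) \<longrightarrow> u x < top" for k
  proof -
    have [measurable]: "cball 0 (real k) \<in> sets lebesgue" by simp
    have "(\<integral>\<^sup>+ x \<in> cball 0 (real k). u x \<partial>lebesgue) \<noteq> \<infinity>"
      using assms by (auto simp: weight_def less_top)
    then have "AE x in lebesgue. u x * indicator (cball 0 (real k)) x \<noteq> \<infinity>"
      by (intro nn_integral_PInf_AE) measurable
    then show ?thesis by eventually_elim (auto simp: less_top)
  qed
  then have "AE x in lebesgue. \<forall>k. x \<in> cball 0 (real k) \<longrightarrow> u x < top"
    by (subst AE_all_countable) blast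
  then show ?thesis
  proof eventually_elim
    case (elim x)
    obtain k where "norm x \<le> real k" using real_arch_simple by blast
    then show ?case using elim by auto
  qed
qed

lemma invertible_matrix_inv:
  fixes A :: "real ^ 'n::finite ^ 'n"
  assumes "invertible A" shows "invertible (matrix_inv A)"
  using matrix_inv_mult[OF assms] unfolding invertible_def by blast

text \<open>The bound holds for every x, since the exceptional set of y is a finite union of
  preimages of null sets under y to x - A_i y and of points where x = A_i y.\<close>

lemma prod_kernel_bound:
  fixes A :: "nat \<Rightarrow> real ^ 'n::finite ^ 'n"
  assumes m: "m \<ge> 1" and a: "\<And>i. i \<in> {1..m} \<Longrightarrow> 0 \<le> a i" and sum: "(\<Sum>i = 1..m. a i) = real CARD('n) - \<alpha>"
    and inv: "\<And>i. i \<in> {1..m} \<Longrightarrow> invertible (A i)"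
    and inv2: "\<And>i j. i \<in> {1..m} \<Longrightarrow> j \<in> {1..m} \<Longrightarrow> i \<noteq> j \<Longrightarrow> invertible (A i - A j)"
    and k: "\<And>i. i \<in> {1..m} \<Longrightarrow> k i \<in> S_inf (real CARD('n) - a i)"
    and \<delta>: "0 \<le> \<delta>" "\<And>i. i \<in> {1..m} \<Longrightarrow> \<delta> \<le> real CARD('n) - \<alpha> - a i"
  shows "\<exists>C\<ge>0. \<forall>x. AE y in lebesgue.
    ennreal (norm (prod_kernel m A k x y)) \<le> ennreal C * (\<Sum>i = 1..m. hker \<alpha> \<delta> (matrix_inv (A i) *v x) y)"
proof -
  have "\<exists>C\<ge>0. \<forall>x y. (\<forall>i\<in>{1..m}. x \<noteq> A i *v y) \<longrightarrow>
    (\<Prod>i = 1..m. norm (x - A i *v y) powr (- a i)) \<le> C * (\<Sum>i = 1..m.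
       max (norm (matrix_inv (A i) *v x)) (norm y) powr (- \<delta>) * norm (matrix_inv (A i) *v x - y) powr (\<delta> - (real CARD('n) - \<alpha>)))"
    by (rule prod_powr_le[OF m]) (fact a sum inv inv2 \<delta>)+
  then obtain C where C: "C \<ge> 0" "\<forall>x y. (\<forall>i\<in>{1..m}. x \<noteq> A i *v y) \<longrightarrow>
    (\<Prod>i = 1..m. norm (x - A i *v y) powr (- a i)) \<le> C * (\<Sum>i = 1..m.
       max (norm (matrix_inv (A i) *v x)) (norm y) powr (- \<delta>) * norm (matrix_inv (A i) *v x - y) powr (\<delta> - (real CARD('n) - \<alpha>)))"
    by (elim exE conjE)
  have "\<forall>i\<in>{1..m}. \<exists>c. c \<ge> 0 \<and> (AE z in lebesgue. norm (k i z) \<le> c * norm z powr (- a i))"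
    by (intro ballI S_inf_bound[OF k a])
  from bchoice[OF this]
  obtain c where c': "\<forall>i\<in>{1..m}. c i \<ge> 0 \<and> (AE z in lebesgue. norm (k i z) \<le> c i * norm z powr (- a i))"
    by (elim exE)
  have c: "c i \<ge> 0" "AE z in lebesgue. norm (k i z) \<le> c i * norm z powr (- a i)" if "i \<in> {1..m}" for i
    using bspec[OF c' that] by (rule conjunct1, rule conjunct2)
  show ?thesis
  proof (intro exI[of _ "(\<Prod>i = 1..m. c i) * C"] conjI allI)
    show c0: "0 \<le> (\<Prod>i = 1..m. c i) * C"
      by (rule mult_nonneg_nonneg[OF prod_nonneg C(1)]) (rule c(1))
    fix x
    have "AE y in lebesgue. \<forall>i\<in>{1..m}. norm (k i (x - A i *v y)) \<le> c i * norm (x - A i *v y) powr (- a i)"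
      by (subst AE_finite_all) (simp, intro ballI AE_lebesgue_affine[OF inv c(2)])
    moreover have "AE y in lebesgue. \<forall>i\<in>{1..m}. matrix_inv (A i) *v x \<noteq> y"
      by (subst AE_finite_all) (simp, intro ballI AE_neq_lebesgue)
    ultimately show "AE y in lebesgue. ennreal (norm (prod_kernel m A k x y))
      \<le> ennreal ((\<Prod>i = 1..m. c i) * C) * (\<Sum>i = 1..m. hker \<alpha> \<delta> (matrix_inv (A i) *v x) y)"
    proof eventually_elim
      case (elim y)
      have ne: "\<forall>i\<in>{1..m}. x \<noteq> A i *v y"
      proof
        fix i assume i: "i \<in> {1..m}"
        then have "matrix_inv (A i) *v (A i *v y) = y" by (intro matrix_inv_vector inv)
        then show "x \<noteq> A i *v y" using elim(2) i by blast
      qed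
      have "norm (prod_kernel m A k x y) = (\<Prod>i = 1..m. norm (k i (x - A i *v y)))"
        by (simp add: prod_kernel_def prod_norm)
      also have "\<dots> \<le> (\<Prod>i = 1..m. c i * norm (x - A i *v y) powr (- a i))"
        using elim(1) by (intro prod_mono) auto
      also have "\<dots> = (\<Prod>i = 1..m. c i) * (\<Prod>i = 1..m. norm (x - A i *v y) powr (- a i))"
        by (rule prod.distrib)
      also have "\<dots> \<le> (\<Prod>i = 1..m. c i) * (C * (\<Sum>i = 1..m.
         max (norm (matrix_inv (A i) *v x)) (norm y) powr (- \<delta>) * norm (matrix_inv (A i) *v x - y) powr (\<delta> - (real CARD('n) - \<alpha>))))"
        using C(2) ne by (intro mult_left_mono prod_nonneg c(1)) simp_all
      finally have "ennreal (norm (prod_kernel m A k x y)) \<le> ennreal (((\<Prod>i = 1..m. c i) * C) * (\<Sum>i = 1..m.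
         max (norm (matrix_inv (A i) *v x)) (norm y) powr (- \<delta>) * norm (matrix_inv (A i) *v x - y) powr (\<delta> - (real CARD('n) - \<alpha>))))"
        by (intro ennreal_leI) (simp only: mult.assoc)
      also have "\<dots> = ennreal ((\<Prod>i = 1..m. c i) * C) * (\<Sum>i = 1..m. hker \<alpha> \<delta> (matrix_inv (A i) *v x) y)"
      proof -
        have e: "\<delta> - (real CARD('n) - \<alpha>) = \<alpha> + \<delta> - real CARD('n)" by simp
        show ?thesis unfolding hker_def e by (subst ennreal_mult'[OF c0]) (simp add: sum_ennreal)
      qed
      finally show ?case .
    qed
  qed
qed

section \<open>Weighted norm inequality for the operator\<close>

lemma measurable_hker [measurable]:
  "(\<lambda>(x, y). hker \<alpha> \<delta> x y) \<in> borel_measurable (borel \<Otimes>\<^sub>M borel)"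
  unfolding hker_def by measurable

text \<open>With \<nu> = w^(-p'), write |f| = f0 \<nu> for f0 = |f| w^p'. Since p' p - p' = p, the
  integral of f0^p \<nu> is that of |f|^p w^p; cancelling the powers requires 0 < w < \<infinity>
  almost everywhere.\<close>

lemma hker_weighted_bound:
  fixes w :: "real ^ 'n::finite \<Rightarrow> ennreal" and \<mu> :: "real ^ 'n \<Rightarrow> ennreal" and f :: "real ^ 'n \<Rightarrow> complex"
  assumes p: "p > 1" and w [measurable]: "w \<in> borel_measurable lebesgue"
    and pos: "AE x in lebesgue. 0 < w x" and fin: "AE x in lebesgue. w x < top"
    and D: "\<And>f. f \<in> borel_measurable lebesgue \<Longrightarrow>
      (\<integral>\<^sup>+ x. epowr (\<integral>\<^sup>+ y. hker \<alpha> \<delta> x y * (f y * epowr (w y) (- conj_exp p)) \<partial>lebesgue) q * \<mu> x \<partial>lebesgue)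
      \<le> ennreal D * epowr (\<integral>\<^sup>+ x. epowr (f x) p * epowr (w x) (- conj_exp p) \<partial>lebesgue) (q / p)"
    and f [measurable]: "f \<in> borel_measurable lebesgue"
  shows "(\<integral>\<^sup>+ x. epowr (\<integral>\<^sup>+ y. hker \<alpha> \<delta> x y * ennreal (norm (f y)) \<partial>lebesgue) q * \<mu> x \<partial>lebesgue)
      \<le> ennreal D * epowr (\<integral>\<^sup>+ x. ennreal (norm (f x) powr p) * epowr (w x) p \<partial>lebesgue) (q / p)"
proof -
  define p' where "p' = conj_exp p"
  have pp: "dual_exp p p'" unfolding p'_def by (rule dual_exp_conj[OF p])
  define f0 where "f0 y = ennreal (norm (f y)) * epowr (w y) p'" for y
  have [measurable]: "f0 \<in> borel_measurable lebesgue" unfolding f0_def by measurable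
  have ae: "AE y in lebesgue. f0 y * epowr (w y) (- p') = ennreal (norm (f y)) \<and>
     epowr (f0 y) p * epowr (w y) (- p') = ennreal (norm (f y) powr p) * epowr (w y) p"
    using pos fin
  proof eventually_elim
    case (elim y)
    have "f0 y * epowr (w y) (- p') = ennreal (norm (f y)) * epowr (w y) (p' + - p')"
      unfolding f0_def epowr_add_pos[OF elim] by (rule mult.assoc)
    moreover have "epowr (f0 y) p * epowr (w y) (- p') = epowr (ennreal (norm (f y))) p * (epowr (w y) (p' * p) * epowr (w y) (- p'))"
      using p elim unfolding f0_def by (simp add: epowr_mult epowr_epowr_pos mult.assoc)
    moreover have "epowr (w y) (p' * p) * epowr (w y) (- p') = epowr (w y) p"
    proof -
      have "p' * p + - p' = p" using dual_expD[OF pp] by (simp add: algebra_simps)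
      then show ?thesis by (simp add: epowr_add_pos[OF elim, symmetric])
    qed
    ultimately show ?case using p by (simp add: epowr_0_right epowr_ennreal)
  qed
  have "(\<integral>\<^sup>+ y. hker \<alpha> \<delta> x y * (f0 y * epowr (w y) (- p')) \<partial>lebesgue) = (\<integral>\<^sup>+ y. hker \<alpha> \<delta> x y * ennreal (norm (f y)) \<partial>lebesgue)" for x
    by (rule nn_integral_cong_AE, use ae in eventually_elim) simp
  moreover have "(\<integral>\<^sup>+ x. epowr (f0 x) p * epowr (w x) (- p') \<partial>lebesgue) = (\<integral>\<^sup>+ x. ennreal (norm (f x) powr p) * epowr (w x) p \<partial>lebesgue)"
    by (rule nn_integral_cong_AE, use ae in eventually_elim) simp
  ultimately show ?thesis using D[of f0] by (simp add: p'_def)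
qed

theorem corollary2p5:
  fixes \<alpha> p q :: real and m :: nat
    and \<alpha>s :: "nat \<Rightarrow> real"
    and A :: "nat \<Rightarrow> real ^ 'n ^ 'n"
    and k :: "nat \<Rightarrow> real ^ 'n \<Rightarrow> complex"
    and w :: "real ^ 'n \<Rightarrow> ennreal"
  assumes "0 \<le> \<alpha>" and "\<alpha> < real CARD('n)"
    and "m \<ge> 1"
    and "\<And>i. i \<in> {1..m} \<Longrightarrow> 0 \<le> \<alpha>s i \<and> \<alpha>s i < real CARD('n)"
    and "(\<Sum>i = 1..m. \<alpha>s i) = real CARD('n) - \<alpha>"
    and "\<And>i. i \<in> {1..m} \<Longrightarrow> invertible (A i)"
    and "\<And>i j. i \<in> {1..m} \<Longrightarrow> j \<in> {1..m} \<Longrightarrow> i \<noteq> j \<Longrightarrow> invertible (A i - A j)"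
    and "\<And>i. i \<in> {1..m} \<Longrightarrow>
           k i \<in> S_inf (real CARD('n) - \<alpha>s i) \<inter> H_inf (real CARD('n) - \<alpha>s i)"
    and "\<alpha> = 0 \<Longrightarrow>
           \<exists>p0>1. int_op_bounded (prod_kernel m A k) p0 (\<lambda>_. 1) p0 (\<lambda>_. 1)"
    and "1 < p" and "\<alpha> = 0 \<or> p < real CARD('n) / \<alpha>"
    and "1 / q = 1 / p - \<alpha> / real CARD('n)"
    and "weight w"
    and "\<And>i. i \<in> {1..m} \<Longrightarrow> w \<in> M_class \<alpha> (A i) p q \<inter> M_class_dual \<alpha> (A i) p q"
  shows "int_op_bounded (prod_kernel m A k)
           p (\<lambda>x. epowr (w x) p) q (\<lambda>x. epowr (w x) q)"
proof -
  let ?n = "real CARD('n)"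
  let ?I = "{1..m}"
  let ?B = "\<lambda>i. matrix_inv (A i)"
  let ?K = "prod_kernel m A k"
  have n: "?n > 0" by simp
  have p1: "1 < p" by fact
  have "\<alpha> / ?n < 1 / p"
  proof (cases "\<alpha> = 0")
    case False
    then have "p < ?n / \<alpha>" "\<alpha> > 0" using assms by auto
    then show ?thesis using p1 n by (simp add: field_simps)
  qed (use p1 in simp)
  then have "1 / q > 0" using assms(12) by simp
  then have q0: "q > 0" by simp
  have "1 / q \<le> 1 / p" using assms(1,12) n by simp
  then have pq: "p \<le> q" using p1 q0 by (simp add: field_simps)
  have q1: "1 < q" using p1 pq by simp
  have pq_less: "p < q" if "\<alpha> \<noteq> 0"
  proof -
    have "\<alpha> / ?n > 0" using that assms(1) n by simp
    then have "1 / q < 1 / p" using assms(12) by simp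
    then show ?thesis using p1 q0 by (simp add: field_simps)
  qed
  have dp: "dual_exp p (conj_exp p)" and dq: "dual_exp q (conj_exp q)"
    by (rule dual_exp_conj[OF p1] dual_exp_conj[OF q1])+
  define \<nu> where "\<nu> x = epowr (w x) (- conj_exp p)" for x
  define \<mu> where "\<mu> i x = epowr (w (A i *v x)) q" for i x
  have cls: "weight (\<mu> i) \<and> weight \<nu> \<and> testing_const \<alpha> p q (\<mu> i) \<nu> < top \<and> testing_const \<alpha> (conj_exp q) (conj_exp p) \<nu> (\<mu> i) < top"
    if "i \<in> ?I" for i
    using assms(14)[OF that] unfolding M_class_def M_class_dual_def testing_class_def \<nu>_def[abs_def] \<mu>_def[abs_def] by blast
  have w [measurable]: "w \<in> borel_measurable lebesgue" using assms(13) by (simp add: weight_def)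
  have \<nu>: "weight \<nu>" using cls[of 1] assms(3) by simp
  have fin: "AE x in lebesgue. w x < top" by (rule weight_AE_less_top[OF assms(13)])
  \<comment> \<open>A negative power of 0 is \<infinity>, so local integrability of w^(-p') forbids
    w = 0 on a set of positive measure.\<close>
  have pos: "AE x in lebesgue. 0 < w x"
    using weight_AE_less_top[OF \<nu>]
  proof eventually_elim
    case (elim x)
    have "conj_exp p > 1" using dual_expD[OF dp] by simp
    then have "w x \<noteq> 0" using elim by (auto simp: \<nu>_def epowr_def)
    then show ?case by (simp add: zero_less_iff_neq_zero)
  qed
  \<comment> \<open>For \<alpha> = 0 this is the largest exponent with \<delta> \<le> n -
    \<alpha>s(i) for all i, and it is positive because every \<alpha>s(i) < n.\<close>
  define \<delta> where "\<delta> = (if \<alpha> = 0 then Min ((\<lambda>i. ?n - \<alpha>s i) ` ?I) else 0)"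
  have ne: "(\<lambda>i. ?n - \<alpha>s i) ` ?I \<noteq> {}" using assms(3) by auto
  have \<delta>0: "0 \<le> \<delta>" and \<delta>pos: "\<alpha> = 0 \<Longrightarrow> 0 < \<delta>"
    using assms(4) ne by (auto simp: \<delta>_def less_imp_le)
  have \<delta>_le: "\<delta> \<le> ?n - \<alpha> - \<alpha>s i" if "i \<in> ?I" for i
  proof (cases "\<alpha> = 0")
    case True
    then show ?thesis using that by (auto simp: \<delta>_def intro!: Min_le)
  next
    case False
    have "\<alpha>s i \<le> (\<Sum>i = 1..m. \<alpha>s i)" using assms(4) that by (intro member_le_sum) auto
    then show ?thesis using False assms(5) by (simp add: \<delta>_def)
  qed
  have \<delta>n: "\<delta> \<le> ?n" using \<delta>_le[of 1] assms(1,3) assms(4)[of 1] by simp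
  have cases: "(\<delta> = 0 \<and> p < q) \<or> (\<alpha> = 0 \<and> 0 < \<delta> \<and> \<delta> \<le> ?n)"
    using pq_less \<delta>pos \<delta>n by (cases "\<alpha> = 0") (auto simp: \<delta>_def)

  have "\<forall>i\<in>?I. \<exists>D. D \<ge> 0 \<and> (\<forall>f \<in> borel_measurable lebesgue.
    (\<integral>\<^sup>+ x. epowr (\<integral>\<^sup>+ y. hker \<alpha> \<delta> x y * (f y * \<nu> y) \<partial>lebesgue) q * \<mu> i x \<partial>lebesgue)
      \<le> ennreal D * epowr (\<integral>\<^sup>+ x. epowr (f x) p * \<nu> x \<partial>lebesgue) (q / p))"
  proof
    fix i assume "i \<in> ?I"
    then show "\<exists>D. D \<ge> 0 \<and> (\<forall>f \<in> borel_measurable lebesgue.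
    (\<integral>\<^sup>+ x. epowr (\<integral>\<^sup>+ y. hker \<alpha> \<delta> x y * (f y * \<nu> y) \<partial>lebesgue) q * \<mu> i x \<partial>lebesgue)
      \<le> ennreal D * epowr (\<integral>\<^sup>+ x. epowr (f x) p * \<nu> x \<partial>lebesgue) (q / p))"
      using cls[of i] by (intro hker_two_weight[OF \<nu> _ dp dq pq _ _ assms(2) cases]) auto
  qed
  from bchoice[OF this] obtain D where D: "\<forall>i\<in>?I. D i \<ge> 0 \<and> (\<forall>f \<in> borel_measurable lebesgue.
    (\<integral>\<^sup>+ x. epowr (\<integral>\<^sup>+ y. hker \<alpha> \<delta> x y * (f y * \<nu> y) \<partial>lebesgue) q * \<mu> i x \<partial>lebesgue)
      \<le> ennreal (D i) * epowr (\<integral>\<^sup>+ x. epowr (f x) p * \<nu> x \<partial>lebesgue) (q / p))"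
    by (elim exE)
  have "\<forall>i\<in>?I. \<exists>c. c \<ge> 0 \<and> (\<forall>F \<in> borel_measurable lebesgue. (\<integral>\<^sup>+ x. F (?B i *v x) \<partial>lebesgue) \<le> ennreal c * (\<integral>\<^sup>+ x. F x \<partial>lebesgue))"
    using assms(6) by (intro ballI nn_integral_lebesgue_matrix_le invertible_matrix_inv)
  from bchoice[OF this] obtain c where c: "\<forall>i\<in>?I. c i \<ge> 0 \<and> (\<forall>F \<in> borel_measurable lebesgue.
      (\<integral>\<^sup>+ x. F (?B i *v x) \<partial>lebesgue) \<le> ennreal (c i) * (\<integral>\<^sup>+ x. F x \<partial>lebesgue))"
    by (elim exE)
  have "\<exists>C\<ge>0. \<forall>x. AE y in lebesgue. ennreal (norm (?K x y)) \<le> ennreal C * (\<Sum>i = 1..m. hker \<alpha> \<delta> (?B i *v x) y)"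
  proof (rule prod_kernel_bound[OF assms(3) _ assms(5)])
    show "0 \<le> \<alpha>s i" "k i \<in> S_inf (?n - \<alpha>s i)" if "i \<in> ?I" for i
      using assms(4,8)[OF that] by blast+
  qed (fact assms(6,7) \<delta>0 \<delta>_le)+
  then obtain C where C: "C \<ge> 0" and K_le': "\<forall>x. AE y in lebesgue. ennreal (norm (?K x y)) \<le> ennreal C * (\<Sum>i = 1..m. hker \<alpha> \<delta> (?B i *v x) y)"
    by (elim exE conjE)
  note K_le = spec[OF K_le']

  \<comment> \<open>Borel versions of the kernels: the operator is unchanged at every x, because for
    each x the two product kernels agree for almost every y.\<close>
  have "\<forall>i\<in>?I. \<exists>g. g \<in> borel_measurable borel \<and> (AE x in lebesgue. k i x = g x)"
  proof
    fix i assume "i \<in> ?I"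
    then have "k i \<in> borel_measurable lebesgue" using assms(8)[of i] by (simp add: S_inf_def)
    from ex_borel_complex[OF this]
    show "\<exists>g. g \<in> borel_measurable borel \<and> (AE x in lebesgue. k i x = g x)"
      by (simp only: Bex_def)
  qed
  from bchoice[OF this] obtain kb where kb: "\<forall>i\<in>?I. kb i \<in> borel_measurable borel \<and> (AE x in lebesgue. k i x = kb i x)"
    by (elim exE)
  have [measurable]: "i \<in> ?I \<Longrightarrow> kb i \<in> borel_measurable borel" for i using kb by blast
  have K_eq: "AE y in lebesgue. ?K x y = prod_kernel m A kb x y" for x
  proof -
    have "AE y in lebesgue. \<forall>i\<in>?I. k i (x - A i *v y) = kb i (x - A i *v y)"
    proof (subst AE_finite_all, simp, rule ballI)
      fix i assume i: "i \<in> ?I"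
      show "AE y in lebesgue. k i (x - A i *v y) = kb i (x - A i *v y)"
        by (rule AE_lebesgue_affine[OF assms(6)[OF i] conjunct2[OF bspec[OF kb i]]])
    qed
    then show ?thesis by eventually_elim (simp add: prod_kernel_def)
  qed
  have [measurable]: "(\<lambda>(x, y). prod_kernel m A kb x y) \<in> borel_measurable (borel \<Otimes>\<^sub>M borel)"
    unfolding prod_kernel_def by measurable

  define E where "E = C powr q * (real m powr q * (\<Sum>i = 1..m. c i * D i))"
  have E: "E \<ge> 0" unfolding E_def using c D by (intro mult_nonneg_nonneg sum_nonneg) auto
  have "(AE x in lebesgue. integrable lebesgue (\<lambda>y. ?K x y * f y)) \<and> int_op ?K f \<in> wLp q (\<lambda>x. epowr (w x) q) \<and>
      wLp_norm q (\<lambda>x. epowr (w x) q) (int_op ?K f) \<le> ennreal (E powr (1 / q)) * wLp_norm p (\<lambda>x. epowr (w x) p) f"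
    if f_in: "f \<in> wLp p (\<lambda>x. epowr (w x) p)" for f
  proof -
    have f [measurable]: "f \<in> borel_measurable lebesgue" using f_in by (simp add: wLp_def)
    define X where "X = (\<integral>\<^sup>+ x. ennreal (norm (f x) powr p) * epowr (w x) p \<partial>lebesgue)"
    have X_norm: "wLp_norm p (\<lambda>x. epowr (w x) p) f = epowr X (1 / p)" by (simp add: wLp_norm_def X_def)
    have "epowr X (1 / p) \<noteq> top" using f_in X_norm by (auto simp: wLp_def)
    then have X: "X < top" using p1 by (simp add: epowr_eq_top_iff less_top)
    obtain fb where fb [measurable]: "fb \<in> borel_measurable borel" and f_eq: "AE x in lebesgue. f x = fb x"
      using ex_borel_complex[OF f] by blast
    \<comment> \<open>Defined with the Borel version of f and Borel measure, so that it is
      measurable in x; it equals the integral with f itself.\<close>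
    define G where "G i x = (\<integral>\<^sup>+ y. hker \<alpha> \<delta> (?B i *v x) y * ennreal (norm (fb y)) \<partial>lborel)" for i x
    have [measurable]: "G i \<in> borel_measurable borel" for i
      unfolding G_def by measurable
    have [measurable]: "G i \<in> borel_measurable lebesgue" for i by (intro measurable_completion) simp
    define J where "J x = ennreal C * (\<Sum>i = 1..m. G i x)" for x
    have [measurable]: "J \<in> borel_measurable lebesgue" unfolding J_def by measurable
    have J_ge: "(\<integral>\<^sup>+ y. ennreal (norm (?K x y * f y)) \<partial>lebesgue) \<le> J x" for x
    proof -
      have "(\<integral>\<^sup>+ y. ennreal (norm (?K x y * f y)) \<partial>lebesgue)
         \<le> (\<integral>\<^sup>+ y. ennreal C * (\<Sum>i = 1..m. hker \<alpha> \<delta> (?B i *v x) y * ennreal (norm (fb y))) \<partial>lebesgue)"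
      proof (rule nn_integral_mono_AE)
        show "AE y in lebesgue. ennreal (norm (?K x y * f y)) \<le> ennreal C * (\<Sum>i = 1..m. hker \<alpha> \<delta> (?B i *v x) y * ennreal (norm (fb y)))"
          using K_le[of x] f_eq
        proof eventually_elim
          case (elim y)
          have "ennreal (norm (?K x y * f y)) = ennreal (norm (?K x y)) * ennreal (norm (fb y))"
            using elim(2) by (simp add: norm_mult ennreal_mult)
          also have "\<dots> \<le> (ennreal C * (\<Sum>i = 1..m. hker \<alpha> \<delta> (?B i *v x) y)) * ennreal (norm (fb y))"
            using elim(1) by (rule mult_right_mono) simp
          finally show ?case by (simp only: mult.assoc sum_distrib_right)
        qed
      qed
      also have "\<dots> = J x"
        unfolding J_def G_def nn_integral_completion by (simp add: nn_integral_cmult nn_integral_sum)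
      finally show ?thesis .
    qed
    have Gi: "(\<integral>\<^sup>+ x. epowr (G i x) q * epowr (w x) q \<partial>lebesgue) \<le> ennreal (c i * D i) * epowr X (q / p)" if i: "i \<in> ?I" for i
    proof -
      have A_inv: "A i *v (?B i *v x) = x" for x by (rule matrix_inv_vector[OF assms(6)[OF i]])
      define H where "H x = epowr (\<integral>\<^sup>+ y. hker \<alpha> \<delta> x y * ennreal (norm (f y)) \<partial>lebesgue) q * \<mu> i x" for x
      have Hb: "(\<integral>\<^sup>+ y. hker \<alpha> \<delta> x y * ennreal (norm (f y)) \<partial>lebesgue) = (\<integral>\<^sup>+ y. hker \<alpha> \<delta> x y * ennreal (norm (fb y)) \<partial>lborel)" for x
      proof -
        have "(\<integral>\<^sup>+ y. hker \<alpha> \<delta> x y * ennreal (norm (f y)) \<partial>lebesgue) = (\<integral>\<^sup>+ y. hker \<alpha> \<delta> x y * ennreal (norm (fb y)) \<partial>lebesgue)"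
          by (rule nn_integral_cong_AE, use f_eq in eventually_elim) simp
        then show ?thesis by (simp only: nn_integral_completion)
      qed
      have [measurable]: "(\<lambda>x. \<integral>\<^sup>+ y. hker \<alpha> \<delta> x y * ennreal (norm (fb y)) \<partial>lborel) \<in> borel_measurable lebesgue"
        by (intro measurable_completion) measurable
      have [measurable]: "\<mu> i \<in> borel_measurable lebesgue" using cls[OF i] by (simp add: weight_def)
      have H_meas: "H \<in> borel_measurable lebesgue" unfolding H_def Hb by measurable
      \<comment> \<open>With H evaluated at the preimage of x under A_i, the weight \<mu>(i) becomes
        w(x)^q: this is why the classes contain w composed with A_i.\<close>
      have "(\<integral>\<^sup>+ x. epowr (G i x) q * epowr (w x) q \<partial>lebesgue) = (\<integral>\<^sup>+ x. H (?B i *v x) \<partial>lebesgue)"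
        unfolding H_def Hb G_def \<mu>_def A_inv ..
      also have "\<dots> \<le> ennreal (c i) * (\<integral>\<^sup>+ x. H x \<partial>lebesgue)"
        using bspec[OF conjunct2[OF bspec[OF c i]] H_meas] .
      also have "(\<integral>\<^sup>+ x. H x \<partial>lebesgue) \<le> ennreal (D i) * epowr X (q / p)"
        unfolding H_def X_def
      proof (rule hker_weighted_bound[OF p1 w pos fin _ f])
        fix g :: "real ^ 'n \<Rightarrow> ennreal" assume "g \<in> borel_measurable lebesgue"
        then show "(\<integral>\<^sup>+ x. epowr (\<integral>\<^sup>+ y. hker \<alpha> \<delta> x y * (g y * epowr (w y) (- conj_exp p)) \<partial>lebesgue) q * \<mu> i x \<partial>lebesgue)
           \<le> ennreal (D i) * epowr (\<integral>\<^sup>+ x. epowr (g x) p * epowr (w x) (- conj_exp p) \<partial>lebesgue) (q / p)"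
          using bspec[OF conjunct2[OF bspec[OF D i]], of g] unfolding \<nu>_def by simp
      qed
      finally show ?thesis using c D i by (simp add: ennreal_mult mult.assoc mult_left_mono)
    qed
    have J_int: "(\<integral>\<^sup>+ x. epowr (J x) q * epowr (w x) q \<partial>lebesgue) \<le> ennreal E * epowr X (q / p)"
    proof -
      have "(\<integral>\<^sup>+ x. epowr (J x) q * epowr (w x) q \<partial>lebesgue)
        \<le> (\<integral>\<^sup>+ x. ennreal (C powr q * real m powr q) * (\<Sum>i = 1..m. epowr (G i x) q * epowr (w x) q) \<partial>lebesgue)"
      proof (rule nn_integral_mono)
        fix x
        have "epowr (J x) q = ennreal (C powr q) * epowr (\<Sum>i = 1..m. G i x) q"
          unfolding J_def using q0 C by (simp add: epowr_mult epowr_ennreal)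
        also have "\<dots> \<le> ennreal (C powr q) * (ennreal (real (card ?I) powr q) * (\<Sum>i = 1..m. epowr (G i x) q))"
          using q0 by (intro mult_left_mono epowr_sum_le) auto
        finally have "epowr (J x) q \<le> ennreal (C powr q * real m powr q) * (\<Sum>i = 1..m. epowr (G i x) q)"
          by (simp add: ennreal_mult mult.assoc)
        then have "epowr (J x) q * epowr (w x) q \<le> (ennreal (C powr q * real m powr q) * (\<Sum>i = 1..m. epowr (G i x) q)) * epowr (w x) q"
          by (rule mult_right_mono) simp
        then show "epowr (J x) q * epowr (w x) q \<le> ennreal (C powr q * real m powr q) * (\<Sum>i = 1..m. epowr (G i x) q * epowr (w x) q)"
          by (simp only: mult.assoc sum_distrib_right)
      qed
      also have "\<dots> = ennreal (C powr q * real m powr q) * (\<Sum>i = 1..m. \<integral>\<^sup>+ x. epowr (G i x) q * epowr (w x) q \<partial>lebesgue)"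
        by (simp add: nn_integral_cmult nn_integral_sum)
      also have "\<dots> \<le> ennreal (C powr q * real m powr q) * (\<Sum>i = 1..m. ennreal (c i * D i) * epowr X (q / p))"
        by (intro mult_left_mono sum_mono Gi) auto
      also have "\<dots> = ennreal (C powr q * real m powr q) * (ennreal (\<Sum>i = 1..m. c i * D i) * epowr X (q / p))"
      proof -
        have "(\<Sum>i = 1..m. ennreal (c i * D i)) = ennreal (\<Sum>i = 1..m. c i * D i)"
          using c D by (intro sum_ennreal mult_nonneg_nonneg) auto
        then show ?thesis by (simp only: sum_distrib_right[symmetric])
      qed
      also have "\<dots> = ennreal E * epowr X (q / p)"
      proof -
        have "0 \<le> (\<Sum>i = 1..m. c i * D i)" using c D by (intro sum_nonneg mult_nonneg_nonneg) auto
        then show ?thesis by (simp add: E_def ennreal_mult mult.assoc)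
      qed
      finally show ?thesis .
    qed
    have EX: "ennreal E * epowr X (q / p) < top"
      using X p1 q0 epowr_less_top[of "q / p" X] by (simp add: ennreal_mult_less_top)
    \<comment> \<open>J dominates the integral of the absolute value, and J^q w^q has finite
      integral; so J is finite almost everywhere, because w > 0 almost everywhere.\<close>
    have ints: "AE x in lebesgue. integrable lebesgue (\<lambda>y. ?K x y * f y)"
    proof -
      have "AE x in lebesgue. epowr (J x) q * epowr (w x) q \<noteq> \<infinity>"
        using J_int EX by (intro nn_integral_PInf_AE) (auto simp: top_unique less_top)
      then show ?thesis using pos
      proof eventually_elim
        case (elim x)
        have "epowr (w x) q \<noteq> 0" using elim(2) q0 by (simp add: epowr_eq_0_iff)
        then have "epowr (J x) q \<noteq> top" using elim(1) by (auto simp: ennreal_top_mult)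
        then have "J x < top" using q0 by (simp add: epowr_eq_top_iff less_top)
        then have fin_int: "(\<integral>\<^sup>+ y. ennreal (norm (?K x y * f y)) \<partial>lebesgue) < \<infinity>"
          using J_ge[of x] by simp
        have "(\<lambda>y. prod_kernel m A kb x y * fb y) \<in> borel_measurable lebesgue"
          by (intro measurable_completion) measurable
        then have "(\<lambda>y. ?K x y * f y) \<in> borel_measurable lebesgue"
          by (rule borel_measurable_lebesgue_AE) (use K_eq[of x] f_eq in eventually_elim, simp)
        then show ?case using fin_int by (rule integrableI_bounded)
      qed
    qed
    have T_eq: "int_op ?K f x = (LINT y|lborel. prod_kernel m A kb x y * fb y)" for x
    proof -
      have meas: "(\<lambda>y. prod_kernel m A kb x y * fb y) \<in> borel_measurable lborel" by measurable
      then have "(\<lambda>y. prod_kernel m A kb x y * fb y) \<in> borel_measurable lebesgue" by (rule measurable_completion)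
      moreover have ae: "AE y in lebesgue. ?K x y * f y = prod_kernel m A kb x y * fb y"
        using K_eq[of x] f_eq by eventually_elim simp
      ultimately have "int_op ?K f x = (LINT y|lebesgue. prod_kernel m A kb x y * fb y)"
        unfolding int_op_def by (intro integral_cong_AE borel_measurable_lebesgue_AE[OF _ ae])
      then show ?thesis by (simp only: integral_completion[OF meas])
    qed
    have T_meas: "int_op ?K f \<in> borel_measurable lebesgue"
    proof -
      have "(\<lambda>x. LINT y|lborel. prod_kernel m A kb x y * fb y) \<in> borel_measurable lborel"
        by (rule lborel.borel_measurable_lebesgue_integral) measurable
      then show ?thesis unfolding T_eq[abs_def] by (rule measurable_completion)
    qed
    have T_norm: "wLp_norm q (\<lambda>x. epowr (w x) q) (int_op ?K f) \<le> ennreal (E powr (1 / q)) * epowr X (1 / p)"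
    proof -
      have "(\<integral>\<^sup>+ x. ennreal (norm (int_op ?K f x) powr q) * epowr (w x) q \<partial>lebesgue) \<le> (\<integral>\<^sup>+ x. epowr (J x) q * epowr (w x) q \<partial>lebesgue)"
      proof (rule nn_integral_mono_AE)
        show "AE x in lebesgue. ennreal (norm (int_op ?K f x) powr q) * epowr (w x) q \<le> epowr (J x) q * epowr (w x) q"
          using ints
        proof eventually_elim
          case (elim x)
          have "ennreal (norm (int_op ?K f x)) \<le> (\<integral>\<^sup>+ y. ennreal (norm (?K x y * f y)) \<partial>lebesgue)"
            unfolding int_op_def by (rule integral_norm_bound_ennreal[OF elim])
          then have "ennreal (norm (int_op ?K f x)) \<le> J x" by (rule order_trans[OF _ J_ge])
          then have "epowr (ennreal (norm (int_op ?K f x))) q \<le> epowr (J x) q" using q0 by (intro epowr_mono) auto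
          then show ?case using q0 by (intro mult_right_mono) (auto simp: epowr_ennreal)
        qed
      qed
      also note J_int
      finally have "wLp_norm q (\<lambda>x. epowr (w x) q) (int_op ?K f) \<le> epowr (ennreal E * epowr X (q / p)) (1 / q)"
        unfolding wLp_norm_def using q0 by (intro epowr_mono) auto
      also have "\<dots> = ennreal (E powr (1 / q)) * epowr X (1 / p)"
        using E q0 p1 by (simp add: epowr_mult epowr_ennreal epowr_epowr)
      finally show ?thesis .
    qed
    have "ennreal (E powr (1 / q)) * epowr X (1 / p) < top"
      using X p1 epowr_less_top[of "1 / p" X] by (simp add: ennreal_mult_less_top)
    then have "int_op ?K f \<in> wLp q (\<lambda>x. epowr (w x) q)"
      using T_meas order_le_less_trans[OF T_norm] by (simp add: wLp_def)
    then show ?thesis using ints T_norm X_norm by simp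
  qed
  then show ?thesis unfolding int_op_bounded_def by (intro exI[of _ "E powr (1 / q)"] ballI)
qed

end
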